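(* Let $\mathcal{A}=(A,B,C,t_B,t_C,\Delta_B,\Delta_C)$ and $\mathcal{D}=(D,E,F,t_E,t_F,\Delta_E,\Delta_F)$ be regular multiplier Hopf algebroids with antipodes $S_A$ and $S_D$, respectively, and let $\pi\colon D\to M(A)$ be a morphism from $\mathcal{D}$ to $\mathcal{A}$. Then $\pi\circ S_D=S_A\circ\pi$ (where $S_A$ is extended to $M(A)$).
   Context: Conventions. All algebras are complex and associative, not necessarily unital; products of subspaces are linear spans; $\iota$ denotes identity maps. An algebra $A$ is non-degenerate if $aA=0$ or $Aa=0$ only for $a=0$, and idempotent if $AA=A$; $M(A)$ is its multiplier algebra. A module over $B$ is non-degenerate if no non-zero element is annihilated by $B$, and idempotent if it is spanned by products with elements of $B$. For commuting subalgebras $B,C\subseteq M(A)$ with anti-isomorphisms $t_B\colon B\to C$, $t_C\colon C\to B$, write ${}_BA,A_B,{}_CA,A_C$ for $A$ with left/right multiplication, and $A^B,{}^BA,A^C,{}^CA$ for $A$ with the structures $a\cdot x=t_B(x)a$, $x\cdot a=at_B(x)$, $a\cdot y=t_C(y)a$, $y\cdot a=at_C(y)$ ($x\in B$, $y\in C$). Balanced tensor products are written $A^C\otimes{}_CA$ (over $C$), $A_B\otimes{}^BA$ (over $B$), etc. $A^C\otimes{}_CA$ is a right and $A_B\otimes{}^BA$ a left $M(A)\otimes M(A)$-module; endomorphisms in $\operatorname{End}(A_B\otimes{}^BA)^{\mathrm{op}}$ are written on the right. $A^C\overline{\times}{}_CA\subseteq\operatorname{End}(A^C\otimes{}_CA)$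 consists of all $T$ such that for all $a,b\in A$ there are $T(a\otimes1),T(1\otimes b)\in A^C\otimes{}_CA$ with $T(a\otimes b)=(T(a\otimes1))(1\otimes b)=(T(1\otimes b))(a\otimes1)$; $A_B\overline{\times}{}^BA\subseteq\operatorname{End}(A_B\otimes{}^BA)^{\mathrm{op}}$ consists of all $T$ such that for all $a,b$ there are $(a\otimes1)T,(1\otimes b)T\in A_B\otimes{}^BA$ with $(a\otimes b)T=(1\otimes b)((a\otimes1)T)=(a\otimes1)((1\otimes b)T)$. A multiplier bialgebroid $(A,B,C,t_B,t_C,\Delta_B,\Delta_C)$ consists of a non-degenerate idempotent algebra $A$, subalgebras $B,C\subseteq M(A)$, anti-isomorphisms $t_B\colon B\to C$, $t_C\colon C\to B$, and homomorphisms $\Delta_C\colon A\to A^C\overline{\times}{}_CA$ (left comultiplication), $\Delta_B\colon A\to A_B\overline{\times}{}^BA$ (right comultiplication) such that: (1) $B$ and $C$ commute and ${}_BA,A_B,{}_CA,A_C$ are non-degenerate and idempotent; (2) $A^C\otimes{}_CA$ is non-degenerate as a right module over $1\otimes A$ and over $A\otimes1$, and $A_B\otimes{}^BA$ as a left module over $1\otimes A$ and over $A\otimes1$; (3) $\Delta_C(xyax'y')=(y\otimes x)\Delta_C(a)(y'\otimes x')$ and $\Delta_B(xyax'y')=(y\otimes x)\Delta_B(a)(y'\otimes x')$ for $x,x'\in B$, $y,y'\in C$, $a\in A$; (4) for all $a,b,c\in A$: $(\Delta_C\otimes\iota)(\Delta_C(b)(1\otimes c))(a\otimes1\otimes1)=(\iota\otimes\Delta_C)(\Delta_C(b)(a\otimes1))(1\otimes1\otimes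 c)$; $(a\otimes1\otimes1)(\Delta_B\otimes\iota)((1\otimes c)\Delta_B(b))=(1\otimes1\otimes c)(\iota\otimes\Delta_B)((a\otimes1)\Delta_B(b))$; $(\Delta_C\otimes\iota)((1\otimes c)\Delta_B(b))(a\otimes1\otimes1)=(1\otimes1\otimes c)(\iota\otimes\Delta_B)(\Delta_C(b)(a\otimes1))$; $(a\otimes1\otimes1)(\Delta_B\otimes\iota)(\Delta_C(b)(1\otimes c))=(\iota\otimes\Delta_C)((a\otimes1)\Delta_B(b))(1\otimes1\otimes c)$. It is a regular multiplier Hopf algebroid if there exist (then unique) a left counit ${}_C\varepsilon\colon A\to C$, a right counit $\varepsilon_B\colon A\to B$ and an antipode $S$, i.e.: ${}_C\varepsilon(ya)=y\,{}_C\varepsilon(a)$, ${}_C\varepsilon(t_C(y)a)={}_C\varepsilon(a)y$, and $({}_C\varepsilon\odot\iota)(\Delta_C(a)(1\otimes b))=ab=(\iota\odot{}_C\varepsilon)(\Delta_C(a)(b\otimes1))$, where $({}_C\varepsilon\odot\iota)(a\otimes b)={}_C\varepsilon(a)b$, $(\iota\odot{}_C\varepsilon)(a\otimes b)=t_C({}_C\varepsilon(b))a$; $\varepsilon_B(ax)=\varepsilon_B(a)x$, $\varepsilon_B(at_B(x))=x\varepsilon_B(a)$, and $(\varepsilon_B\odot\iota)((1\otimes b)\Delta_B(a))=ba=(\iota\odot\varepsilon_B)((b\otimes1)\Delta_B(a))$, where $(\varepsilon_B\odot\iota)(a\otimes b)=bt_B(\varepsilon_B(a))$, $(\iota\odot\varepsilon_B)(a\otimes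 b)=a\varepsilon_B(b)$; $S$ is an anti-automorphism of $A$ whose extension to $M(A)$ satisfies $S|_B=t_C^{-1}$, $S|_C=t_B^{-1}$, and, with $m$ the multiplication, $m(S\otimes\iota)(\Delta_C(a)(1\otimes b))=\varepsilon_B(a)b$ and $m(\iota\otimes S)((a\otimes1)\Delta_B(b))=a\,{}_C\varepsilon(b)$. Morphisms. For $T\in M(A)$, $\Delta_B(T)$ and $\Delta_C(T)$ denote the unique endomorphisms of the left $A\otimes A$-module $A_B\otimes{}^BA$ (acting from the right) and of the right $A\otimes A$-module $A^C\otimes{}_CA$ with $(a\otimes b)\Delta_B(c)\Delta_B(T)=(a\otimes b)\Delta_B(cT)$ and $\Delta_C(T)\Delta_C(a)(b\otimes c)=\Delta_C(Ta)(b\otimes c)$. For $\mathcal D=(D,E,F,t_E,t_F,\Delta_E,\Delta_F)$ ($E,F$ playing the roles of $B,C$), a morphism from $\mathcal D$ to $\mathcal A$ is a non-degenerate homomorphism $\pi\colon D\to M(A)$ ($\pi(D)A=A=A\pi(D)$; extended to $M(D)$) such that $\pi(E)B=B=B\pi(E)$, $\pi\circ t_E=t_B\circ\pi$, $\pi(F)C=C=C\pi(F)$, $\pi\circ t_F=t_C\circ\pi$ (with $t_B,t_C$ extended to multipliers), and for all $d,d',d''\in D$, $a',a''\in A$: $(a'\pi(d')\otimes a''\pi(d''))\Delta_B(\pi(d))=(a'\otimes a'')(\pi\otimes\pi)((d'\otimes d'')\Delta_E(d))$ in $A_B\otimes{}^BA$ and $\Delta_C(\pi(d))(\pi(d')a'\otimes\pi(d'')a'')=(\pi\otimes\pi)(\Delta_F(d)(d'\otimes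 d''))(a'\otimes a'')$ in $A^C\otimes{}_CA$. *)

theory Defs
  imports Complex_Main "HOL-Library.Poly_Mapping" "HOL-Library.FuncSet"
begin

section \<open>Complex vector spaces and algebras without unit\<close>

class complex_vector = ab_group_add +
  fixes scaleC :: "complex \<Rightarrow> 'a \<Rightarrow> 'a" (infixr "*\<^sub>C" 75)
  assumes scaleC_add_right: "c *\<^sub>C (x + y) = c *\<^sub>C x + c *\<^sub>C y"
    and scaleC_add_left: "(c + d) *\<^sub>C x = c *\<^sub>C x + d *\<^sub>C x"
    and scaleC_scaleC: "c *\<^sub>C d *\<^sub>C x = (c * d) *\<^sub>C x"
    and scaleC_one: "1 *\<^sub>C x = x"

interpretation complex_vector: vector_space "scaleC :: complex \<Rightarrow> 'a \<Rightarrow> 'a::complex_vector"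
  by unfold_locales (simp_all add: scaleC_add_right scaleC_add_left scaleC_scaleC scaleC_one)

abbreviation csubspace :: "'a::complex_vector set \<Rightarrow> bool"
  where "csubspace \<equiv> module.subspace scaleC"

abbreviation cspan :: "'a::complex_vector set \<Rightarrow> 'a set"
  where "cspan \<equiv> module.span scaleC"

abbreviation clinear :: "('a::complex_vector \<Rightarrow> 'b::complex_vector) \<Rightarrow> bool"
  where "clinear \<equiv> Vector_Spaces.linear scaleC scaleC"

class complex_algebra = complex_vector + ring +
  assumes mult_scaleC_left: "(c *\<^sub>C x) * y = c *\<^sub>C (x * y)"
    and mult_scaleC_right: "x * (c *\<^sub>C y) = c *\<^sub>C (x * y)"

text \<open>Free vector spaces: finitely supported functions.\<close>

instantiation poly_mapping :: (type, complex_vector) complex_vector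
begin

definition scaleC_poly_mapping :: "complex \<Rightarrow> ('a \<Rightarrow>\<^sub>0 'b) \<Rightarrow> ('a \<Rightarrow>\<^sub>0 'b)"
  where "scaleC_poly_mapping c f = Poly_Mapping.map ((*\<^sub>C) c) f"

lemma lookup_scaleC:
  "Poly_Mapping.lookup (c *\<^sub>C f) x = c *\<^sub>C Poly_Mapping.lookup f x"
  by (auto simp: scaleC_poly_mapping_def Poly_Mapping.map.rep_eq when_def)

instance
  by standard (auto intro!: poly_mapping_eqI simp: lookup_scaleC lookup_add
      scaleC_add_right scaleC_add_left scaleC_scaleC scaleC_one)

end

instantiation complex :: complex_algebra
begin

definition scaleC_complex :: "complex \<Rightarrow> complex \<Rightarrow> complex"
  where "scaleC_complex c x = c * x"

instance
  by standard (simp_all add: scaleC_complex_def algebra_simps)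

end

definition nondegenerate_algebra :: "'a::complex_algebra itself \<Rightarrow> bool"
  where "nondegenerate_algebra _ \<longleftrightarrow>
    (\<forall>a::'a. (\<forall>b. a * b = 0) \<longrightarrow> a = 0) \<and> (\<forall>a::'a. (\<forall>b. b * a = 0) \<longrightarrow> a = 0)"

definition idempotent_algebra :: "'a::complex_algebra itself \<Rightarrow> bool"
  where "idempotent_algebra _ \<longleftrightarrow> cspan {a * b |a b::'a. True} = UNIV"


section \<open>Multipliers\<close>

text \<open>
  A multiplier is a double centralizer \<open>T = (L, R)\<close>, where \<open>L a\<close> is the product \<open>T a\<close>
  and \<open>R a\<close> is the product \<open>a T\<close>.
\<close>

typedef (overloaded) 'a multiplier = "{(L, R) |L R :: 'a::complex_algebra \<Rightarrow> 'a.
    clinear L \<and> clinear R \<and> (\<forall>a b. L (a * b) = L a * b) \<and> (\<forall>a b. R (a * b) = a * R b) \<and>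
    (\<forall>a b. a * L b = R a * b)}"
  by (intro exI[of _ "(\<lambda>x. x, \<lambda>x. x)"]) (simp add: complex_vector.linear_id[unfolded id_def])

setup_lifting type_definition_multiplier

lift_definition mult_left :: "'a::complex_algebra multiplier \<Rightarrow> 'a \<Rightarrow> 'a" (infixr "\<rhd>" 75)
  is fst .

lift_definition mult_right :: "'a \<Rightarrow> 'a::complex_algebra multiplier \<Rightarrow> 'a" (infixl "\<lhd>" 75)
  is "\<lambda>a T. snd T a" .

lemma multiplier_eqI:
  "(\<And>a. S \<rhd> a = T \<rhd> a) \<Longrightarrow> (\<And>a. a \<lhd> S = a \<lhd> T) \<Longrightarrow> S = T"
  by transfer (auto intro!: prod_eqI)

lemma clinearI:
  "(\<And>x y. f (x + y) = f x + f y) \<Longrightarrow> (\<And>c x. f (c *\<^sub>C x) = c *\<^sub>C f x) \<Longrightarrow> clinear f"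
  by unfold_locales auto

lemma clinear_rules:
  assumes "clinear f"
  shows "f (x + y) = f x + f y" "f (c *\<^sub>C x) = c *\<^sub>C f x" "f 0 = 0" "f (x - y) = f x - f y"
    "f (- x) = - f x"
proof -
  interpret Vector_Spaces.linear scaleC scaleC f by fact
  show "f (x + y) = f x + f y" "f (c *\<^sub>C x) = c *\<^sub>C f x" "f 0 = 0" "f (x - y) = f x - f y"
    "f (- x) = - f x"
    by (simp_all add: add scale zero diff neg)
qed

instantiation multiplier :: (complex_algebra) "{complex_algebra, one}"
begin

lift_definition zero_multiplier :: "'a multiplier" is "(\<lambda>a. 0, \<lambda>a. 0)"
  by (auto intro!: clinearI)

lift_definition one_multiplier :: "'a multiplier" is "(\<lambda>a. a, \<lambda>a. a)"
  by (auto intro!: clinearI)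

lift_definition plus_multiplier :: "'a multiplier \<Rightarrow> 'a multiplier \<Rightarrow> 'a multiplier"
  is "\<lambda>S T. (\<lambda>a. fst S a + fst T a, \<lambda>a. snd S a + snd T a)"
  by (auto intro!: clinearI simp: clinear_rules scaleC_add_right algebra_simps)

lift_definition uminus_multiplier :: "'a multiplier \<Rightarrow> 'a multiplier"
  is "\<lambda>S. (\<lambda>a. - fst S a, \<lambda>a. - snd S a)"
  by (auto intro!: clinearI simp: clinear_rules)

lift_definition minus_multiplier :: "'a multiplier \<Rightarrow> 'a multiplier \<Rightarrow> 'a multiplier"
  is "\<lambda>S T. (\<lambda>a. fst S a - fst T a, \<lambda>a. snd S a - snd T a)"
  by (auto intro!: clinearI simp: clinear_rules algebra_simps complex_vector.scale_right_diff_distrib)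

lift_definition times_multiplier :: "'a multiplier \<Rightarrow> 'a multiplier \<Rightarrow> 'a multiplier"
  is "\<lambda>S T. (\<lambda>a. fst S (fst T a), \<lambda>a. snd T (snd S a))"
  by (auto intro!: clinearI simp: clinear_rules)

lift_definition scaleC_multiplier :: "complex \<Rightarrow> 'a multiplier \<Rightarrow> 'a multiplier"
  is "\<lambda>c S. (\<lambda>a. c *\<^sub>C fst S a, \<lambda>a. c *\<^sub>C snd S a)"
  by (auto intro!: clinearI simp: clinear_rules scaleC_add_right scaleC_scaleC
      mult_scaleC_left mult_scaleC_right mult.commute)

lemma mult_left_simps [simp]:
  "0 \<rhd> a = 0" "1 \<rhd> a = a" "(S + T) \<rhd> a = S \<rhd> a + T \<rhd> a" "(- S) \<rhd> a = - (S \<rhd> a)"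
  "(S - T) \<rhd> a = S \<rhd> a - T \<rhd> a" "(S * T) \<rhd> a = S \<rhd> (T \<rhd> a)"
  "(c *\<^sub>C S) \<rhd> a = c *\<^sub>C (S \<rhd> a)"
  by (transfer; simp)+

lemma mult_right_simps [simp]:
  "a \<lhd> 0 = 0" "a \<lhd> 1 = a" "a \<lhd> (S + T) = a \<lhd> S + a \<lhd> T" "a \<lhd> (- S) = - (a \<lhd> S)"
  "a \<lhd> (S - T) = a \<lhd> S - a \<lhd> T" "a \<lhd> (S * T) = a \<lhd> S \<lhd> T"
  "a \<lhd> (c *\<^sub>C S) = c *\<^sub>C (a \<lhd> S)"
  by (transfer; simp)+

lemma clinear_mult_left: "clinear ((\<rhd>) T)"
  by transfer auto

lemma clinear_mult_right: "clinear (\<lambda>a. a \<lhd> T)"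
  by transfer auto

instance
  by standard (auto intro!: multiplier_eqI
      simp: clinear_rules[OF clinear_mult_left] clinear_rules[OF clinear_mult_right]
        scaleC_add_right scaleC_add_left scaleC_scaleC scaleC_one)

end

lift_definition multiplier_of :: "'a::complex_algebra \<Rightarrow> 'a multiplier"
  is "\<lambda>a. (\<lambda>b. a * b, \<lambda>b. b * a)"
  by (auto intro!: clinearI simp: algebra_simps mult_scaleC_left mult_scaleC_right)

definition subalgebra :: "'a::complex_algebra set \<Rightarrow> bool"
  where "subalgebra B \<longleftrightarrow> csubspace B \<and> (\<forall>x\<in>B. \<forall>y\<in>B. x * y \<in> B)"

definition anti_isomorphism ::
    "'a::complex_algebra set \<Rightarrow> 'b::complex_algebra set \<Rightarrow> ('a \<Rightarrow> 'b) \<Rightarrow> bool"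
  where "anti_isomorphism B C t \<longleftrightarrow> bij_betw t B C \<and>
    (\<forall>x\<in>B. \<forall>y\<in>B. t (x + y) = t x + t y \<and> t (x * y) = t y * t x) \<and>
    (\<forall>c. \<forall>x\<in>B. t (c *\<^sub>C x) = c *\<^sub>C t x)"

text \<open>
  If \<open>A\<close> is non-degenerate and idempotent as a left and as a right \<open>B\<close>-module, then \<open>M(B)\<close>
  is identified with the following subalgebra of \<open>M(A)\<close>.
\<close>

definition multipliers_of_subalgebra :: "'a::complex_algebra multiplier set \<Rightarrow> 'a multiplier set"
  where "multipliers_of_subalgebra B = {T. \<forall>x\<in>B. T * x \<in> B \<and> x * T \<in> B}"

text \<open>Extension of an anti-isomorphism \<open>t: B \<rightarrow> C\<close> to a map \<open>M(B) \<rightarrow> M(C)\<close>.\<close>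

definition extend_base_anti ::
    "'a::complex_algebra multiplier set \<Rightarrow> 'a multiplier set \<Rightarrow>
     ('a multiplier \<Rightarrow> 'a multiplier) \<Rightarrow> 'a multiplier \<Rightarrow> 'a multiplier"
  where "extend_base_anti B C t T = (THE T'. T' \<in> multipliers_of_subalgebra C \<and>
    (\<forall>x\<in>B. T' * t x = t (x * T) \<and> t x * T' = t (T * x)))"

text \<open>Extension of an anti-automorphism of \<open>A\<close> to \<open>M(A)\<close>.\<close>

definition extend_anti :: "('a::complex_algebra \<Rightarrow> 'a) \<Rightarrow> 'a multiplier \<Rightarrow> 'a multiplier"
  where "extend_anti S T = (THE T'. \<forall>a. T' \<rhd> S a = S (a \<lhd> T) \<and> S a \<lhd> T' = S (T \<rhd> a))"

definition nondegenerate_hom :: "('d::complex_algebra \<Rightarrow> 'a::complex_algebra multiplier) \<Rightarrow> bool"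
  where "nondegenerate_hom \<pi> \<longleftrightarrow> clinear \<pi> \<and> (\<forall>d d'. \<pi> (d * d') = \<pi> d * \<pi> d') \<and>
    cspan {\<pi> d \<rhd> a |d a. True} = UNIV \<and> cspan {a \<lhd> \<pi> d |a d. True} = UNIV"

text \<open>Extension of a non-degenerate homomorphism \<open>D \<rightarrow> M(A)\<close> to \<open>M(D)\<close>.\<close>

definition extend_hom ::
    "('d::complex_algebra \<Rightarrow> 'a::complex_algebra multiplier) \<Rightarrow> 'd multiplier \<Rightarrow> 'a multiplier"
  where "extend_hom \<pi> T = (THE T'. \<forall>d. T' * \<pi> d = \<pi> (T \<rhd> d) \<and> \<pi> d * T' = \<pi> (d \<lhd> T))"


section \<open>Quotients of vector spaces\<close>

text \<open>The quotient of \<open>V\<close> by a subspace \<open>N\<close> is the set of cosets, with the following operations.\<close>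

definition qclass :: "'v::complex_vector set \<Rightarrow> 'v \<Rightarrow> 'v set"
  where "qclass N u = {v. v - u \<in> N}"

definition qspace :: "'v::complex_vector set \<Rightarrow> 'v set set"
  where "qspace N = range (qclass N)"

definition qadd :: "'v::complex_vector set \<Rightarrow> 'v set \<Rightarrow> 'v set \<Rightarrow> 'v set"
  where "qadd N X Y = (\<Union>u\<in>X. \<Union>v\<in>Y. qclass N (u + v))"

definition qscale :: "'v::complex_vector set \<Rightarrow> complex \<Rightarrow> 'v set \<Rightarrow> 'v set"
  where "qscale N c X = (\<Union>u\<in>X. qclass N (c *\<^sub>C u))"

definition qEnd :: "'v::complex_vector set \<Rightarrow> ('v set \<Rightarrow> 'v set) set"
  where "qEnd N = {T. (\<forall>X\<in>qspace N. T X \<in> qspace N) \<and>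
    (\<forall>X\<in>qspace N. \<forall>Y\<in>qspace N. T (qadd N X Y) = qadd N (T X) (T Y)) \<and>
    (\<forall>c. \<forall>X\<in>qspace N. T (qscale N c X) = qscale N c (T X))}"

definition gen :: "'x \<Rightarrow> 'x \<Rightarrow>\<^sub>0 complex"
  where "gen x = Poly_Mapping.single x 1"

definition lin_ext :: "('x \<Rightarrow> 'v::complex_vector) \<Rightarrow> ('x \<Rightarrow>\<^sub>0 complex) \<Rightarrow> 'v"
  where "lin_ext f u = (\<Sum>x\<in>Poly_Mapping.keys u. Poly_Mapping.lookup u x *\<^sub>C f x)"

text \<open>
  Let \<open>X\<close> be an element of a quotient of the free vector space on \<open>'x\<close>.
  \<open>qlift M f X\<close> is the image of \<open>X\<close> under the linear map into the quotient by \<open>M\<close> that sends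
  the class of each generator \<open>x\<close> to \<open>f x\<close>; the unions run over all choices of representatives.
  \<open>qeval f X\<close> is the image of \<open>X\<close> under the linear map into a vector space \<open>'v\<close> that sends the
  class of each generator \<open>x\<close> to \<open>f x\<close>.  Both are used only where these maps are well-defined,
  that is, where \<open>f\<close> respects the relations defining the quotient.
\<close>

definition qlift ::
    "'v::complex_vector set \<Rightarrow> ('x \<Rightarrow> 'v set) \<Rightarrow> ('x \<Rightarrow>\<^sub>0 complex) set \<Rightarrow> 'v set"
  where "qlift M f X = (\<Union>u\<in>X. \<Union>g\<in>{g. \<forall>x. g x \<in> f x}. qclass M (lin_ext g u))"

definition qeval :: "('x \<Rightarrow> 'v::complex_vector) \<Rightarrow> ('x \<Rightarrow>\<^sub>0 complex) set \<Rightarrow> 'v"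
  where "qeval f X = the_elem (lin_ext f ` X)"


section \<open>Balanced tensor products\<close>

text \<open>
  A balanced tensor product of two (three) copies of \<open>A\<close> is the quotient of the free vector space
  on \<open>A \<times> A\<close> (on \<open>A \<times> A \<times> A\<close>) by the subspace spanned by the multilinearity relations and the
  balancing relations \<open>f a \<otimes> b = a \<otimes> g b\<close>, where \<open>(f, g)\<close> runs through a set of pairs of maps.
\<close>

type_synonym 'a tensor2 = "('a \<times> 'a) \<Rightarrow>\<^sub>0 complex"
type_synonym 'a tensor3 = "('a \<times> 'a \<times> 'a) \<Rightarrow>\<^sub>0 complex"
type_synonym 'a balance = "(('a \<Rightarrow> 'a) \<times> ('a \<Rightarrow> 'a)) set"

definition relations2 :: "'a::complex_algebra balance \<Rightarrow> 'a tensor2 set"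
  where "relations2 R = cspan (
    {gen (a + a', b) - gen (a, b) - gen (a', b) |a a' b. True} \<union>
    {gen (a, b + b') - gen (a, b) - gen (a, b') |a b b'. True} \<union>
    {gen (c *\<^sub>C a, b) - c *\<^sub>C gen (a, b) |c a b. True} \<union>
    {gen (a, c *\<^sub>C b) - c *\<^sub>C gen (a, b) |c a b. True} \<union>
    {gen (f a, b) - gen (a, g b) |f g a b. (f, g) \<in> R})"

definition relations3 :: "'a::complex_algebra balance \<Rightarrow> 'a balance \<Rightarrow> 'a tensor3 set"
  where "relations3 R R' = cspan (
    {gen (a + a', b, d) - gen (a, b, d) - gen (a', b, d) |a a' b d. True} \<union>
    {gen (a, b + b', d) - gen (a, b, d) - gen (a, b', d) |a b b' d. True} \<union>
    {gen (a, b, d + d') - gen (a, b, d) - gen (a, b, d') |a b d d'. True} \<union>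
    {gen (c *\<^sub>C a, b, d) - c *\<^sub>C gen (a, b, d) |c a b d. True} \<union>
    {gen (a, c *\<^sub>C b, d) - c *\<^sub>C gen (a, b, d) |c a b d. True} \<union>
    {gen (a, b, c *\<^sub>C d) - c *\<^sub>C gen (a, b, d) |c a b d. True} \<union>
    {gen (f a, b, d) - gen (a, g b, d) |f g a b d. (f, g) \<in> R} \<union>
    {gen (a, f b, d) - gen (a, b, g d) |f g a b d. (f, g) \<in> R'})"

definition tens :: "'a::complex_algebra tensor2 set \<Rightarrow> 'a \<Rightarrow> 'a \<Rightarrow> 'a tensor2 set"
  where "tens N a b = qclass N (gen (a, b))"

text \<open>\<open>(S \<otimes> T) X\<close> and \<open>X (S \<otimes> T)\<close> for multipliers \<open>S, T\<close>.\<close>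

definition lact :: "'a::complex_algebra tensor2 set \<Rightarrow> 'a multiplier \<Rightarrow> 'a multiplier \<Rightarrow>
    'a tensor2 set \<Rightarrow> 'a tensor2 set"
  where "lact N S T X = qlift N (\<lambda>(p, q). tens N (S \<rhd> p) (T \<rhd> q)) X"

definition ract :: "'a::complex_algebra tensor2 set \<Rightarrow> 'a tensor2 set \<Rightarrow>
    'a multiplier \<Rightarrow> 'a multiplier \<Rightarrow> 'a tensor2 set"
  where "ract N X S T = qlift N (\<lambda>(p, q). tens N (p \<lhd> S) (q \<lhd> T)) X"

text \<open>\<open>X \<otimes> q\<close> and \<open>p \<otimes> X\<close> in a threefold tensor product.\<close>

definition tens_right :: "'a::complex_algebra tensor3 set \<Rightarrow> 'a tensor2 set \<Rightarrow> 'a \<Rightarrow> 'a tensor3 set"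
  where "tens_right M X q = qlift M (\<lambda>(r, s). qclass M (gen (r, s, q))) X"

definition tens_left :: "'a::complex_algebra tensor3 set \<Rightarrow> 'a \<Rightarrow> 'a tensor2 set \<Rightarrow> 'a tensor3 set"
  where "tens_left M p X = qlift M (\<lambda>(r, s). qclass M (gen (p, r, s))) X"


section \<open>Multiplier bialgebroids\<close>

text \<open>
  The algebra \<open>A\<close> is the type \<open>'a\<close>.  The maps \<open>tB\<close> and \<open>tC\<close> matter only on \<open>B\<close> and \<open>C\<close>.
  \<open>\<Delta>C a X\<close> is the value of the endomorphism \<open>\<Delta>C a\<close> at \<open>X\<close>, and \<open>\<Delta>B a X\<close> is \<open>X \<Delta>B(a)\<close>, the
  endomorphism \<open>\<Delta>B a\<close> being written on the right.
\<close>

record (overloaded) ('a::complex_algebra) bialgebroid =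
  baseB :: "'a multiplier set"
  baseC :: "'a multiplier set"
  tB :: "'a multiplier \<Rightarrow> 'a multiplier"
  tC :: "'a multiplier \<Rightarrow> 'a multiplier"
  \<Delta>B :: "'a \<Rightarrow> 'a tensor2 set \<Rightarrow> 'a tensor2 set"
  \<Delta>C :: "'a \<Rightarrow> 'a tensor2 set \<Rightarrow> 'a tensor2 set"

text \<open>
  The relations \<open>t\<^sub>C(y) a \<otimes> b = a \<otimes> y b\<close> and \<open>a x \<otimes> b = a \<otimes> b t\<^sub>B(x)\<close>, and the resulting
  subspaces by which one divides to obtain \<open>A\<^sup>C \<otimes> \<^sub>CA\<close> and \<open>A\<^sub>B \<otimes> \<^sup>BA\<close>.
\<close>

definition balC :: "'a::complex_algebra bialgebroid \<Rightarrow> 'a balance"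
  where "balC \<A> = {(\<lambda>a. tC \<A> y \<rhd> a, \<lambda>b. y \<rhd> b) |y. y \<in> baseC \<A>}"

definition balB :: "'a::complex_algebra bialgebroid \<Rightarrow> 'a balance"
  where "balB \<A> = {(\<lambda>a. a \<lhd> x, \<lambda>b. b \<lhd> tB \<A> x) |x. x \<in> baseB \<A>}"

definition NC :: "'a::complex_algebra bialgebroid \<Rightarrow> 'a tensor2 set"
  where "NC \<A> = relations2 (balC \<A>)"

definition NB :: "'a::complex_algebra bialgebroid \<Rightarrow> 'a tensor2 set"
  where "NB \<A> = relations2 (balB \<A>)"

definition takeuchiC :: "'a::complex_algebra bialgebroid \<Rightarrow> ('a tensor2 set \<Rightarrow> 'a tensor2 set) set"
  where "takeuchiC \<A> = {T \<in> qEnd (NC \<A>).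
    (\<forall>a. \<exists>X\<in>qspace (NC \<A>). \<forall>b. T (tens (NC \<A>) a b) = ract (NC \<A>) X 1 (multiplier_of b)) \<and>
    (\<forall>b. \<exists>X\<in>qspace (NC \<A>). \<forall>a. T (tens (NC \<A>) a b) = ract (NC \<A>) X (multiplier_of a) 1)}"

definition takeuchiB :: "'a::complex_algebra bialgebroid \<Rightarrow> ('a tensor2 set \<Rightarrow> 'a tensor2 set) set"
  where "takeuchiB \<A> = {T \<in> qEnd (NB \<A>).
    (\<forall>a. \<exists>X\<in>qspace (NB \<A>). \<forall>b. T (tens (NB \<A>) a b) = lact (NB \<A>) 1 (multiplier_of b) X) \<and>
    (\<forall>b. \<exists>X\<in>qspace (NB \<A>). \<forall>a. T (tens (NB \<A>) a b) = lact (NB \<A>) (multiplier_of a) 1 X)}"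

text \<open>
  The elements \<open>\<Delta>C(b)(a \<otimes> 1)\<close>, \<open>\<Delta>C(b)(1 \<otimes> c)\<close>, \<open>(a \<otimes> 1)\<Delta>B(b)\<close> and \<open>(1 \<otimes> c)\<Delta>B(b)\<close>.
\<close>

definition \<Delta>C1 :: "'a::complex_algebra bialgebroid \<Rightarrow> 'a \<Rightarrow> 'a \<Rightarrow> 'a tensor2 set"
  where "\<Delta>C1 \<A> b a = (THE X. X \<in> qspace (NC \<A>) \<and>
    (\<forall>c. \<Delta>C \<A> b (tens (NC \<A>) a c) = ract (NC \<A>) X 1 (multiplier_of c)))"

definition \<Delta>C2 :: "'a::complex_algebra bialgebroid \<Rightarrow> 'a \<Rightarrow> 'a \<Rightarrow> 'a tensor2 set"
  where "\<Delta>C2 \<A> b c = (THE X. X \<in> qspace (NC \<A>) \<and>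
    (\<forall>a. \<Delta>C \<A> b (tens (NC \<A>) a c) = ract (NC \<A>) X (multiplier_of a) 1))"

definition \<Delta>B1 :: "'a::complex_algebra bialgebroid \<Rightarrow> 'a \<Rightarrow> 'a \<Rightarrow> 'a tensor2 set"
  where "\<Delta>B1 \<A> a b = (THE X. X \<in> qspace (NB \<A>) \<and>
    (\<forall>c. \<Delta>B \<A> b (tens (NB \<A>) a c) = lact (NB \<A>) 1 (multiplier_of c) X))"

definition \<Delta>B2 :: "'a::complex_algebra bialgebroid \<Rightarrow> 'a \<Rightarrow> 'a \<Rightarrow> 'a tensor2 set"
  where "\<Delta>B2 \<A> c b = (THE X. X \<in> qspace (NB \<A>) \<and>
    (\<forall>a. \<Delta>B \<A> b (tens (NB \<A>) a c) = lact (NB \<A>) (multiplier_of a) 1 X))"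

definition bialgebroid_base :: "'a::complex_algebra bialgebroid \<Rightarrow> bool"
  where "bialgebroid_base \<A> \<longleftrightarrow>
    subalgebra (baseB \<A>) \<and> subalgebra (baseC \<A>) \<and>
    anti_isomorphism (baseB \<A>) (baseC \<A>) (tB \<A>) \<and> anti_isomorphism (baseC \<A>) (baseB \<A>) (tC \<A>) \<and>
    (\<forall>x\<in>baseB \<A>. \<forall>y\<in>baseC \<A>. x * y = y * x) \<and>
    (\<forall>K\<in>{baseB \<A>, baseC \<A>}.
      (\<forall>a. (\<forall>x\<in>K. x \<rhd> a = 0) \<longrightarrow> a = 0) \<and> cspan {x \<rhd> a |x a. x \<in> K} = UNIV \<and>
      (\<forall>a. (\<forall>x\<in>K. a \<lhd> x = 0) \<longrightarrow> a = 0) \<and> cspan {a \<lhd> x |a x. x \<in> K} = UNIV)"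

definition bialgebroid_nondegenerate :: "'a::complex_algebra bialgebroid \<Rightarrow> bool"
  where "bialgebroid_nondegenerate \<A> \<longleftrightarrow>
    (\<forall>X\<in>qspace (NC \<A>). (\<forall>a. ract (NC \<A>) X 1 (multiplier_of a) = qclass (NC \<A>) 0) \<longrightarrow>
      X = qclass (NC \<A>) 0) \<and>
    (\<forall>X\<in>qspace (NC \<A>). (\<forall>a. ract (NC \<A>) X (multiplier_of a) 1 = qclass (NC \<A>) 0) \<longrightarrow>
      X = qclass (NC \<A>) 0) \<and>
    (\<forall>X\<in>qspace (NB \<A>). (\<forall>a. lact (NB \<A>) 1 (multiplier_of a) X = qclass (NB \<A>) 0) \<longrightarrow>
      X = qclass (NB \<A>) 0) \<and>
    (\<forall>X\<in>qspace (NB \<A>). (\<forall>a. lact (NB \<A>) (multiplier_of a) 1 X = qclass (NB \<A>) 0) \<longrightarrow>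
      X = qclass (NB \<A>) 0)"

text \<open>
  In \<open>\<Delta>B(a a') = \<Delta>B(a) \<Delta>B(a')\<close>, the factor \<open>\<Delta>B(a)\<close> acts first, since these endomorphisms act
  from the right.
\<close>

definition comultiplication_homs :: "'a::complex_algebra bialgebroid \<Rightarrow> bool"
  where "comultiplication_homs \<A> \<longleftrightarrow>
    (\<forall>a. \<Delta>C \<A> a \<in> takeuchiC \<A> \<and> \<Delta>B \<A> a \<in> takeuchiB \<A>) \<and>
    (\<forall>X\<in>qspace (NC \<A>). \<forall>a a' c.
      \<Delta>C \<A> (a + a') X = qadd (NC \<A>) (\<Delta>C \<A> a X) (\<Delta>C \<A> a' X) \<and>
      \<Delta>C \<A> (c *\<^sub>C a) X = qscale (NC \<A>) c (\<Delta>C \<A> a X) \<and>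
      \<Delta>C \<A> (a * a') X = \<Delta>C \<A> a (\<Delta>C \<A> a' X)) \<and>
    (\<forall>X\<in>qspace (NB \<A>). \<forall>a a' c.
      \<Delta>B \<A> (a + a') X = qadd (NB \<A>) (\<Delta>B \<A> a X) (\<Delta>B \<A> a' X) \<and>
      \<Delta>B \<A> (c *\<^sub>C a) X = qscale (NB \<A>) c (\<Delta>B \<A> a X) \<and>
      \<Delta>B \<A> (a * a') X = \<Delta>B \<A> a' (\<Delta>B \<A> a X))"

definition comultiplication_bimodule :: "'a::complex_algebra bialgebroid \<Rightarrow> bool"
  where "comultiplication_bimodule \<A> \<longleftrightarrow>
    (\<forall>x\<in>baseB \<A>. \<forall>x'\<in>baseB \<A>. \<forall>y\<in>baseC \<A>. \<forall>y'\<in>baseC \<A>. \<forall>a b c.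
      \<Delta>C \<A> ((x \<rhd> y \<rhd> a) \<lhd> x' \<lhd> y') (tens (NC \<A>) b c) =
        lact (NC \<A>) y x (\<Delta>C \<A> a (tens (NC \<A>) (y' \<rhd> b) (x' \<rhd> c))) \<and>
      \<Delta>B \<A> ((x \<rhd> y \<rhd> a) \<lhd> x' \<lhd> y') (tens (NB \<A>) b c) =
        ract (NB \<A>) (\<Delta>B \<A> a (tens (NB \<A>) (b \<lhd> y) (c \<lhd> x))) y' x')"

text \<open>
  The four coassociativity conditions, which are identities in
  \<open>A\<^sup>C \<otimes> \<^sub>CA\<^sup>C \<otimes> \<^sub>CA\<close>, \<open>A\<^sub>B \<otimes> \<^sup>BA\<^sub>B \<otimes> \<^sup>BA\<close>, \<open>A\<^sup>C \<otimes> \<^sub>CA\<^sub>B \<otimes> \<^sup>BA\<close> and \<open>A\<^sub>B \<otimes> \<^sup>BA\<^sup>C \<otimes> \<^sub>CA\<close>, respectively.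
  For example, \<open>(\<Delta>C \<otimes> \<iota>)(X)(a \<otimes> 1 \<otimes> 1)\<close> is the image of \<open>X\<close> under the linear map
  \<open>p \<otimes> q \<mapsto> \<Delta>C(p)(a \<otimes> 1) \<otimes> q\<close>.
\<close>

definition coassociative :: "'a::complex_algebra bialgebroid \<Rightarrow> bool"
  where "coassociative \<A> \<longleftrightarrow> (\<forall>a b c.
    (let M = relations3 (balC \<A>) (balC \<A>) in
      qlift M (\<lambda>(p, q). tens_right M (\<Delta>C1 \<A> p a) q) (\<Delta>C2 \<A> b c) =
      qlift M (\<lambda>(p, q). tens_left M p (\<Delta>C2 \<A> q c)) (\<Delta>C1 \<A> b a)) \<and>
    (let M = relations3 (balB \<A>) (balB \<A>) in
      qlift M (\<lambda>(p, q). tens_right M (\<Delta>B1 \<A> a p) q) (\<Delta>B2 \<A> c b) =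
      qlift M (\<lambda>(p, q). tens_left M p (\<Delta>B2 \<A> c q)) (\<Delta>B1 \<A> a b)) \<and>
    (let M = relations3 (balC \<A>) (balB \<A>) in
      qlift M (\<lambda>(p, q). tens_right M (\<Delta>C1 \<A> p a) q) (\<Delta>B2 \<A> c b) =
      qlift M (\<lambda>(p, q). tens_left M p (\<Delta>B2 \<A> c q)) (\<Delta>C1 \<A> b a)) \<and>
    (let M = relations3 (balB \<A>) (balC \<A>) in
      qlift M (\<lambda>(p, q). tens_right M (\<Delta>B1 \<A> a p) q) (\<Delta>C2 \<A> b c) =
      qlift M (\<lambda>(p, q). tens_left M p (\<Delta>C2 \<A> q c)) (\<Delta>B1 \<A> a b)))"

definition multiplier_bialgebroid :: "'a::complex_algebra bialgebroid \<Rightarrow> bool"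
  where "multiplier_bialgebroid \<A> \<longleftrightarrow>
    nondegenerate_algebra TYPE('a) \<and> idempotent_algebra TYPE('a) \<and>
    bialgebroid_base \<A> \<and> bialgebroid_nondegenerate \<A> \<and>
    comultiplication_homs \<A> \<and> comultiplication_bimodule \<A> \<and> coassociative \<A>"


section \<open>Regular multiplier Hopf algebroids\<close>

definition left_counit ::
    "'a::complex_algebra bialgebroid \<Rightarrow> ('a \<Rightarrow> 'a multiplier) \<Rightarrow> bool"
  where "left_counit \<A> \<epsilon> \<longleftrightarrow> clinear \<epsilon> \<and> range \<epsilon> \<subseteq> baseC \<A> \<and>
    (\<forall>y\<in>baseC \<A>. \<forall>a. \<epsilon> (y \<rhd> a) = y * \<epsilon> a \<and> \<epsilon> (tC \<A> y \<rhd> a) = \<epsilon> a * y) \<and>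
    (\<forall>a b. qeval (\<lambda>(p, q). \<epsilon> p \<rhd> q) (\<Delta>C2 \<A> a b) = a * b \<and>
           qeval (\<lambda>(p, q). tC \<A> (\<epsilon> q) \<rhd> p) (\<Delta>C1 \<A> a b) = a * b)"

definition right_counit ::
    "'a::complex_algebra bialgebroid \<Rightarrow> ('a \<Rightarrow> 'a multiplier) \<Rightarrow> bool"
  where "right_counit \<A> \<epsilon> \<longleftrightarrow> clinear \<epsilon> \<and> range \<epsilon> \<subseteq> baseB \<A> \<and>
    (\<forall>x\<in>baseB \<A>. \<forall>a. \<epsilon> (a \<lhd> x) = \<epsilon> a * x \<and> \<epsilon> (a \<lhd> tB \<A> x) = x * \<epsilon> a) \<and>
    (\<forall>a b. qeval (\<lambda>(p, q). q \<lhd> tB \<A> (\<epsilon> p)) (\<Delta>B2 \<A> b a) = b * a \<and>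
           qeval (\<lambda>(p, q). p \<lhd> \<epsilon> q) (\<Delta>B1 \<A> b a) = b * a)"

definition antipode_wrt ::
    "'a::complex_algebra bialgebroid \<Rightarrow> ('a \<Rightarrow> 'a multiplier) \<Rightarrow> ('a \<Rightarrow> 'a multiplier) \<Rightarrow>
     ('a \<Rightarrow> 'a) \<Rightarrow> bool"
  where "antipode_wrt \<A> \<epsilon>C \<epsilon>B S \<longleftrightarrow> anti_isomorphism UNIV UNIV S \<and>
    (\<forall>x\<in>baseB \<A>. extend_anti S x = inv_into (baseC \<A>) (tC \<A>) x) \<and>
    (\<forall>y\<in>baseC \<A>. extend_anti S y = inv_into (baseB \<A>) (tB \<A>) y) \<and>
    (\<forall>a b. qeval (\<lambda>(p, q). S p * q) (\<Delta>C2 \<A> a b) = \<epsilon>B a \<rhd> b \<and>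
           qeval (\<lambda>(p, q). p * S q) (\<Delta>B1 \<A> a b) = a \<lhd> \<epsilon>C b)"

definition antipode :: "'a::complex_algebra bialgebroid \<Rightarrow> ('a \<Rightarrow> 'a) \<Rightarrow> bool"
  where "antipode \<A> S \<longleftrightarrow>
    (\<exists>\<epsilon>C \<epsilon>B. left_counit \<A> \<epsilon>C \<and> right_counit \<A> \<epsilon>B \<and> antipode_wrt \<A> \<epsilon>C \<epsilon>B S)"

definition regular_multiplier_Hopf_algebroid :: "'a::complex_algebra bialgebroid \<Rightarrow> bool"
  where "regular_multiplier_Hopf_algebroid \<A> \<longleftrightarrow>
    multiplier_bialgebroid \<A> \<and> (\<exists>S. antipode \<A> S)"


section \<open>Morphisms\<close>

text \<open>
  The comultiplications of multipliers.  Membership in \<open>extensional\<close> only fixes values outside the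
  tensor product so that the endomorphism is unique as a function.
\<close>

definition \<Delta>B_ext :: "'a::complex_algebra bialgebroid \<Rightarrow> 'a multiplier \<Rightarrow>
    'a tensor2 set \<Rightarrow> 'a tensor2 set"
  where "\<Delta>B_ext \<A> T = (THE \<Theta>. \<Theta> \<in> qEnd (NB \<A>) \<inter> extensional (qspace (NB \<A>)) \<and>
    (\<forall>X\<in>qspace (NB \<A>). \<forall>a b. \<Theta> (lact (NB \<A>) (multiplier_of a) (multiplier_of b) X) =
      lact (NB \<A>) (multiplier_of a) (multiplier_of b) (\<Theta> X)) \<and>
    (\<forall>a b c. \<Theta> (\<Delta>B \<A> c (tens (NB \<A>) a b)) = \<Delta>B \<A> (c \<lhd> T) (tens (NB \<A>) a b)))"

definition \<Delta>C_ext :: "'a::complex_algebra bialgebroid \<Rightarrow> 'a multiplier \<Rightarrow>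
    'a tensor2 set \<Rightarrow> 'a tensor2 set"
  where "\<Delta>C_ext \<A> T = (THE \<Theta>. \<Theta> \<in> qEnd (NC \<A>) \<inter> extensional (qspace (NC \<A>)) \<and>
    (\<forall>X\<in>qspace (NC \<A>). \<forall>a b. \<Theta> (ract (NC \<A>) X (multiplier_of a) (multiplier_of b)) =
      ract (NC \<A>) (\<Theta> X) (multiplier_of a) (multiplier_of b)) \<and>
    (\<forall>a b c. \<Theta> (\<Delta>C \<A> a (tens (NC \<A>) b c)) = \<Delta>C \<A> (T \<rhd> a) (tens (NC \<A>) b c)))"

definition morphism :: "'d::complex_algebra bialgebroid \<Rightarrow> 'a::complex_algebra bialgebroid \<Rightarrow>
    ('d \<Rightarrow> 'a multiplier) \<Rightarrow> bool"
  where "morphism \<D> \<A> \<pi> \<longleftrightarrow> nondegenerate_hom \<pi> \<and>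
    cspan {extend_hom \<pi> x * b |x b. x \<in> baseB \<D> \<and> b \<in> baseB \<A>} = baseB \<A> \<and>
    cspan {b * extend_hom \<pi> x |x b. x \<in> baseB \<D> \<and> b \<in> baseB \<A>} = baseB \<A> \<and>
    (\<forall>x\<in>baseB \<D>. extend_hom \<pi> (tB \<D> x) =
      extend_base_anti (baseB \<A>) (baseC \<A>) (tB \<A>) (extend_hom \<pi> x)) \<and>
    cspan {extend_hom \<pi> y * c |y c. y \<in> baseC \<D> \<and> c \<in> baseC \<A>} = baseC \<A> \<and>
    cspan {c * extend_hom \<pi> y |y c. y \<in> baseC \<D> \<and> c \<in> baseC \<A>} = baseC \<A> \<and>
    (\<forall>y\<in>baseC \<D>. extend_hom \<pi> (tC \<D> y) =
      extend_base_anti (baseC \<A>) (baseB \<A>) (tC \<A>) (extend_hom \<pi> y)) \<and>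
    (\<forall>d d' d'' a' a''.
      \<Delta>B_ext \<A> (\<pi> d) (tens (NB \<A>) (a' \<lhd> \<pi> d') (a'' \<lhd> \<pi> d'')) =
        qlift (NB \<A>) (\<lambda>(p, q). tens (NB \<A>) (a' \<lhd> \<pi> p) (a'' \<lhd> \<pi> q))
          (\<Delta>B \<D> d (tens (NB \<D>) d' d'')) \<and>
      \<Delta>C_ext \<A> (\<pi> d) (tens (NC \<A>) (\<pi> d' \<rhd> a') (\<pi> d'' \<rhd> a'')) =
        qlift (NC \<A>) (\<lambda>(p, q). tens (NC \<A>) (\<pi> p \<rhd> a') (\<pi> q \<rhd> a''))
          (\<Delta>C \<D> d (tens (NC \<D>) d' d'')))"

end

theory Submission
  imports Defs
begin

text \<open>
  Write \<open>\<Delta>\<^sub>C(a) = a\<^sub>1 \<otimes> a\<^sub>2\<close> and \<open>\<Delta>\<^sub>B(a) = a\<^sup>1 \<otimes> a\<^sup>2\<close> in Sweedler's manner, and use the names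
  \<open>B\<close>, \<open>C\<close>, \<open>\<epsilon>\<close>, \<open>S\<close> for \<open>\<D>\<close> as for \<open>\<A>\<close>.  For Hopf algebras,
  \<open>\<pi> \<circ> S\<close> and \<open>S \<circ> \<pi>\<close> agree because both are convolution inverses of \<open>\<pi>\<close>.  Here the two antipode
  identities concern different comultiplications, and what joins them is the mixed coassociativity
  \<open>d\<^sub>1 \<otimes> d\<^sub>2\<^sup>1 \<otimes> d\<^sub>2\<^sup>2 = d\<^sup>1\<^sub>1 \<otimes> d\<^sup>1\<^sub>2 \<otimes> d\<^sup>2\<close>.  Apply \<open>r \<otimes> s \<otimes> q \<mapsto> \<pi>(S(r)) \<pi>(s) S(\<pi>(q))\<close>.  The
  right-hand side becomes \<open>\<pi>(\<epsilon>\<^sub>B(d\<^sup>1)) S(\<pi>(d\<^sup>2)) = S(\<pi>(d))\<close> by the antipode and counit identities of \<open>\<D>\<close>.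
  The left-hand side becomes \<open>\<pi>(S(d\<^sub>1)) \<pi>(\<epsilon>\<^sub>C(d\<^sub>2)) = \<pi>(S(d))\<close>, provided that
  \<open>\<pi>(d\<^sup>1) S(\<pi>(d\<^sup>2)) = \<pi>(\<epsilon>\<^sub>C(d))\<close>; this is lemma \<open>antipode_morphism\<close>, and the computation as a whole is
  lemma \<open>antipode_\<pi>\<close>.

  Lemma \<open>antipode_morphism\<close> follows from the antipode identity of \<open>\<A>\<close> once \<open>\<pi>\<close> is known to respect the
  left counits in the form \<open>\<epsilon>\<^sub>C(c \<pi>(d)) = \<epsilon>\<^sub>C(c \<pi>(\<epsilon>\<^sub>C(d)))\<close>, lemma \<open>counit_morphism\<close>.  A morphism respects
  the counits because they are determined by the comultiplications: elements
  \<open>\<Delta>\<^sub>C(a)(1 \<otimes> b)\<close> span the tensor product, so the counit identity fixes \<open>\<epsilon>\<^sub>C\<close>.  The spanning property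
  (lemma \<open>canonical_surj\<close>) holds because \<open>a \<otimes> b \<mapsto> a\<^sup>1 \<otimes> S(a\<^sup>2) b\<close> inverts the canonical map
  \<open>a \<otimes> b \<mapsto> \<Delta>\<^sub>C(a)(1 \<otimes> b)\<close>.  The same inverse shows that \<open>\<Delta>\<^sub>B(T)\<close> and \<open>\<Delta>\<^sub>C(T)\<close> exist for every
  multiplier \<open>T\<close>, so that the conditions on a morphism are meaningful (lemmas \<open>\<Delta>C_ext_qclass\<close> and
  \<open>\<Delta>B_ext_qclass\<close>).

  As there are no units, each identity is proved after multiplication by further elements of the
  algebra, which are then cancelled by non-degeneracy.  Elements of a balanced tensor product are
  represented in the free vector space, and only values of balanced maps on them are considered.
  The locale \<open>Hopf_frame\<close> lists what is used of a regular multiplier Hopf algebroid in this form.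
  Passing to the opposite algebra and flipping the tensor factors exchanges \<open>\<Delta>\<^sub>B\<close> and \<open>\<Delta>\<^sub>C\<close>
  (lemma \<open>mirror\<close>), so that every statement about one of them yields one about the other.
\<close>

section \<open>Linear extension and Sweedler sums\<close>

interpretation complex_vector_pair:
  vector_space_pair "scaleC :: complex \<Rightarrow> 'a \<Rightarrow> 'a::complex_vector"
    "scaleC :: complex \<Rightarrow> 'b \<Rightarrow> 'b::complex_vector"
  by unfold_locales

lemma clinear_sum: "clinear f \<Longrightarrow> f (\<Sum>x\<in>I. g x) = (\<Sum>x\<in>I. f (g x))"
  by (rule complex_vector_pair.linear_sum)

lemma clinear_const_0: "clinear (\<lambda>x. 0)"
  by (intro clinearI) auto

lemma clinear_ident: "clinear (\<lambda>x. x)"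
  by (intro clinearI) auto

lemma clinear_compose: "clinear f \<Longrightarrow> clinear g \<Longrightarrow> clinear (\<lambda>x. f (g x))"
  by (intro clinearI) (auto simp: clinear_rules)

lemma clinear_diff: "clinear f \<Longrightarrow> clinear g \<Longrightarrow> clinear (\<lambda>x. f x - g x)"
  by (intro clinearI) (auto simp: clinear_rules complex_vector.scale_right_diff_distrib)

lemma clinear_kernel: "clinear F \<Longrightarrow> csubspace {u. F u = 0}"
  by (rule complex_vector.subspaceI) (auto simp: clinear_rules)

lemma lin_ext_superset:
  assumes "finite K" "Poly_Mapping.keys u \<subseteq> K"
  shows "lin_ext f u = (\<Sum>x\<in>K. Poly_Mapping.lookup u x *\<^sub>C f x)"
  unfolding lin_ext_def
  by (rule sum.mono_neutral_left) (use assms in \<open>auto simp: in_keys_iff\<close>)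

lemma clinear_lin_ext: "clinear (lin_ext f)"
proof (rule clinearI)
  fix u v :: "'a \<Rightarrow>\<^sub>0 complex" and c
  let ?K = "Poly_Mapping.keys u \<union> Poly_Mapping.keys v"
  have K: "finite ?K" "Poly_Mapping.keys (u + v) \<subseteq> ?K" "Poly_Mapping.keys u \<subseteq> ?K"
    "Poly_Mapping.keys v \<subseteq> ?K"
    using Poly_Mapping.keys_add[of u v] by auto
  show "lin_ext f (u + v) = lin_ext f u + lin_ext f v"
    by (simp add: lin_ext_superset[OF K(1) K(2)] lin_ext_superset[OF K(1) K(3)]
        lin_ext_superset[OF K(1) K(4)] lookup_add scaleC_add_left sum.distrib)
  have K': "Poly_Mapping.keys (c *\<^sub>C u) \<subseteq> Poly_Mapping.keys u"
    by (auto simp: in_keys_iff lookup_scaleC)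
  show "lin_ext f (c *\<^sub>C u) = c *\<^sub>C lin_ext f u"
    by (subst lin_ext_superset[OF finite_keys K'])
      (simp add: lin_ext_def lookup_scaleC complex_vector.scale_sum_right scaleC_complex_def scaleC_scaleC)
qed

lemma lin_ext_gen [simp]: "lin_ext f (gen x) = f x"
  by (simp add: lin_ext_def gen_def scaleC_one)

lemma clinear_apply_lin_ext:
  "clinear h \<Longrightarrow> h (lin_ext f u) = lin_ext (\<lambda>x. h (f x)) u"
  by (simp add: lin_ext_def clinear_sum clinear_rules)

lemma lin_ext_gen_id [simp]: "lin_ext gen u = u"
proof (rule poly_mapping_eqI)
  fix k
  have "Poly_Mapping.lookup (lin_ext gen u) k =
      (\<Sum>x\<in>Poly_Mapping.keys u. Poly_Mapping.lookup u x * (1 when x = k))"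
    unfolding lin_ext_def by (subst lookup_sum) (simp add: lookup_scaleC gen_def lookup_single scaleC_complex_def)
  also have "\<dots> = (\<Sum>x\<in>Poly_Mapping.keys u. if x = k then Poly_Mapping.lookup u x else 0)"
    by (intro sum.cong) (auto simp: when_def)
  also have "\<dots> = Poly_Mapping.lookup u k"
    by (simp add: sum.delta' in_keys_iff)
  finally show "Poly_Mapping.lookup (lin_ext gen u) k = Poly_Mapping.lookup u k" .
qed

lemma lin_ext_diff_fun: "lin_ext (\<lambda>x. f x - g x) u = lin_ext f u - lin_ext g u"
  by (simp add: lin_ext_def complex_vector.scale_right_diff_distrib sum_subtractf)

lemma lin_ext_in_subspace:
  assumes "csubspace M" "\<And>x. f x \<in> M"
  shows "lin_ext f u \<in> M"
  unfolding lin_ext_def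
  by (intro complex_vector.subspace_sum complex_vector.subspace_scale assms)

lemma lin_ext_0 [simp]: "lin_ext (\<lambda>x. 0) u = 0"
  by (simp add: lin_ext_def)

lemma in_range_lin_ext:
  assumes "v \<in> cspan (range f)"
  shows "\<exists>u. lin_ext f u = v"
  using assms
proof (induction rule: complex_vector.span_induct_alt)
  case base
  show ?case by (rule exI[of _ 0]) (simp add: clinear_rules[OF clinear_lin_ext])
next
  case (step c x y)
  then obtain u a where "lin_ext f u = y" "x = f a" by auto
  then have "lin_ext f (c *\<^sub>C gen a + u) = c *\<^sub>C x + y"
    by (simp add: clinear_rules[OF clinear_lin_ext])
  then show ?case by blast
qed

text \<open>
  An element of \<open>A \<otimes> A\<close> enters the argument only through the values of bilinear maps on it, so
  \<open>eval2 f u\<close>, the value at \<open>u = \<Sum> p \<otimes> q\<close>, plays the part of Sweedler's \<open>\<Sum> f(p, q)\<close>.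
\<close>

definition eval2 :: "('a \<Rightarrow> 'a \<Rightarrow> 'v::complex_vector) \<Rightarrow> 'a tensor2 \<Rightarrow> 'v"
  where "eval2 f u = lin_ext (case_prod f) u"

lemma eval2_gen [simp]: "eval2 f (gen (a, b)) = f a b"
  by (simp add: eval2_def)

lemma clinear_eval2: "clinear (eval2 f)"
  unfolding eval2_def by (rule clinear_lin_ext)

lemmas eval2_rules = clinear_rules[OF clinear_eval2]

lemma clinear_apply_eval2: "clinear h \<Longrightarrow> h (eval2 f u) = eval2 (\<lambda>p q. h (f p q)) u"
  by (simp add: eval2_def clinear_apply_lin_ext split_def)

lemma eval2_eval2: "eval2 f (eval2 g u) = eval2 (\<lambda>p q. eval2 f (g p q)) u"
  by (rule clinear_apply_eval2[OF clinear_eval2])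

lemma eval2_gen_id [simp]: "eval2 (\<lambda>p q. gen (p, q)) u = u"
  by (simp add: eval2_def)

lemma eval2_diff_fun: "eval2 (\<lambda>p q. f p q - g p q) u = eval2 f u - eval2 g u"
  unfolding eval2_def lin_ext_diff_fun[symmetric] by (simp add: split_def)

lemma eval2_0 [simp]: "eval2 (\<lambda>p q. 0) u = 0"
  by (simp add: eval2_def split_def)

lemma clinear_eval2_fun:
  assumes "\<And>p q. clinear (\<lambda>x. f x p q)"
  shows "clinear (\<lambda>x. eval2 (f x) u)"
  by (rule clinearI)
    (simp_all add: eval2_def lin_ext_def split_def clinear_rules[OF assms] scaleC_add_right
      sum.distrib complex_vector.scale_sum_right scaleC_scaleC mult.commute)

lemma clinear_eq_on_span:
  assumes "clinear f" "clinear g" "cspan X = UNIV" "\<And>x. x \<in> X \<Longrightarrow> f x = g x"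
  shows "f x = g x"
proof -
  have "x \<in> cspan X" unfolding assms(3) by (rule UNIV_I)
  from complex_vector_pair.linear_eq_on[OF assms(1,2) this assms(4)] show ?thesis .
qed

text \<open>
  The prescription \<open>f x \<mapsto> g x\<close> is well-defined as every relation between the \<open>f x\<close> also holds between
  the \<open>g x\<close>.  Multipliers will be constructed from their values on products in this way.
\<close>

lemma clinear_factorization:
  fixes f :: "'x \<Rightarrow> 'v::complex_vector" and g :: "'x \<Rightarrow> 'w::complex_vector"
  assumes span: "cspan (range f) = UNIV" and ker: "\<And>u. lin_ext f u = 0 \<Longrightarrow> lin_ext g u = 0"
  shows "\<exists>h. clinear h \<and> (\<forall>x. h (f x) = g x)"
proof -
  define s where "s v = (SOME u. lin_ext f u = v)" for v
  have s: "lin_ext f (s v) = v" for v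
  proof -
    have "v \<in> cspan (range f)" unfolding span by (rule UNIV_I)
    from someI_ex[OF in_range_lin_ext[OF this]] show ?thesis by (simp only: s_def)
  qed
  have eq: "lin_ext g u = lin_ext g v" if "lin_ext f u = lin_ext f v" for u v
    using ker[of "u - v"] that by (simp add: clinear_rules[OF clinear_lin_ext])
  define h where "h v = lin_ext g (s v)" for v
  have h: "h (lin_ext f u) = lin_ext g u" for u
    unfolding h_def by (rule eq) (rule s)
  have "clinear h"
  proof (rule clinearI)
    show "h (v + w) = h v + h w" for v w
      using h[of "s v + s w"] by (simp add: clinear_rules[OF clinear_lin_ext] s) (simp add: h_def)
    show "h (c *\<^sub>C v) = c *\<^sub>C h v" for c v
      using h[of "c *\<^sub>C s v"] by (simp add: clinear_rules[OF clinear_lin_ext] s) (simp add: h_def)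
  qed
  moreover have "h (f x) = g x" for x
    using h[of "gen x"] by simp
  ultimately show ?thesis by blast
qed

section \<open>Balanced maps and tensor products\<close>

definition balanced :: "'a::complex_vector balance \<Rightarrow> ('a \<Rightarrow> 'a \<Rightarrow> 'v::complex_vector) \<Rightarrow> bool"
  where "balanced R f \<longleftrightarrow> (\<forall>a. clinear (f a)) \<and> (\<forall>b. clinear (\<lambda>a. f a b)) \<and>
    (\<forall>g h a b. (g, h) \<in> R \<longrightarrow> f (g a) b = f a (h b))"

lemma balancedI:
  assumes "\<And>a. clinear (f a)" "\<And>b. clinear (\<lambda>a. f a b)"
    and "\<And>g h a b. (g, h) \<in> R \<Longrightarrow> f (g a) b = f a (h b)"
  shows "balanced R f"
  using assms by (auto simp: balanced_def)

lemma balancedD: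
  assumes "balanced R f"
  shows "clinear (f a)" "clinear (\<lambda>a. f a b)" "(g, h) \<in> R \<Longrightarrow> f (g a) b = f a (h b)"
  using assms by (auto simp: balanced_def)

lemma balanced_compose: "clinear k \<Longrightarrow> balanced R f \<Longrightarrow> balanced R (\<lambda>p q. k (f p q))"
  by (auto simp: balanced_def intro: clinear_compose)

lemma balanced_diff: "balanced R f \<Longrightarrow> balanced R g \<Longrightarrow> balanced R (\<lambda>p q. f p q - g p q)"
  by (auto simp: balanced_def intro: clinear_diff)

lemma csubspace_relations2: "csubspace (relations2 R)"
  unfolding relations2_def by (rule complex_vector.subspace_span)

lemma eval2_relations2:
  assumes "balanced R f" "u \<in> relations2 R"
  shows "eval2 f u = 0"
proof -
  note f = clinear_rules[OF balancedD(1)[OF assms(1)]] clinear_rules[OF balancedD(2)[OF assms(1)]]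
    balancedD(3)[OF assms(1)]
  have "csubspace {u. eval2 f u = 0}"
    by (rule complex_vector.subspaceI) (auto simp: eval2_rules)
  then have "relations2 R \<subseteq> {u. eval2 f u = 0}"
    unfolding relations2_def by (intro complex_vector.span_minimal) (auto simp: eval2_rules f)
  with assms(2) show ?thesis by auto
qed

text \<open>
  The second condition makes the balanced map \<open>t\<close> universal, whatever the space in which it takes its
  values: \<open>t\<close> identifies two elements only if all balanced maps do.
\<close>

definition tensor_product :: "'a::complex_algebra balance \<Rightarrow> ('a \<Rightarrow> 'a \<Rightarrow> 'v::complex_vector) \<Rightarrow> bool"
  where "tensor_product R t \<longleftrightarrow> balanced R t \<and> (\<forall>u. eval2 t u = 0 \<longrightarrow> u \<in> relations2 R)"

lemma eval2_cong_tensor: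
  assumes "tensor_product R t" "balanced R f" "eval2 t u = eval2 t v"
  shows "eval2 f u = eval2 f v"
proof -
  have "u - v \<in> relations2 R"
    using assms(1,3) by (auto simp: tensor_product_def eval2_rules)
  from eval2_relations2[OF assms(2) this] show ?thesis
    by (simp add: eval2_rules)
qed

lemma clinear_eval2_tensor:
  assumes "tensor_product R t" "balanced R f" "clinear (\<lambda>x. eval2 t (d x))"
  shows "clinear (\<lambda>x. eval2 f (d x))"
  by (rule clinearI; unfold eval2_rules[symmetric]; rule eval2_cong_tensor[OF assms(1,2)])
    (simp_all add: eval2_rules clinear_rules[OF assms(3)])

text \<open>
  Needed for the passage to the opposite algebra, which reverses the order of the tensor factors.
\<close>

definition flip2 :: "'a tensor2 \<Rightarrow> 'a tensor2"
  where "flip2 = eval2 (\<lambda>a b. gen (b, a))"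

lemma eval2_flip2 [simp]: "eval2 f (flip2 u) = eval2 (\<lambda>p q. f q p) u"
  by (simp add: flip2_def eval2_eval2)

lemma clinear_flip2: "clinear flip2"
  unfolding flip2_def by (rule clinear_eval2)

lemma flip2_gen [simp]: "flip2 (gen (a, b)) = gen (b, a)"
  by (simp add: flip2_def)

lemma flip2_eval2: "flip2 (eval2 f u) = eval2 (\<lambda>p q. flip2 (f p q)) u"
  by (rule clinear_apply_eval2[OF clinear_flip2])

lemma balanced_flip:
  "balanced ((\<lambda>(f, g). (g, f)) ` R) f \<longleftrightarrow> balanced R (\<lambda>a b. f b a)"
  by (auto simp: balanced_def split_def image_iff) (metis fst_conv snd_conv)+

text \<open>
  A linear projection along \<open>N\<close>.  It picks one representative in each coset, compatibly with the
  linear structure, so that equations between cosets become equations in a vector space, and a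
  quotient by a subspace that is not a type can serve as the target of linear maps.
\<close>

definition proj :: "'v::complex_vector set \<Rightarrow> 'v \<Rightarrow> 'v"
  where "proj N = (SOME P. clinear P \<and> (\<forall>u. P u = 0 \<longleftrightarrow> u \<in> N) \<and> (\<forall>u. P (P u) = P u))"

lemma proj:
  assumes "csubspace N"
  shows "clinear (proj N)" "proj N u = 0 \<longleftrightarrow> u \<in> N" "proj N (proj N u) = proj N u"
proof -
  have "\<exists>P. clinear P \<and> (\<forall>u. P u = 0 \<longleftrightarrow> u \<in> N) \<and> (\<forall>u::'a. P (P u) = P u)"
  proof -
    obtain E where E: "E \<subseteq> N" "complex_vector.independent E" "N \<subseteq> cspan E"
      by (rule complex_vector.maximal_independent_subset)
    obtain F where F: "E \<subseteq> F" "F \<subseteq> UNIV" "complex_vector.independent F" "UNIV \<subseteq> cspan F"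
      by (rule complex_vector.maximal_independent_subset_extend[OF subset_UNIV E(2)])
    define P :: "'a \<Rightarrow> 'a" where "P = complex_vector_pair.construct F (\<lambda>b. if b \<in> E then 0 else b)"
    have lin: "clinear P" unfolding P_def
      using F(3) by (rule complex_vector_pair.linear_construct)
    have basis: "P b = (if b \<in> E then 0 else b)" if "b \<in> F" for b
      unfolding P_def using F(3) that by (rule complex_vector_pair.construct_basis)
    have 1: "P u = 0" if "u \<in> N" for u
    proof -
      have "u \<in> cspan E" using that E(3) by auto
      then show ?thesis
        by (rule complex_vector_pair.linear_eq_on[OF lin clinear_const_0])
           (use basis F(1) in auto)
    qed
    have 2: "P u - u \<in> N" for u
    proof -
      have "u \<in> cspan F" using F(4) by auto
      then show ?thesis
      proof (induction rule: complex_vector.span_induct_alt)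
        case base
        show ?case by (simp add: clinear_rules[OF lin] complex_vector.subspace_0[OF assms])
      next
        case (step c x y)
        have "P x - x \<in> N" using basis[OF step(1)] E(1) complex_vector.subspace_0[OF assms]
            complex_vector.subspace_neg[OF assms] by auto
        moreover have "P (c *\<^sub>C x + y) - (c *\<^sub>C x + y) = c *\<^sub>C (P x - x) + (P y - y)"
          by (simp add: clinear_rules[OF lin] complex_vector.scale_right_diff_distrib)
        ultimately show ?case
          using step(2) complex_vector.subspace_add[OF assms] complex_vector.subspace_scale[OF assms] by metis
      qed
    qed
    have 3: "u \<in> N" if "P u = 0" for u
      using 2[of u] that complex_vector.subspace_neg[OF assms, of "- u"] by simp
    have 4: "P (P u) = P u" for u
      using 1[OF 2[of u]] by (simp add: clinear_rules[OF lin])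
    from lin 1 3 4 show ?thesis by blast
  qed
  from someI_ex[OF this, folded proj_def]
  show "clinear (proj N)" "proj N u = 0 \<longleftrightarrow> u \<in> N" "proj N (proj N u) = proj N u"
    by blast+
qed

lemma proj_eq_iff:
  assumes "csubspace N"
  shows "proj N u = proj N v \<longleftrightarrow> u - v \<in> N"
  using proj(2)[OF assms, of "u - v"] by (simp add: clinear_rules[OF proj(1)[OF assms]])

definition tens_val :: "'a::complex_algebra tensor2 set \<Rightarrow> 'a \<Rightarrow> 'a \<Rightarrow> 'a tensor2"
  where "tens_val N a b = proj N (gen (a, b))"

lemma eval2_tens_val: "csubspace N \<Longrightarrow> eval2 (tens_val N) u = proj N u"
  unfolding tens_val_def
  using clinear_apply_eval2[OF proj(1), of N "\<lambda>p q. gen (p, q)" u] by simp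

lemma tensor_product_tens_val: "tensor_product R (tens_val (relations2 R))"
proof -
  let ?N = "relations2 R"
  note N = csubspace_relations2[of R]
  have rel: "gen (a + a', b) - gen (a, b) - gen (a', b) \<in> ?N"
    "gen (a, b + b') - gen (a, b) - gen (a, b') \<in> ?N"
    "gen (c *\<^sub>C a, b) - c *\<^sub>C gen (a, b) \<in> ?N"
    "gen (a, c *\<^sub>C b) - c *\<^sub>C gen (a, b) \<in> ?N"
    "(f, g) \<in> R \<Longrightarrow> gen (f a, b) - gen (a, g b) \<in> ?N" for a a' b b' c f g
    unfolding relations2_def by (rule complex_vector.span_base; blast)+
  have "balanced R (tens_val ?N)"
    by (rule balancedI; (rule clinearI)?)
      (use rel in \<open>simp_all add: tens_val_def clinear_rules[OF proj(1)[OF N], symmetric] proj_eq_iff[OF N]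
        diff_diff_add[symmetric]\<close>)
  then show ?thesis
    by (simp add: tensor_product_def eval2_tens_val[OF N] proj(2)[OF N])
qed

lemma eval2_proj:
  assumes "balanced R f"
  shows "eval2 f (proj (relations2 R) u) = eval2 f u"
proof (rule eval2_cong_tensor[OF tensor_product_tens_val assms])
  show "eval2 (tens_val (relations2 R)) (proj (relations2 R) u) = eval2 (tens_val (relations2 R)) u"
    by (simp add: eval2_tens_val csubspace_relations2 proj(3))
qed

lemma tensor_product_flip:
  assumes "tensor_product R t"
  shows "tensor_product ((\<lambda>(f, g). (g, f)) ` R) (\<lambda>a b. t b a)"
proof -
  let ?R = "(\<lambda>(f, g). (g, f)) ` R"
  have "u \<in> relations2 ?R" if "eval2 (\<lambda>a b. t b a) u = 0" for u
  proof -
    have "flip2 u \<in> relations2 R"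
      using assms that by (auto simp: tensor_product_def)
    moreover have "balanced R (\<lambda>a b. tens_val (relations2 ?R) b a)"
      using tensor_product_tens_val[of ?R] by (simp add: tensor_product_def balanced_flip)
    ultimately have "eval2 (tens_val (relations2 ?R)) u = 0"
      using eval2_relations2 by fastforce
    then show ?thesis
      using tensor_product_tens_val[of ?R] by (simp add: tensor_product_def)
  qed
  with assms show ?thesis
    by (simp add: tensor_product_def balanced_flip)
qed

section \<open>Canonical maps and comultiplications of multipliers\<close>

named_theorems lin "linearity of composite maps"

declare clinear_ident [lin] clinear_eval2_fun [lin] clinear_diff [lin]

text \<open>
  A regular multiplier Hopf algebroid as seen by balanced maps.  The multipliers enter only as an
  index type \<open>'k\<close> with a left and a right action; \<open>dC1 b a\<close>, \<open>dC2 b c\<close>, \<open>dB1 a b\<close> and \<open>dB2 c b\<close> represent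
  \<open>\<Delta>\<^sub>C(b)(a \<otimes> 1)\<close>, \<open>\<Delta>\<^sub>C(b)(1 \<otimes> c)\<close>, \<open>(a \<otimes> 1)\<Delta>\<^sub>B(b)\<close> and \<open>(1 \<otimes> c)\<Delta>\<^sub>B(b)\<close>.  The list of assumptions is closed
  under exchanging \<open>B\<close> and \<open>C\<close>, left and right, and the two tensor factors.

  The two mixed coassociativity laws are stated through their effect on a trilinear balanced map
  \<open>\<Phi>\<close>.  The disjunction says that one of the two iterated sums does not depend on the chosen
  representatives in its outer tensor factor; for the maps considered below, one side can be
  computed explicitly, and there this is evident.
\<close>

locale Hopf_frame =
  fixes mult :: "'a::complex_algebra \<Rightarrow> 'a \<Rightarrow> 'a" (infixl "\<odot>" 70)
    and la :: "'k \<Rightarrow> 'a \<Rightarrow> 'a" (infixr "\<rightharpoonup>" 75)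
    and ra :: "'a \<Rightarrow> 'k \<Rightarrow> 'a" (infixl "\<leftharpoonup>" 74)
    and B C :: "'k set" and tB tC :: "'k \<Rightarrow> 'k"
    and tenB :: "'a \<Rightarrow> 'a \<Rightarrow> 'v::complex_vector" (infix "\<otimes>\<^sub>B" 65)
    and tenC :: "'a \<Rightarrow> 'a \<Rightarrow> 'v" (infix "\<otimes>\<^sub>C" 65)
    and dB1 dB2 dC1 dC2 :: "'a \<Rightarrow> 'a \<Rightarrow> 'a tensor2"
    and eB eC :: "'a \<Rightarrow> 'k" and S :: "'a \<Rightarrow> 'a"
  assumes mult_balanced: "balanced {} (\<odot>)"
    and assoc: "(a \<odot> b) \<odot> c = a \<odot> (b \<odot> c)"
    and nondeg_left: "(\<And>b. a \<odot> b = 0) \<Longrightarrow> a = 0"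
    and nondeg_right: "(\<And>b. b \<odot> a = 0) \<Longrightarrow> a = 0"
    and idempotent: "cspan {a \<odot> b |a b. True} = UNIV"
    and clinear_la: "clinear (\<lambda>a. k \<rightharpoonup> a)"
    and clinear_ra: "clinear (\<lambda>a. a \<leftharpoonup> k)"
    and la_mult: "k \<rightharpoonup> (a \<odot> b) = (k \<rightharpoonup> a) \<odot> b"
    and mult_ra: "(a \<odot> b) \<leftharpoonup> k = a \<odot> (b \<leftharpoonup> k)"
    and ra_mult: "(a \<leftharpoonup> k) \<odot> b = a \<odot> (k \<rightharpoonup> b)"
    and tensor_B: "tensor_product {(\<lambda>a. a \<leftharpoonup> x, \<lambda>b. b \<leftharpoonup> tB x) |x. x \<in> B} (\<otimes>\<^sub>B)"
    and tensor_C: "tensor_product {(\<lambda>a. tC y \<rightharpoonup> a, \<lambda>b. y \<rightharpoonup> b) |y. y \<in> C} (\<otimes>\<^sub>C)"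
    and cancel_B1: "(\<And>a. eval2 (\<lambda>p q. a \<odot> p \<otimes>\<^sub>B q) u = 0) \<Longrightarrow> eval2 (\<otimes>\<^sub>B) u = 0"
    and cancel_B2: "(\<And>a. eval2 (\<lambda>p q. p \<otimes>\<^sub>B a \<odot> q) u = 0) \<Longrightarrow> eval2 (\<otimes>\<^sub>B) u = 0"
    and cancel_C1: "(\<And>a. eval2 (\<lambda>p q. p \<odot> a \<otimes>\<^sub>C q) u = 0) \<Longrightarrow> eval2 (\<otimes>\<^sub>C) u = 0"
    and cancel_C2: "(\<And>a. eval2 (\<lambda>p q. p \<otimes>\<^sub>C q \<odot> a) u = 0) \<Longrightarrow> eval2 (\<otimes>\<^sub>C) u = 0"
    and dB12: "eval2 (\<lambda>p q. p \<otimes>\<^sub>B c \<odot> q) (dB1 a b) = eval2 (\<lambda>p q. a \<odot> p \<otimes>\<^sub>B q) (dB2 c b)"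
    and dC12: "eval2 (\<lambda>p q. p \<otimes>\<^sub>C q \<odot> c) (dC1 b a) = eval2 (\<lambda>p q. p \<odot> a \<otimes>\<^sub>C q) (dC2 b c)"
    and clinear_dB1: "clinear (\<lambda>b. eval2 (\<otimes>\<^sub>B) (dB1 a b))"
    and clinear_dC2: "clinear (\<lambda>b. eval2 (\<otimes>\<^sub>C) (dC2 b c))"
    and dB_balanced: "balanced {(\<lambda>a. a \<leftharpoonup> x, \<lambda>b. b \<leftharpoonup> tB x) |x. x \<in> B}
      (\<lambda>p q. eval2 (\<lambda>r s. r \<otimes>\<^sub>B q \<odot> s) (dB1 p b))"
    and dC_balanced: "balanced {(\<lambda>a. tC y \<rightharpoonup> a, \<lambda>b. y \<rightharpoonup> b) |y. y \<in> C}
      (\<lambda>p q. eval2 (\<lambda>r s. r \<odot> p \<otimes>\<^sub>C s) (dC2 b q))"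
    and dB1_mult: "eval2 (\<otimes>\<^sub>B) (dB1 c (b' \<odot> b)) =
      eval2 (\<lambda>p q. eval2 (\<lambda>r s. r \<otimes>\<^sub>B q \<odot> s) (dB1 p b)) (dB1 c b')"
    and dC2_mult: "eval2 (\<otimes>\<^sub>C) (dC2 (b \<odot> b') c) =
      eval2 (\<lambda>p q. eval2 (\<lambda>r s. r \<odot> p \<otimes>\<^sub>C s) (dC2 b q)) (dC2 b' c)"
    and dB1_la_B: "x \<in> B \<Longrightarrow> eval2 (\<otimes>\<^sub>B) (dB1 c (x \<rightharpoonup> b)) = eval2 (\<lambda>p q. p \<otimes>\<^sub>B x \<rightharpoonup> q) (dB1 c b)"
    and dB1_la_C: "y \<in> C \<Longrightarrow> eval2 (\<otimes>\<^sub>B) (dB1 c (y \<rightharpoonup> b)) = eval2 (\<otimes>\<^sub>B) (dB1 (c \<leftharpoonup> y) b)"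
    and dC2_ra_C: "y \<in> C \<Longrightarrow> eval2 (\<otimes>\<^sub>C) (dC2 (b \<leftharpoonup> y) c) = eval2 (\<lambda>p q. p \<leftharpoonup> y \<otimes>\<^sub>C q) (dC2 b c)"
    and dC2_ra_B: "x \<in> B \<Longrightarrow> eval2 (\<otimes>\<^sub>C) (dC2 (b \<leftharpoonup> x) c) = eval2 (\<otimes>\<^sub>C) (dC2 b (x \<rightharpoonup> c))"
    and tB_range: "x \<in> B \<Longrightarrow> tB x \<in> C"
    and tC_range: "y \<in> C \<Longrightarrow> tC y \<in> B"
    and eB_range: "eB a \<in> B"
    and eC_range: "eC a \<in> C"
    and clinear_eB: "clinear (\<lambda>a. b \<leftharpoonup> eB a)"
    and clinear_eC: "clinear (\<lambda>a. eC a \<rightharpoonup> b)"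
    and eB_ra: "x \<in> B \<Longrightarrow> b \<leftharpoonup> eB (a \<leftharpoonup> x) = b \<leftharpoonup> eB a \<leftharpoonup> x"
    and eB_ra_t: "x \<in> B \<Longrightarrow> b \<leftharpoonup> eB (a \<leftharpoonup> tB x) = b \<leftharpoonup> x \<leftharpoonup> eB a"
    and eC_la: "y \<in> C \<Longrightarrow> eC (y \<rightharpoonup> a) \<rightharpoonup> b = y \<rightharpoonup> eC a \<rightharpoonup> b"
    and eC_la_t: "y \<in> C \<Longrightarrow> eC (tC y \<rightharpoonup> a) \<rightharpoonup> b = eC a \<rightharpoonup> y \<rightharpoonup> b"
    and counit_B1: "eval2 (\<lambda>p q. p \<leftharpoonup> eB q) (dB1 b a) = b \<odot> a"
    and counit_B2: "eval2 (\<lambda>p q. q \<leftharpoonup> tB (eB p)) (dB2 b a) = b \<odot> a"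
    and counit_C1: "eval2 (\<lambda>p q. tC (eC q) \<rightharpoonup> p) (dC1 a b) = a \<odot> b"
    and counit_C2: "eval2 (\<lambda>p q. eC p \<rightharpoonup> q) (dC2 a b) = a \<odot> b"
    and clinear_S: "clinear S"
    and bij_S: "bij S"
    and S_mult: "S (a \<odot> b) = S b \<odot> S a"
    and S_la_tC: "y \<in> C \<Longrightarrow> S (tC y \<rightharpoonup> a) = S a \<leftharpoonup> y"
    and S_ra_tC: "y \<in> C \<Longrightarrow> S (a \<leftharpoonup> tC y) = y \<rightharpoonup> S a"
    and S_la_tB: "x \<in> B \<Longrightarrow> S (tB x \<rightharpoonup> a) = S a \<leftharpoonup> x"
    and S_ra_tB: "x \<in> B \<Longrightarrow> S (a \<leftharpoonup> tB x) = x \<rightharpoonup> S a"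
    and antipode_B1: "eval2 (\<lambda>p q. p \<odot> S q) (dB1 a b) = a \<leftharpoonup> eC b"
    and antipode_C2: "eval2 (\<lambda>p q. S p \<odot> q) (dC2 a b) = eB a \<rightharpoonup> b"
    and coassoc_CB: "\<And>\<Phi> :: 'a \<Rightarrow> 'a \<Rightarrow> 'a \<Rightarrow> 'v. \<And>a b c.
      (\<And>q. balanced {(\<lambda>a. tC y \<rightharpoonup> a, \<lambda>b. y \<rightharpoonup> b) |y. y \<in> C} (\<lambda>r s. \<Phi> r s q)) \<Longrightarrow>
      (\<And>p. balanced {(\<lambda>a. a \<leftharpoonup> x, \<lambda>b. b \<leftharpoonup> tB x) |x. x \<in> B} (\<Phi> p)) \<Longrightarrow>
      balanced {(\<lambda>a. tC y \<rightharpoonup> a, \<lambda>b. y \<rightharpoonup> b) |y. y \<in> C} (\<lambda>p q. eval2 (\<Phi> p) (dB2 c q)) \<or>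
      balanced {(\<lambda>a. a \<leftharpoonup> x, \<lambda>b. b \<leftharpoonup> tB x) |x. x \<in> B} (\<lambda>p q. eval2 (\<lambda>r s. \<Phi> r s q) (dC1 p a)) \<Longrightarrow>
      eval2 (\<lambda>p q. eval2 (\<lambda>r s. \<Phi> r s q) (dC1 p a)) (dB2 c b) =
      eval2 (\<lambda>p q. eval2 (\<Phi> p) (dB2 c q)) (dC1 b a)"
    and coassoc_BC: "\<And>\<Phi> :: 'a \<Rightarrow> 'a \<Rightarrow> 'a \<Rightarrow> 'v. \<And>a b c.
      (\<And>q. balanced {(\<lambda>a. a \<leftharpoonup> x, \<lambda>b. b \<leftharpoonup> tB x) |x. x \<in> B} (\<lambda>r s. \<Phi> r s q)) \<Longrightarrow>
      (\<And>p. balanced {(\<lambda>a. tC y \<rightharpoonup> a, \<lambda>b. y \<rightharpoonup> b) |y. y \<in> C} (\<Phi> p)) \<Longrightarrow>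
      balanced {(\<lambda>a. tC y \<rightharpoonup> a, \<lambda>b. y \<rightharpoonup> b) |y. y \<in> C} (\<lambda>p q. eval2 (\<lambda>r s. \<Phi> r s q) (dB1 a p)) \<or>
      balanced {(\<lambda>a. a \<leftharpoonup> x, \<lambda>b. b \<leftharpoonup> tB x) |x. x \<in> B} (\<lambda>p q. eval2 (\<Phi> p) (dC2 q c)) \<Longrightarrow>
      eval2 (\<lambda>p q. eval2 (\<lambda>r s. \<Phi> r s q) (dB1 a p)) (dC2 b c) =
      eval2 (\<lambda>p q. eval2 (\<Phi> p) (dC2 q c)) (dB1 a b)"
begin

abbreviation RB :: "'a balance"
  where "RB \<equiv> {(\<lambda>a. a \<leftharpoonup> x, \<lambda>b. b \<leftharpoonup> tB x) |x. x \<in> B}"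

abbreviation RC :: "'a balance"
  where "RC \<equiv> {(\<lambda>a. tC y \<rightharpoonup> a, \<lambda>b. y \<rightharpoonup> b) |y. y \<in> C}"

abbreviation S' :: "'a \<Rightarrow> 'a"
  where "S' \<equiv> inv S"

lemma S_S' [simp]: "S (S' a) = a" and S'_S [simp]: "S' (S a) = a"
  using bij_S by (simp_all add: bij_is_surj bij_is_inj surj_f_inv_f)

lemma S'_eq: "S' a = b \<longleftrightarrow> a = S b"
  by (metis S_S' S'_S)

lemma clinear_S': "clinear S'"
  by (rule clinearI) (simp_all add: S'_eq clinear_rules[OF clinear_S])

lemma S'_mult: "S' (a \<odot> b) = S' b \<odot> S' a"
  by (simp add: S'_eq S_mult)

lemma balanced_tenB: "balanced RB (\<otimes>\<^sub>B)" and balanced_tenC: "balanced RC (\<otimes>\<^sub>C)"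
  using tensor_B tensor_C by (simp_all add: tensor_product_def)

lemma lin_rules [lin]:
  assumes "clinear h"
  shows "clinear (\<lambda>x. h x \<odot> a)" "clinear (\<lambda>x. a \<odot> h x)" "clinear (\<lambda>x. k \<rightharpoonup> h x)"
    "clinear (\<lambda>x. h x \<leftharpoonup> k)" "clinear (\<lambda>x. S (h x))" "clinear (\<lambda>x. S' (h x))"
    "clinear (\<lambda>x. h x \<otimes>\<^sub>B a)" "clinear (\<lambda>x. a \<otimes>\<^sub>B h x)"
    "clinear (\<lambda>x. h x \<otimes>\<^sub>C a)" "clinear (\<lambda>x. a \<otimes>\<^sub>C h x)"
    "clinear (\<lambda>x. eC (h x) \<rightharpoonup> a)" "clinear (\<lambda>x. a \<leftharpoonup> eB (h x))"
  using clinear_compose[OF balancedD(2)[OF mult_balanced] assms]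
    clinear_compose[OF balancedD(1)[OF mult_balanced] assms]
    clinear_compose[OF clinear_la assms] clinear_compose[OF clinear_ra assms]
    clinear_compose[OF clinear_S assms] clinear_compose[OF clinear_S' assms]
    clinear_compose[OF balancedD(1)[OF balanced_tenB] assms]
    clinear_compose[OF balancedD(2)[OF balanced_tenB] assms]
    clinear_compose[OF balancedD(1)[OF balanced_tenC] assms]
    clinear_compose[OF balancedD(2)[OF balanced_tenC] assms]
    clinear_compose[OF clinear_eB assms] clinear_compose[OF clinear_eC assms]
  by blast+

lemma tenB_ra: "x \<in> B \<Longrightarrow> a \<leftharpoonup> x \<otimes>\<^sub>B b = a \<otimes>\<^sub>B b \<leftharpoonup> tB x"
  by (rule balancedD(3)[OF balanced_tenB, of "\<lambda>a. a \<leftharpoonup> x" "\<lambda>b. b \<leftharpoonup> tB x"]) auto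

lemma tenC_la: "y \<in> C \<Longrightarrow> tC y \<rightharpoonup> a \<otimes>\<^sub>C b = a \<otimes>\<^sub>C y \<rightharpoonup> b"
  by (rule balancedD(3)[OF balanced_tenC, of "\<lambda>a. tC y \<rightharpoonup> a" "\<lambda>b. y \<rightharpoonup> b"]) auto

lemma balancedI_B:
  assumes "\<And>a. clinear (f a)" "\<And>b. clinear (\<lambda>a. f a b)"
    and "\<And>x a b. x \<in> B \<Longrightarrow> f (a \<leftharpoonup> x) b = f a (b \<leftharpoonup> tB x)"
  shows "balanced RB f"
  by (rule balancedI) (use assms in auto)

lemma balancedI_C:
  assumes "\<And>a. clinear (f a)" "\<And>b. clinear (\<lambda>a. f a b)"
    and "\<And>y a b. y \<in> C \<Longrightarrow> f (tC y \<rightharpoonup> a) b = f a (y \<rightharpoonup> b)"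
  shows "balanced RC f"
  by (rule balancedI) (use assms in auto)

lemma balancedD_C: "balanced RC f \<Longrightarrow> y \<in> C \<Longrightarrow> f (tC y \<rightharpoonup> a) b = f a (y \<rightharpoonup> b)"
  by (rule balancedD(3)[of RC f "\<lambda>a. tC y \<rightharpoonup> a" "\<lambda>b. y \<rightharpoonup> b"]) auto

lemma eval2_cong_B: "balanced RB f \<Longrightarrow> eval2 (\<otimes>\<^sub>B) u = eval2 (\<otimes>\<^sub>B) v \<Longrightarrow> eval2 f u = eval2 f v"
  by (rule eval2_cong_tensor[OF tensor_B])

lemma eval2_cong_C: "balanced RC f \<Longrightarrow> eval2 (\<otimes>\<^sub>C) u = eval2 (\<otimes>\<^sub>C) v \<Longrightarrow> eval2 f u = eval2 f v"
  by (rule eval2_cong_tensor[OF tensor_C])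

lemma eq_B1:
  assumes "\<And>a. eval2 (\<lambda>p q. a \<odot> p \<otimes>\<^sub>B q) u = eval2 (\<lambda>p q. a \<odot> p \<otimes>\<^sub>B q) v"
  shows "eval2 (\<otimes>\<^sub>B) u = eval2 (\<otimes>\<^sub>B) v"
  using cancel_B1[of "u - v"] assms by (simp add: eval2_rules)

lemma eq_C1:
  assumes "\<And>a. eval2 (\<lambda>p q. p \<odot> a \<otimes>\<^sub>C q) u = eval2 (\<lambda>p q. p \<odot> a \<otimes>\<^sub>C q) v"
  shows "eval2 (\<otimes>\<^sub>C) u = eval2 (\<otimes>\<^sub>C) v"
  using cancel_C1[of "u - v"] assms by (simp add: eval2_rules)

lemma eq_left: "(\<And>b. a \<odot> b = a' \<odot> b) \<Longrightarrow> a = a'"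
  using nondeg_left[of "a - a'"] by (simp add: clinear_rules[OF balancedD(2)[OF mult_balanced]])

lemma eq_right: "(\<And>b. b \<odot> a = b \<odot> a') \<Longrightarrow> a = a'"
  using nondeg_right[of "a - a'"] by (simp add: clinear_rules[OF balancedD(1)[OF mult_balanced]])

lemma la_ra: "k \<rightharpoonup> (a \<leftharpoonup> l) = (k \<rightharpoonup> a) \<leftharpoonup> l"
  by (rule eq_left) (simp add: ra_mult la_mult[symmetric])

lemma dB12_eval:
  assumes "balanced RB f"
  shows "eval2 (\<lambda>p q. f p (c \<odot> q)) (dB1 a b) = eval2 (\<lambda>p q. f (a \<odot> p) q) (dB2 c b)"
  using eval2_cong_B[OF assms, of "eval2 (\<lambda>p q. gen (p, c \<odot> q)) (dB1 a b)"
      "eval2 (\<lambda>p q. gen (a \<odot> p, q)) (dB2 c b)"] dB12 by (simp add: eval2_eval2)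

lemma dC12_eval:
  assumes "balanced RC f"
  shows "eval2 (\<lambda>p q. f p (q \<odot> c)) (dC1 b a) = eval2 (\<lambda>p q. f (p \<odot> a) q) (dC2 b c)"
  using eval2_cong_C[OF assms, of "eval2 (\<lambda>p q. gen (p, q \<odot> c)) (dC1 b a)"
      "eval2 (\<lambda>p q. gen (p \<odot> a, q)) (dC2 b c)"] dC12 by (simp add: eval2_eval2)

text \<open>
  The antipode identity with the covering element on the other leg: multiplied by \<open>e\<close> from the left,
  it is the identity for \<open>dB1\<close> multiplied by \<open>S c\<close>.
\<close>

lemma antipode_B2: "eval2 (\<lambda>p q. p \<odot> S q) (dB2 c b) = eC b \<rightharpoonup> S c"
proof (rule eq_right)
  fix e
  have bal: "balanced RB (\<lambda>p q. p \<odot> S q)"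
    by (intro balancedI_B lin) (simp add: S_ra_tB ra_mult)
  have "e \<odot> eval2 (\<lambda>p q. p \<odot> S q) (dB2 c b) = eval2 (\<lambda>p q. (e \<odot> p) \<odot> S q) (dB2 c b)"
    by (subst clinear_apply_eval2) (auto intro: lin simp: assoc)
  also have "\<dots> = eval2 (\<lambda>p q. (p \<odot> S q) \<odot> S c) (dB1 e b)"
    unfolding dB12_eval[OF bal, symmetric] by (simp add: S_mult assoc)
  also have "\<dots> = (e \<leftharpoonup> eC b) \<odot> S c"
    unfolding antipode_B1[symmetric] by (subst clinear_apply_eval2) (auto intro: lin)
  finally show "e \<odot> eval2 (\<lambda>p q. p \<odot> S q) (dB2 c b) = e \<odot> (eC b \<rightharpoonup> S c)"
    by (simp add: ra_mult)
qed

text \<open>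
  Surjectivity of the canonical map \<open>a \<otimes> b \<mapsto> \<Delta>\<^sub>C(a)(1 \<otimes> b)\<close>.  In Sweedler notation,
  \<open>\<Delta>\<^sub>C(b\<^sup>1)(1 \<otimes> S(b\<^sup>2)) = b\<^sub>1 \<otimes> b\<^sub>2\<^sup>1 S(b\<^sub>2\<^sup>2) = b\<^sub>1 \<otimes> \<epsilon>\<^sub>C(b\<^sub>2) = b \<otimes> 1\<close>; here \<open>c\<close> covers the second leg
  and the auxiliary \<open>a\<close> the first one.
\<close>

lemma canonical_surj:
  "eval2 (\<otimes>\<^sub>C) (eval2 (\<lambda>p q. dC2 p (S q)) (dB2 c b)) = b \<otimes>\<^sub>C S c"
proof -
  have "eval2 (\<otimes>\<^sub>C) (eval2 (\<lambda>p q. dC2 p (S q)) (dB2 c b)) = eval2 (\<otimes>\<^sub>C) (gen (b, S c))"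
  proof (rule eq_C1)
    fix a
    define \<Phi> where "\<Phi> = (\<lambda>r s q. r \<otimes>\<^sub>C s \<odot> S q)"
    have right: "eval2 (\<Phi> p) (dB2 c q) = p \<otimes>\<^sub>C eC q \<rightharpoonup> S c" for p q
      unfolding antipode_B2[symmetric] \<Phi>_def
      by (rule clinear_apply_eval2[symmetric]) (intro lin)
    have "eval2 (\<lambda>p q. p \<odot> a \<otimes>\<^sub>C q) (eval2 (\<lambda>p q. dC2 p (S q)) (dB2 c b)) =
        eval2 (\<lambda>p q. eval2 (\<lambda>r s. \<Phi> r s q) (dC1 p a)) (dB2 c b)"
      by (simp add: eval2_eval2 dC12 \<Phi>_def)
    also have "\<dots> = eval2 (\<lambda>p q. eval2 (\<Phi> p) (dB2 c q)) (dC1 b a)"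
    proof (rule coassoc_CB)
      show "balanced RC (\<lambda>r s. \<Phi> r s q)" for q
        unfolding \<Phi>_def by (intro balancedI_C lin) (simp add: tenC_la la_mult)
      show "balanced RB (\<Phi> p)" for p
        unfolding \<Phi>_def by (intro balancedI_B lin) (simp add: ra_mult S_ra_tB)
      show "balanced RC (\<lambda>p q. eval2 (\<Phi> p) (dB2 c q)) \<or>
          balanced RB (\<lambda>p q. eval2 (\<lambda>r s. \<Phi> r s q) (dC1 p a))"
        unfolding right by (intro disjI1 balancedI_C lin) (simp add: tenC_la eC_la)
    qed
    also have "\<dots> = eval2 (\<lambda>p q. tC (eC q) \<rightharpoonup> p \<otimes>\<^sub>C S c) (dC1 b a)"
      by (simp add: right tenC_la eC_range)
    also have "\<dots> = b \<odot> a \<otimes>\<^sub>C S c"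
      unfolding counit_C1[symmetric] by (rule clinear_apply_eval2[symmetric]) (intro lin)
    finally show "eval2 (\<lambda>p q. p \<odot> a \<otimes>\<^sub>C q) (eval2 (\<lambda>p q. dC2 p (S q)) (dB2 c b)) =
        eval2 (\<lambda>p q. p \<odot> a \<otimes>\<^sub>C q) (gen (b, S c))"
      by simp
  qed
  then show ?thesis by simp
qed

text \<open>
  The inverse of the canonical map applied to one of its values:
  \<open>b\<^sub>1\<^sup>1 \<otimes> S(b\<^sub>1\<^sup>2) b\<^sub>2 = b\<^sup>1 \<otimes> S(b\<^sup>2\<^sub>1) b\<^sup>2\<^sub>2 = b\<^sup>1 \<otimes> \<epsilon>\<^sub>B(b\<^sup>2) = b \<otimes> 1\<close>.
  The domain of the canonical map is the product over \<open>B\<close> in which \<open>a x \<otimes> b = a \<otimes> x b\<close>; it is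
  identified with \<open>(\<otimes>\<^sub>B)\<close> by applying the inverse of \<open>S\<close> to the second leg.
\<close>

lemma canonical_inverse:
  "eval2 (\<otimes>\<^sub>B) (eval2 (\<lambda>p q. dB2 (S' q) p) (dC2 b (S c))) = b \<otimes>\<^sub>B c"
proof -
  have "eval2 (\<otimes>\<^sub>B) (eval2 (\<lambda>p q. dB2 (S' q) p) (dC2 b (S c))) = eval2 (\<otimes>\<^sub>B) (gen (b, c))"
  proof (rule eq_B1)
    fix a
    define \<Phi> where "\<Phi> = (\<lambda>s t q. s \<otimes>\<^sub>B S' q \<odot> t)"
    have right: "eval2 (\<Phi> p) (dC2 q (S c)) = p \<leftharpoonup> eB q \<otimes>\<^sub>B c" for p q
    proof -
      have "eval2 (\<Phi> p) (dC2 q (S c)) = eval2 (\<lambda>r s. p \<otimes>\<^sub>B S' (S r \<odot> s)) (dC2 q (S c))"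
        by (simp add: \<Phi>_def S'_mult)
      also have "\<dots> = p \<otimes>\<^sub>B S' (eB q \<rightharpoonup> S c)"
        unfolding antipode_C2[symmetric]
        by (rule clinear_apply_eval2[symmetric]) (intro lin)
      also have "S' (eB q \<rightharpoonup> S c) = c \<leftharpoonup> tB (eB q)"
        by (simp add: S'_eq S_ra_tB eB_range)
      finally show ?thesis by (simp add: tenB_ra eB_range)
    qed
    have "eval2 (\<lambda>p q. a \<odot> p \<otimes>\<^sub>B q) (eval2 (\<lambda>p q. dB2 (S' q) p) (dC2 b (S c))) =
        eval2 (\<lambda>p q. eval2 (\<lambda>s t. \<Phi> s t q) (dB1 a p)) (dC2 b (S c))"
      by (simp add: eval2_eval2 dB12 \<Phi>_def)
    also have "\<dots> = eval2 (\<lambda>p q. eval2 (\<Phi> p) (dC2 q (S c))) (dB1 a b)"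
    proof (rule coassoc_BC)
      show "balanced RB (\<lambda>r s. \<Phi> r s q)" for q
        unfolding \<Phi>_def by (intro balancedI_B lin) (simp add: tenB_ra mult_ra)
      have "S' (y \<rightharpoonup> b) = S' b \<leftharpoonup> tC y" if "y \<in> C" for y b
        using that by (simp add: S'_eq S_ra_tC)
      then show "balanced RC (\<Phi> p)" for p
        unfolding \<Phi>_def by (intro balancedI_C lin) (simp add: ra_mult)
      show "balanced RC (\<lambda>p q. eval2 (\<lambda>r s. \<Phi> r s q) (dB1 a p)) \<or>
          balanced RB (\<lambda>p q. eval2 (\<Phi> p) (dC2 q (S c)))"
        unfolding right by (intro disjI2 balancedI_B lin) (simp add: eB_ra_t)
    qed
    also have "\<dots> = a \<odot> b \<otimes>\<^sub>B c"
      unfolding right counit_B1[symmetric]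
      by (rule clinear_apply_eval2[symmetric]) (intro lin)
    finally show "eval2 (\<lambda>p q. a \<odot> p \<otimes>\<^sub>B q) (eval2 (\<lambda>p q. dB2 (S' q) p) (dC2 b (S c))) =
        eval2 (\<lambda>p q. a \<odot> p \<otimes>\<^sub>B q) (gen (b, c))"
      by simp
  qed
  then show ?thesis by simp
qed

lemma clinear_dC2_eval:
  assumes "balanced RC f"
  shows "clinear (\<lambda>b. eval2 f (dC2 b c))" "clinear (\<lambda>c. eval2 f (dC2 b c))"
proof -
  show "clinear (\<lambda>b. eval2 f (dC2 b c))"
    by (rule clinear_eval2_tensor[OF tensor_C assms clinear_dC2])
  have *: "clinear (\<lambda>c. eval2 (\<lambda>p q. p \<odot> a \<otimes>\<^sub>C q) (dC2 b c))" for a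
    unfolding dC12[symmetric] by (intro lin)
  have "clinear (\<lambda>c. eval2 (\<otimes>\<^sub>C) (dC2 b c))"
    by (rule clinearI; unfold eval2_rules[symmetric]; rule eq_C1)
      (simp_all add: eval2_rules clinear_rules[OF *])
  then show "clinear (\<lambda>c. eval2 f (dC2 b c))"
    by (rule clinear_eval2_tensor[OF tensor_C assms])
qed

lemma clinear_dB2_eval:
  assumes "balanced RB f"
  shows "clinear (\<lambda>b. eval2 f (dB2 c b))" "clinear (\<lambda>c. eval2 f (dB2 c b))"
proof -
  have bal: "balanced RB (\<lambda>p q. p \<otimes>\<^sub>B c \<odot> q)" for c
    by (intro balancedI_B lin) (simp add: tenB_ra mult_ra)
  have "clinear (\<lambda>b. eval2 (\<lambda>p q. p \<otimes>\<^sub>B c \<odot> q) (dB1 a b))" for a c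
    by (rule clinear_eval2_tensor[OF tensor_B bal clinear_dB1])
  then have *: "clinear (\<lambda>b. eval2 (\<lambda>p q. a \<odot> p \<otimes>\<^sub>B q) (dB2 c b))"
    "clinear (\<lambda>c. eval2 (\<lambda>p q. a \<odot> p \<otimes>\<^sub>B q) (dB2 c b))" for a b c
    unfolding dB12[symmetric] by (blast, intro lin)
  have "clinear (\<lambda>b. eval2 (\<otimes>\<^sub>B) (dB2 c b))"
    by (rule clinearI; unfold eval2_rules[symmetric]; rule eq_B1)
      (simp_all add: eval2_rules clinear_rules[OF *(1)])
  then show "clinear (\<lambda>b. eval2 f (dB2 c b))"
    by (rule clinear_eval2_tensor[OF tensor_B assms])
  have "clinear (\<lambda>c. eval2 (\<otimes>\<^sub>B) (dB2 c b))"
    by (rule clinearI; unfold eval2_rules[symmetric]; rule eq_B1)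
      (simp_all add: eval2_rules clinear_rules[OF *(2)])
  then show "clinear (\<lambda>c. eval2 f (dB2 c b))"
    by (rule clinear_eval2_tensor[OF tensor_B assms])
qed

lemma dB2_la_B:
  assumes "x \<in> B"
  shows "eval2 (\<otimes>\<^sub>B) (dB2 c (x \<rightharpoonup> b)) = eval2 (\<otimes>\<^sub>B) (dB2 (c \<leftharpoonup> x) b)"
proof (rule eq_B1)
  fix a
  have bal: "balanced RB (\<lambda>p q. p \<otimes>\<^sub>B c \<odot> q)"
    by (intro balancedI_B lin) (simp add: tenB_ra mult_ra)
  have "eval2 (\<lambda>p q. a \<odot> p \<otimes>\<^sub>B q) (dB2 c (x \<rightharpoonup> b)) = eval2 (\<lambda>p q. p \<otimes>\<^sub>B c \<odot> q) (dB1 a (x \<rightharpoonup> b))"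
    by (rule dB12[symmetric])
  also have "\<dots> = eval2 (\<lambda>p q. p \<otimes>\<^sub>B c \<odot> q) (eval2 (\<lambda>p q. gen (p, x \<rightharpoonup> q)) (dB1 a b))"
    by (rule eval2_cong_B[OF bal]) (simp add: eval2_eval2 dB1_la_B assms)
  also have "\<dots> = eval2 (\<lambda>p q. a \<odot> p \<otimes>\<^sub>B q) (dB2 (c \<leftharpoonup> x) b)"
    by (simp add: eval2_eval2 dB12[symmetric] ra_mult)
  finally show "eval2 (\<lambda>p q. a \<odot> p \<otimes>\<^sub>B q) (dB2 c (x \<rightharpoonup> b)) =
      eval2 (\<lambda>p q. a \<odot> p \<otimes>\<^sub>B q) (dB2 (c \<leftharpoonup> x) b)" .
qed

lemma canonical_eq_0:
  assumes "balanced RC f" "\<And>b c. eval2 f (dC2 b c) = 0"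
  shows "f p q = 0"
proof -
  have "f p q = eval2 f (gen (p, q))" by simp
  also have "\<dots> = eval2 f (eval2 (\<lambda>p' q'. dC2 p' (S q')) (dB2 (S' q) p))"
    by (rule eval2_cong_C[OF assms(1)]) (simp add: canonical_surj)
  also have "\<dots> = 0"
    by (simp add: eval2_eval2 assms(2))
  finally show ?thesis .
qed

text \<open>
  A representative of \<open>\<Delta>\<^sub>C(b)(p \<otimes> q)\<close>.
\<close>

definition DC :: "'a \<Rightarrow> 'a \<Rightarrow> 'a \<Rightarrow> 'a tensor2"
  where "DC b p q = eval2 (\<lambda>r s. gen (r \<odot> p, s)) (dC2 b q)"

lemma eval2_DC: "eval2 f (DC b p q) = eval2 (\<lambda>r s. f (r \<odot> p) s) (dC2 b q)"
  by (simp add: DC_def eval2_eval2)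

lemma balanced_mult_left:
  assumes "balanced RC f"
  shows "balanced RC (\<lambda>r s. f (r \<odot> a) s)"
  by (intro balancedI_C balancedD(1)[OF assms] clinear_compose[OF balancedD(2)[OF assms]] lin)
    (simp add: balancedD_C[OF assms] la_mult[symmetric])

lemma balanced_mult_right:
  assumes "balanced RC f"
  shows "balanced RC (\<lambda>r s. f r (s \<odot> a))"
  by (intro balancedI_C balancedD(2)[OF assms] clinear_compose[OF balancedD(1)[OF assms]] lin)
    (simp add: balancedD_C[OF assms] la_mult)

text \<open>
  The elements \<open>\<Delta>\<^sub>C(b)(p \<otimes> q)\<close> span the tensor product, since
  \<open>r e \<otimes> s = (r \<otimes> s)(e \<otimes> 1)\<close> and the \<open>r \<otimes> s\<close> are sums of values of the canonical map.
\<close>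

lemma DC_eq_0:
  assumes "balanced RC f" "\<And>b p q. eval2 f (DC b p q) = 0"
  shows "f p q = 0"
proof -
  have "f (r \<odot> e) s = 0" for r e s
  proof (rule canonical_eq_0[of "\<lambda>r s. f (r \<odot> e) s"])
    show "balanced RC (\<lambda>r s. f (r \<odot> e) s)"
      by (rule balanced_mult_left[OF assms(1)])
    show "eval2 (\<lambda>r s. f (r \<odot> e) s) (dC2 b c) = 0" for b c
      using assms(2)[of b e c] by (simp add: eval2_DC)
  qed
  then have *: "f e q = 0" if "e \<in> {a \<odot> b |a b. True}" for e
    using that by blast
  have "p \<in> cspan {a \<odot> b |a b. True}"
    unfolding idempotent by (rule UNIV_I)
  from complex_vector_pair.linear_eq_on[OF balancedD(2)[OF assms(1)] clinear_const_0 this *]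
  show ?thesis .
qed

text \<open>
  The multiplier \<open>T\<close> is inserted between the inverse of the canonical map and the canonical map:
  \<open>r \<otimes> s \<mapsto> \<Delta>\<^sub>C(T r\<^sup>1)(1 \<otimes> S(r\<^sup>2) s)\<close>.  This is the endomorphism \<open>\<Delta>\<^sub>C(T)\<close>.
\<close>

definition ext :: "'k \<Rightarrow> 'a \<Rightarrow> 'a \<Rightarrow> 'a tensor2"
  where "ext T r s = eval2 (\<lambda>p q. dC2 (T \<rightharpoonup> p) (S q)) (dB2 (S' s) r)"

lemma eval2_ext: "eval2 f (ext T r s) = eval2 (\<lambda>p q. eval2 f (dC2 (T \<rightharpoonup> p) (S q))) (dB2 (S' s) r)"
  by (simp add: ext_def eval2_eval2)

lemma S'_la: "y \<in> C \<Longrightarrow> S' (y \<rightharpoonup> b) = S' b \<leftharpoonup> tC y"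
  by (simp add: S'_eq S_ra_tC)

lemma balanced_dC2_S:
  assumes "balanced RC f"
  shows "balanced RB (\<lambda>p q. eval2 f (dC2 (T \<rightharpoonup> p) (S q)))"
proof (intro balancedI_B)
  show "clinear (\<lambda>q. eval2 f (dC2 (T \<rightharpoonup> p) (S q)))" for p
    by (rule clinear_compose[OF clinear_dC2_eval(2)[OF assms] clinear_S])
  show "clinear (\<lambda>p. eval2 f (dC2 (T \<rightharpoonup> p) (S q)))" for q
    by (rule clinear_compose[OF clinear_dC2_eval(1)[OF assms] clinear_la])
  show "eval2 f (dC2 (T \<rightharpoonup> (p \<leftharpoonup> x)) (S q)) = eval2 f (dC2 (T \<rightharpoonup> p) (S (q \<leftharpoonup> tB x)))"
    if "x \<in> B" for x p q
    by (rule eval2_cong_C[OF assms]) (simp add: la_ra dC2_ra_B S_ra_tB that)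
qed

lemma balanced_ext:
  assumes f: "balanced RC f"
  shows "balanced RC (\<lambda>r s. eval2 f (ext T r s))"
  unfolding eval2_ext
proof (intro balancedI_C)
  note bal = balanced_dC2_S[OF f, of T]
  show "clinear (\<lambda>s. eval2 (\<lambda>p q. eval2 f (dC2 (T \<rightharpoonup> p) (S q))) (dB2 (S' s) r))" for r
    by (rule clinear_compose[OF clinear_dB2_eval(2)[OF bal] clinear_S'])
  show "clinear (\<lambda>r. eval2 (\<lambda>p q. eval2 f (dC2 (T \<rightharpoonup> p) (S q))) (dB2 (S' s) r))" for s
    by (rule clinear_dB2_eval(1)[OF bal])
  show "eval2 (\<lambda>p q. eval2 f (dC2 (T \<rightharpoonup> p) (S q))) (dB2 (S' s) (tC y \<rightharpoonup> r)) =
      eval2 (\<lambda>p q. eval2 f (dC2 (T \<rightharpoonup> p) (S q))) (dB2 (S' (y \<rightharpoonup> s)) r)" if "y \<in> C" for y r s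
    by (rule eval2_cong_B[OF bal]) (simp add: dB2_la_B tC_range S'_la that)
qed

lemma ext_dC2:
  assumes f: "balanced RC f"
  shows "eval2 (\<lambda>r s. eval2 f (ext T r s)) (dC2 b c) = eval2 f (dC2 (T \<rightharpoonup> b) c)"
proof -
  let ?g = "\<lambda>p q. eval2 f (dC2 (T \<rightharpoonup> p) (S q))"
  have "eval2 (\<lambda>r s. eval2 f (ext T r s)) (dC2 b c) =
      eval2 ?g (eval2 (\<lambda>r s. dB2 (S' s) r) (dC2 b (S (S' c))))"
    by (simp add: eval2_ext eval2_eval2)
  also have "\<dots> = eval2 ?g (gen (b, S' c))"
    by (rule eval2_cong_B[OF balanced_dC2_S[OF f]]) (simp only: canonical_inverse eval2_gen)
  finally show ?thesis by simp
qed

lemma balanced_DC: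
  assumes "balanced RC f"
  shows "balanced RC (\<lambda>r s. eval2 f (DC b r s))"
proof -
  note DC = dC_balanced[of b, folded eval2_DC]
  show ?thesis
  proof (rule balancedI_C)
    show "clinear (\<lambda>s. eval2 f (DC b r s))" for r
      by (rule clinear_eval2_tensor[OF tensor_C assms balancedD(1)[OF DC]])
    show "clinear (\<lambda>r. eval2 f (DC b r s))" for s
      by (rule clinear_eval2_tensor[OF tensor_C assms balancedD(2)[OF DC]])
    show "eval2 f (DC b (tC y \<rightharpoonup> r) s) = eval2 f (DC b r (y \<rightharpoonup> s))" if "y \<in> C" for y r s
      by (rule eval2_cong_C[OF assms]) (rule balancedD_C[OF DC that])
  qed
qed

lemma dC2_mult_eval:
  assumes "balanced RC f"
  shows "eval2 f (dC2 (b \<odot> b') c) = eval2 (\<lambda>p q. eval2 f (DC b p q)) (dC2 b' c)"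
  using eval2_cong_C[OF assms, of "dC2 (b \<odot> b') c" "eval2 (DC b) (dC2 b' c)"] dC2_mult
  by (simp add: eval2_eval2 eval2_DC)

text \<open>
  For elements \<open>\<Delta>\<^sub>C(b)(1 \<otimes> c)\<close> this is \<open>ext_dC2\<close>.  It extends to \<open>\<Delta>\<^sub>C(b)(p \<otimes> q)\<close> by writing \<open>p \<otimes> q\<close> as a
  sum of values of the canonical map and by multiplicativity of \<open>\<Delta>\<^sub>C\<close>.
\<close>

lemma ext_DC:
  assumes f: "balanced RC f"
  shows "eval2 (\<lambda>r s. eval2 f (ext T r s)) (DC b p q) = eval2 f (DC (T \<rightharpoonup> b) p q)"
proof -
  let ?g = "\<lambda>r s. eval2 f (ext T r s)"
  let ?w = "eval2 (\<lambda>p q. dC2 p (S q)) (dB2 (S' q) p)"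
  have w: "eval2 g ?w = g p q" if "balanced RC g" for g :: "'a \<Rightarrow> 'a \<Rightarrow> 'w::complex_vector"
    using eval2_cong_C[OF that, of ?w "gen (p, q)"] canonical_surj[of "S' q" p] by simp
  note bal = balanced_ext[OF f, of T]
  have "eval2 ?g (DC b p q) = eval2 (\<lambda>p q. eval2 ?g (DC b p q)) ?w"
    by (rule w[OF balanced_DC[OF bal], symmetric])
  also have "\<dots> = eval2 (\<lambda>p q. eval2 f (DC (T \<rightharpoonup> b) p q)) ?w"
    by (simp add: eval2_eval2 dC2_mult_eval[OF bal, symmetric] dC2_mult_eval[OF f, symmetric]
        ext_dC2[OF f] la_mult)
  also have "\<dots> = eval2 f (DC (T \<rightharpoonup> b) p q)"
    by (rule w[OF balanced_DC[OF f]])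
  finally show ?thesis .
qed

lemma DC_right:
  assumes "balanced RC f"
  shows "eval2 (\<lambda>r s. f (r \<odot> a) (s \<odot> b)) (dC2 x c) = eval2 f (DC x a (c \<odot> b))"
  using dC12_eval[OF balanced_mult_right[OF assms], of c b x a] dC12_eval[OF assms, of "c \<odot> b" x a]
  by (simp add: eval2_DC assoc)

lemma canonical_eq:
  assumes "balanced RC f" "balanced RC g" "\<And>b c. eval2 f (dC2 b c) = eval2 g (dC2 b c)"
  shows "eval2 f u = eval2 g u"
proof -
  have "f p q - g p q = 0" for p q
    by (rule canonical_eq_0[OF balanced_diff[OF assms(1,2)]]) (simp add: eval2_diff_fun assms(3))
  then have "f = g" by (intro ext) simp
  then show ?thesis by simp
qed

text \<open>
  Right linearity of \<open>\<Delta>\<^sub>C(T)\<close> over \<open>A \<otimes> A\<close>; it suffices to check it on values of the canonical map.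
\<close>

lemma ext_mult:
  assumes f: "balanced RC f"
  shows "eval2 (\<lambda>r s. eval2 f (ext T (r \<odot> a) (s \<odot> b))) u =
    eval2 (\<lambda>r s. f (r \<odot> a) (s \<odot> b)) (eval2 (ext T) u)"
proof -
  have f': "balanced RC (\<lambda>r s. f (r \<odot> a) (s \<odot> b))"
    by (rule balanced_mult_left[OF balanced_mult_right[OF f]])
  show ?thesis unfolding eval2_eval2
  proof (rule canonical_eq)
    show "balanced RC (\<lambda>r s. eval2 f (ext T (r \<odot> a) (s \<odot> b)))"
      by (rule balanced_mult_left[OF balanced_mult_right[OF balanced_ext[OF f]]])
    show "balanced RC (\<lambda>r s. eval2 (\<lambda>r s. f (r \<odot> a) (s \<odot> b)) (ext T r s))"
      by (rule balanced_ext[OF f'])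
    show "eval2 (\<lambda>r s. eval2 f (ext T (r \<odot> a) (s \<odot> b))) (dC2 x c) =
        eval2 (\<lambda>r s. eval2 (\<lambda>r s. f (r \<odot> a) (s \<odot> b)) (ext T r s)) (dC2 x c)" for x c
      by (simp add: ext_dC2[OF f'] DC_right[OF balanced_ext[OF f]] DC_right[OF f] ext_DC[OF f])
  qed
qed

text \<open>
  The rule \<open>\<Delta>\<^sub>C(c) \<Delta>\<^sub>C(T) = \<Delta>\<^sub>C(c T)\<close>, with the multiplier on the other side than in the defining
  property of \<open>\<Delta>\<^sub>C(T)\<close>.
\<close>

lemma DC_ext:
  assumes f: "balanced RC f"
  shows "eval2 (\<lambda>r s. eval2 f (DC c r s)) (eval2 (ext T) u) = eval2 (\<lambda>r s. eval2 f (DC (c \<leftharpoonup> T) r s)) u"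
  unfolding eval2_eval2
proof (rule canonical_eq)
  note f' = balanced_DC[OF f, of c]
  show "balanced RC (\<lambda>p q. eval2 (\<lambda>r s. eval2 f (DC c r s)) (ext T p q))"
    by (rule balanced_ext[OF f'])
  show "balanced RC (\<lambda>r s. eval2 f (DC (c \<leftharpoonup> T) r s))"
    by (rule balanced_DC[OF f])
  show "eval2 (\<lambda>p q. eval2 (\<lambda>r s. eval2 f (DC c r s)) (ext T p q)) (dC2 b q) =
      eval2 (\<lambda>r s. eval2 f (DC (c \<leftharpoonup> T) r s)) (dC2 b q)" for b q
    by (simp add: ext_dC2[OF f'] dC2_mult_eval[OF f, symmetric] ra_mult)
qed

text \<open>
  The opposite algebra with flipped tensor factors: \<open>B\<close> and \<open>C\<close>, the maps \<open>t\<^sub>B\<close> and \<open>t\<^sub>C\<close>, the two counits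
  and the two comultiplications change places, while the antipode stays the same.
\<close>

lemma mirror:
  "Hopf_frame (\<lambda>a b. b \<odot> a) (\<lambda>k a. a \<leftharpoonup> k) (\<lambda>a k. k \<rightharpoonup> a) C B tC tB
    (\<lambda>a b. b \<otimes>\<^sub>C a) (\<lambda>a b. b \<otimes>\<^sub>B a)
    (\<lambda>a b. flip2 (dC2 b a)) (\<lambda>c b. flip2 (dC1 b c)) (\<lambda>b a. flip2 (dB2 a b)) (\<lambda>b c. flip2 (dB1 c b))
    eC eB S"
proof -
  have RC: "{(\<lambda>a. y \<rightharpoonup> a, \<lambda>b. tC y \<rightharpoonup> b) |y. y \<in> C} = (\<lambda>(f, g). (g, f)) ` RC"
    and RB: "{(\<lambda>a. a \<leftharpoonup> tB x, \<lambda>b. b \<leftharpoonup> x) |x. x \<in> B} = (\<lambda>(f, g). (g, f)) ` RB"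
    by (simp_all only: setcompr_eq_image image_image prod.case)
  show ?thesis
    apply (rule Hopf_frame.intro)
    unfolding RC RB balanced_flip eval2_flip2
    subgoal using mult_balanced by (simp add: balanced_def)
    subgoal by (simp add: assoc)
    subgoal by (rule nondeg_right)
    subgoal by (rule nondeg_left)
    subgoal using idempotent by (rule back_subst[of "\<lambda>X. cspan X = UNIV"]) (auto)
    subgoal by (rule clinear_ra)
    subgoal by (rule clinear_la)
    subgoal by (simp only: mult_ra)
    subgoal by (simp only: la_mult)
    subgoal by (simp only: ra_mult)
    subgoal by (rule tensor_product_flip[OF tensor_C])
    subgoal by (rule tensor_product_flip[OF tensor_B])
    subgoal for u using cancel_C2[of "flip2 u"] by simp
    subgoal for u using cancel_C1[of "flip2 u"] by simp
    subgoal for u using cancel_B2[of "flip2 u"] by simp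
    subgoal for u using cancel_B1[of "flip2 u"] by simp
    subgoal by (rule dC12[symmetric])
    subgoal by (rule dB12[symmetric])
    subgoal by (rule clinear_dC2)
    subgoal by (rule clinear_dB1)
    subgoal by (rule dC_balanced)
    subgoal by (rule dB_balanced)
    subgoal by (rule dC2_mult)
    subgoal by (rule dB1_mult)
    subgoal by (rule dC2_ra_C)
    subgoal by (rule dC2_ra_B)
    subgoal by (rule dB1_la_B)
    subgoal by (rule dB1_la_C)
    subgoal by (rule tC_range)
    subgoal by (rule tB_range)
    subgoal by (rule eC_range)
    subgoal by (rule eB_range)
    subgoal by (rule clinear_eC)
    subgoal by (rule clinear_eB)
    subgoal by (rule eC_la)
    subgoal by (rule eC_la_t)
    subgoal by (rule eB_ra)
    subgoal by (rule eB_ra_t)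
    subgoal by (rule counit_C2)
    subgoal by (rule counit_C1)
    subgoal by (rule counit_B2)
    subgoal by (rule counit_B1)
    subgoal by (rule clinear_S)
    subgoal by (rule bij_S)
    subgoal by (rule S_mult)
    subgoal by (rule S_ra_tB)
    subgoal by (rule S_la_tB)
    subgoal by (rule S_ra_tC)
    subgoal by (rule S_la_tC)
    subgoal by (rule antipode_C2)
    subgoal by (rule antipode_B1)
    subgoal for \<Phi> a b c
      by (rule coassoc_CB[of "\<lambda>r s q. \<Phi> q s r", symmetric]) (simp_all only: disj_commute)
    subgoal for \<Phi> a b c
      by (rule coassoc_BC[of "\<lambda>r s q. \<Phi> q s r", symmetric]) (simp_all only: disj_commute)
    done
qed

end

section \<open>Cosets\<close>

lemma mem_qclass: "v \<in> qclass N u \<longleftrightarrow> v - u \<in> N"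
  by (simp add: qclass_def)

lemma qclass_self: "csubspace N \<Longrightarrow> u \<in> qclass N u"
  by (simp add: mem_qclass complex_vector.subspace_0)

lemma qclass_eq_iff:
  assumes "csubspace N"
  shows "qclass N u = qclass N v \<longleftrightarrow> u - v \<in> N"
proof
  show "u - v \<in> N" if "qclass N u = qclass N v"
    using qclass_self[OF assms, of u] that by (simp add: mem_qclass)
  assume uv: "u - v \<in> N"
  have "w - u \<in> N \<longleftrightarrow> w - v \<in> N" for w
    using complex_vector.subspace_add[OF assms _ uv, of "w - u"]
      complex_vector.subspace_diff[OF assms _ uv, of "w - v"] by auto
  then show "qclass N u = qclass N v"
    by (simp add: qclass_def)
qed

definition rep :: "'v set \<Rightarrow> 'v"
  where "rep X = (SOME u. u \<in> X)"

lemma rep_in: "X \<noteq> {} \<Longrightarrow> rep X \<in> X"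
  unfolding rep_def by (rule someI_ex) auto

lemma qclass_rep:
  assumes "csubspace N" "X \<in> qspace N"
  shows "qclass N (rep X) = X"
proof -
  obtain u where u: "X = qclass N u" using assms(2) by (auto simp: qspace_def)
  then have "rep X \<in> qclass N u" using rep_in[of X] qclass_self[OF assms(1)] by auto
  then show ?thesis by (simp add: u qclass_eq_iff[OF assms(1)] mem_qclass)
qed

lemma qclass_in_qspace [simp]: "qclass N u \<in> qspace N"
  by (simp add: qspace_def)

lemma tens_in_qspace [simp]: "tens N a b \<in> qspace N"
  by (simp add: tens_def)

definition val :: "'v::complex_vector set \<Rightarrow> 'v set \<Rightarrow> 'v"
  where "val N X = proj N (rep X)"

lemma val_qclass:
  assumes "csubspace N"
  shows "val N (qclass N u) = proj N u"
  using qclass_rep[OF assms qclass_in_qspace, of u]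
  by (simp add: val_def proj_eq_iff[OF assms] qclass_eq_iff[OF assms])

lemma val_eqD:
  assumes "csubspace N" "X \<in> qspace N" "Y \<in> qspace N" "val N X = val N Y"
  shows "X = Y"
  using assms(4) qclass_rep[OF assms(1,2)] qclass_rep[OF assms(1,3)]
  by (metis val_def proj_eq_iff[OF assms(1)] qclass_eq_iff[OF assms(1)])

lemma qadd_qclass:
  assumes "csubspace N"
  shows "qadd N (qclass N u) (qclass N v) = qclass N (u + v)"
proof -
  have "qclass N (u' + v') = qclass N (u + v)" if "u' \<in> qclass N u" "v' \<in> qclass N v" for u' v'
    using complex_vector.subspace_add[OF assms, of "u' - u" "v' - v"] that
    by (simp add: qclass_eq_iff[OF assms] mem_qclass algebra_simps)
  then show ?thesis
    using qclass_self[OF assms, of u] qclass_self[OF assms, of v] unfolding qadd_def by blast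
qed

lemma qscale_qclass:
  assumes "csubspace N"
  shows "qscale N c (qclass N u) = qclass N (c *\<^sub>C u)"
proof -
  have "qclass N (c *\<^sub>C u') = qclass N (c *\<^sub>C u)" if "u' \<in> qclass N u" for u'
    using complex_vector.subspace_scale[OF assms, of "u' - u" c] that
    by (simp add: qclass_eq_iff[OF assms] mem_qclass complex_vector.scale_right_diff_distrib)
  then show ?thesis
    using qclass_self[OF assms, of u] unfolding qscale_def by blast
qed

lemma val_qadd:
  assumes N: "csubspace N" and X: "X \<in> qspace N" "Y \<in> qspace N"
  shows "val N (qadd N X Y) = val N X + val N Y"
proof -
  obtain u v where uv: "X = qclass N u" "Y = qclass N v" using X by (auto simp: qspace_def)
  show ?thesis
    by (simp add: uv qadd_qclass[OF N] val_qclass[OF N] clinear_rules[OF proj(1)[OF N]])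
qed

lemma val_qscale:
  assumes N: "csubspace N" and X: "X \<in> qspace N"
  shows "val N (qscale N c X) = c *\<^sub>C val N X"
proof -
  obtain u where u: "X = qclass N u" using X by (auto simp: qspace_def)
  show ?thesis
    by (simp add: u qscale_qclass[OF N] val_qclass[OF N] clinear_rules[OF proj(1)[OF N]])
qed

lemma qEnd_in_qspace: "T \<in> qEnd N \<Longrightarrow> X \<in> qspace N \<Longrightarrow> T X \<in> qspace N"
  by (simp add: qEnd_def)

lemma clinear_qEnd:
  assumes N: "csubspace N" and T: "T \<in> qEnd N"
  shows "clinear (\<lambda>u. val N (T (qclass N u)))"
proof (rule clinearI)
  show "val N (T (qclass N (u + v))) = val N (T (qclass N u)) + val N (T (qclass N v))" for u v
    using T unfolding qadd_qclass[OF N, symmetric] by (simp add: qEnd_def val_qadd[OF N])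
  show "val N (T (qclass N (c *\<^sub>C u))) = c *\<^sub>C val N (T (qclass N u))" for c u
    using T unfolding qscale_qclass[OF N, symmetric] by (simp add: qEnd_def val_qscale[OF N])
qed

lemma clinear_tensor2_eq_eval2: "clinear F \<Longrightarrow> F u = eval2 (\<lambda>p q. F (gen (p, q))) u"
  using clinear_apply_eval2[of F "\<lambda>p q. gen (p, q)" u] by simp

lemma balanced_clinear:
  assumes F: "clinear F" and ker: "\<And>u. u \<in> relations2 R \<Longrightarrow> F u = 0"
  shows "balanced R (\<lambda>p q. F (gen (p, q)))"
proof -
  have "F u = F (proj (relations2 R) u)" for u
  proof -
    have "proj (relations2 R) (u - proj (relations2 R) u) = 0"
      by (simp add: clinear_rules[OF proj(1)] proj(3) csubspace_relations2)
    then show ?thesis using ker[of "u - proj (relations2 R) u"]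
      by (simp add: proj(2) csubspace_relations2 clinear_rules[OF F])
  qed
  then have *: "(\<lambda>p q. F (gen (p, q))) = (\<lambda>p q. F (tens_val (relations2 R) p q))"
    by (simp add: tens_val_def)
  have "balanced R (\<lambda>p q. F (tens_val (relations2 R) p q))"
    by (rule balanced_compose[OF F]) (use tensor_product_tens_val[of R] in \<open>simp add: tensor_product_def\<close>)
  then show ?thesis by (simp only: *)
qed

lemma qEnd_eval2:
  assumes T: "T \<in> qEnd (relations2 R)"
  shows "balanced R (\<lambda>p q. val (relations2 R) (T (tens (relations2 R) p q)))"
    and "val (relations2 R) (T (qclass (relations2 R) u)) =
      eval2 (\<lambda>p q. val (relations2 R) (T (tens (relations2 R) p q))) u"
proof -
  note N = csubspace_relations2[of R]
  note lin = clinear_qEnd[OF N T]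
  have "val (relations2 R) (T (qclass (relations2 R) u)) = 0" if "u \<in> relations2 R" for u
    using that qclass_eq_iff[OF N, of u 0] clinear_rules(3)[OF lin] by simp
  from balanced_clinear[OF lin this]
  show "balanced R (\<lambda>p q. val (relations2 R) (T (tens (relations2 R) p q)))"
    by (simp add: tens_def)
  show "val (relations2 R) (T (qclass (relations2 R) u)) =
      eval2 (\<lambda>p q. val (relations2 R) (T (tens (relations2 R) p q))) u"
    using clinear_tensor2_eq_eval2[OF lin, of u] by (simp add: tens_def)
qed

text \<open>
  The union \<open>qlift M f X\<close> over all choices of representatives need not be a single coset.  Still, a
  functional that vanishes on \<open>M\<close> takes, on each of its elements, the value computed from some
  representative of \<open>X\<close>; together with \<open>qlift_functional_attained\<close> this allows two such unions to be
  compared when only one of them is known to be well-defined.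
\<close>

lemma qlift_functional:
  assumes \<phi>: "clinear \<phi>" "\<And>m. m \<in> M \<Longrightarrow> \<phi> m = 0"
    and F: "\<And>x w. w \<in> f x \<Longrightarrow> \<phi> w = F x"
    and w: "w \<in> qlift M f X"
  shows "\<exists>u\<in>X. \<phi> w = lin_ext F u"
proof -
  from w obtain u g where u: "u \<in> X" "\<forall>x. g x \<in> f x" "w - lin_ext g u \<in> M"
    by (auto simp: qlift_def mem_qclass)
  have "\<phi> w = \<phi> (lin_ext g u)"
    using \<phi>(2)[OF u(3)] by (simp add: clinear_rules[OF \<phi>(1)])
  also have "\<dots> = lin_ext F u"
  proof -
    have "(\<lambda>x. \<phi> (g x)) = F" using u(2) F by blast
    then show ?thesis by (simp add: clinear_apply_lin_ext[OF \<phi>(1)])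
  qed
  finally show ?thesis using u(1) by blast
qed

lemma lin_ext_in_qlift:
  assumes "csubspace M" "u \<in> X" "\<And>x. g x \<in> f x"
  shows "lin_ext g u \<in> qlift M f X"
  unfolding qlift_def using assms qclass_self[OF assms(1), of "lin_ext g u"] by blast

lemma qlift_functional_attained:
  assumes M: "csubspace M" and \<phi>: "clinear \<phi>"
    and F: "\<And>x w. w \<in> f x \<Longrightarrow> \<phi> w = F x"
    and "u \<in> X" "\<And>x. f x \<noteq> {}"
  shows "\<exists>w\<in>qlift M f X. \<phi> w = lin_ext F u"
proof (rule bexI)
  have g: "rep (f x) \<in> f x" for x
    using assms(5) by (rule rep_in)
  show "lin_ext (\<lambda>x. rep (f x)) u \<in> qlift M f X"
    by (rule lin_ext_in_qlift[OF M assms(4) g])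
  show "\<phi> (lin_ext (\<lambda>x. rep (f x)) u) = lin_ext F u"
    using F[OF g] by (simp add: clinear_apply_lin_ext[OF \<phi>])
qed

text \<open>
  Conversely, if the union happens to be a coset, all choices give the same result.  The equation
  defining a morphism therefore implies that \<open>\<pi> \<otimes> \<pi>\<close> is well-defined.
\<close>

lemma qlift_value:
  assumes M: "csubspace M" and "qlift M f X = qclass M v" "u \<in> X" "\<And>x. g x \<in> f x"
  shows "qclass M (lin_ext g u) = qclass M v"
  using lin_ext_in_qlift[where g = g, OF assms(1,3,4)] assms(2)
  by (simp add: mem_qclass qclass_eq_iff[OF M])

lemma qlift_qclass:
  assumes M: "csubspace M" and N: "csubspace N" and g: "\<And>x. f x = qclass M (g x)"
    and ker: "\<And>n. n \<in> N \<Longrightarrow> lin_ext g n \<in> M"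
  shows "qlift M f (qclass N u) = qclass M (lin_ext g u)"
proof -
  have "qclass M (lin_ext g' u') = qclass M (lin_ext g u)"
    if "u' \<in> qclass N u" "\<forall>x. g' x \<in> f x" for u' g'
  proof -
    have "lin_ext (\<lambda>x. g' x - g x) u' \<in> M"
      using that(2) by (intro lin_ext_in_subspace[OF M]) (simp add: g mem_qclass)
    moreover have "lin_ext g (u' - u) \<in> M"
      using that(1) by (intro ker) (simp add: mem_qclass)
    ultimately have "lin_ext g' u' - lin_ext g u \<in> M"
      using complex_vector.subspace_add[OF M]
      by (fastforce simp: lin_ext_diff_fun clinear_rules[OF clinear_lin_ext])
    then show ?thesis by (simp add: qclass_eq_iff[OF M])
  qed
  moreover have "u \<in> qclass N u" "\<forall>x. g x \<in> f x"
    by (simp_all add: qclass_self M N g)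
  ultimately show ?thesis
    unfolding qlift_def by blast
qed

lemma qeval_qclass:
  assumes N: "csubspace N" and ker: "\<And>n. n \<in> N \<Longrightarrow> lin_ext f n = 0"
  shows "qeval f (qclass N u) = lin_ext f u"
proof -
  have "lin_ext f u' = lin_ext f u" if "u' \<in> qclass N u" for u'
    using ker[of "u' - u"] that by (simp add: mem_qclass clinear_rules[OF clinear_lin_ext])
  then have "lin_ext f ` qclass N u = {lin_ext f u}"
    using qclass_self[OF N] by blast
  then show ?thesis by (simp add: qeval_def)
qed

lemma qeval_balanced:
  assumes "balanced R f"
  shows "qeval (\<lambda>(p, q). f p q) (qclass (relations2 R) u) = eval2 f u"
  unfolding eval2_def using eval2_relations2[OF assms, unfolded eval2_def]
  by (intro qeval_qclass csubspace_relations2) auto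

lemma qlift_balanced:
  assumes "balanced R (\<lambda>p q. proj M (gen (g p q)))" and M: "csubspace M"
  shows "qlift M (\<lambda>(p, q). qclass M (gen (g p q))) (qclass (relations2 R) u) =
    qclass M (eval2 (\<lambda>p q. gen (g p q)) u)"
  unfolding eval2_def
proof (rule qlift_qclass[OF M csubspace_relations2])
  show "lin_ext (\<lambda>(p, q). gen (g p q)) n \<in> M" if "n \<in> relations2 R" for n
    using eval2_relations2[OF assms(1) that] proj(2)[OF M]
    by (simp add: clinear_apply_eval2[OF proj(1)[OF M], symmetric] eval2_def)
qed auto

lemma the_coset:
  assumes N: "csubspace N" and ex: "\<exists>X\<in>qspace N. \<forall>c. D c = act X c"
    and act: "\<And>u c. act (qclass N u) c = qclass N (F c u)" and F: "\<And>c. clinear (F c)"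
    and cancel: "\<And>u. (\<And>c. F c u \<in> N) \<Longrightarrow> u \<in> N"
    and X: "X = (THE X. X \<in> qspace N \<and> (\<forall>c. D c = act X c))"
  shows "X = qclass N (rep X)" "D c = qclass N (F c (rep X))"
proof -
  let ?P = "\<lambda>X. X \<in> qspace N \<and> (\<forall>c. D c = act X c)"
  have "\<exists>!X. ?P X"
  proof (rule ex_ex1I)
    show "\<exists>X. ?P X" using ex by blast
    show "Y = Z" if Y: "?P Y" and Z: "?P Z" for Y Z
    proof -
      obtain u v where uv: "Y = qclass N u" "Z = qclass N v"
        using Y Z by (auto simp: qspace_def)
      have eq: "act Y c = act Z c" for c
        using Y Z by metis
      have "F c (u - v) \<in> N" for c
        using eq[of c] by (simp add: uv act qclass_eq_iff[OF N] clinear_rules[OF F])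
      then show ?thesis
        using cancel by (simp add: uv qclass_eq_iff[OF N])
    qed
  qed
  then have P: "?P X"
    unfolding X by (rule theI')
  then show X': "X = qclass N (rep X)"
    by (intro qclass_rep[symmetric] N) blast
  have "D c = act X c"
    using P by blast
  then show "D c = qclass N (F c (rep X))"
    by (subst (asm) X') (simp only: act)
qed

lemma csubspace_relations3: "csubspace (relations3 R R')"
  unfolding relations3_def by (rule complex_vector.subspace_span)

lemma eval2_cong_relations2:
  assumes "balanced R f" "u \<in> qclass (relations2 R) v"
  shows "eval2 f u = eval2 f v"
  using eval2_relations2[OF assms(1), of "u - v"] assms(2) by (simp add: mem_qclass eval2_rules)

lemma lin_ext_relations3:
  assumes \<Phi>: "\<And>q. balanced R (\<lambda>r s. \<Phi> r s q)" "\<And>p. balanced R' (\<Phi> p)"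
    and "m \<in> relations3 R R'"
  shows "lin_ext (\<lambda>(r, s, q). \<Phi> r s q) m = 0"
proof -
  note lin = clinear_rules[OF clinear_lin_ext]
  note \<Phi>_rules = clinear_rules[OF balancedD(1)[OF \<Phi>(1)]] clinear_rules[OF balancedD(2)[OF \<Phi>(1)]]
    clinear_rules[OF balancedD(1)[OF \<Phi>(2)]] balancedD(3)[OF \<Phi>(1)] balancedD(3)[OF \<Phi>(2)]
  have "csubspace {m. lin_ext (\<lambda>(r, s, q). \<Phi> r s q) m = 0}"
    by (rule clinear_kernel[OF clinear_lin_ext])
  then have "relations3 R R' \<subseteq> {m. lin_ext (\<lambda>(r, s, q). \<Phi> r s q) m = 0}"
    unfolding relations3_def
    by (intro complex_vector.span_minimal) (auto simp: lin \<Phi>_rules)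
  with assms(3) show ?thesis by auto
qed

text \<open>
  The coassociativity laws are equations between two unions \<open>qlift\<close>.  They are evaluated by the linear
  functional that \<open>\<Phi>\<close> induces on the threefold tensor product: starting from the side that is not known
  to be well-defined, one finds a common element whose value is computed from the given
  representatives, and well-definedness of the other side determines the value there.
\<close>

lemma coassociativity_functional:
  fixes x y :: "'a::complex_algebra \<Rightarrow> 'a tensor2" and \<Phi> :: "'a \<Rightarrow> 'a \<Rightarrow> 'a \<Rightarrow> 'w::complex_vector"
  assumes \<Phi>: "\<And>q. balanced R (\<lambda>r s. \<Phi> r s q)" "\<And>p. balanced R' (\<Phi> p)"
    and eq: "qlift (relations3 R R') (\<lambda>(p, q). tens_right (relations3 R R') (qclass (relations2 R) (x p)) q)
        (qclass (relations2 R') u) =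
      qlift (relations3 R R') (\<lambda>(p, q). tens_left (relations3 R R') p (qclass (relations2 R') (y q)))
        (qclass (relations2 R) v)"
    and disj: "balanced R (\<lambda>p q. eval2 (\<Phi> p) (y q)) \<or> balanced R' (\<lambda>p q. eval2 (\<lambda>r s. \<Phi> r s q) (x p))"
  shows "eval2 (\<lambda>p q. eval2 (\<lambda>r s. \<Phi> r s q) (x p)) u = eval2 (\<lambda>p q. eval2 (\<Phi> p) (y q)) v"
proof -
  let ?M = "relations3 R R'"
  let ?F = "\<lambda>p q. eval2 (\<lambda>r s. \<Phi> r s q) (x p)" and ?G = "\<lambda>p q. eval2 (\<Phi> p) (y q)"
  let ?f = "\<lambda>(p, q). tens_right ?M (qclass (relations2 R) (x p)) q"
  let ?g = "\<lambda>(p, q). tens_left ?M p (qclass (relations2 R') (y q))"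
  define \<phi> where "\<phi> = lin_ext (\<lambda>(r, s, q). \<Phi> r s q)"
  have lin: "clinear \<phi>" unfolding \<phi>_def by (rule clinear_lin_ext)
  have ker: "\<phi> m = 0" if "m \<in> ?M" for m
    unfolding \<phi>_def using \<Phi> that by (rule lin_ext_relations3)
  have gen: "\<phi> w = \<Phi> r s q" if "w \<in> qclass ?M (gen (r, s, q))" for w r s q
    using ker[of "w - gen (r, s, q)"] that by (simp add: mem_qclass clinear_rules[OF lin]) (simp add: \<phi>_def)
  have right: "\<phi> w = ?F p q" if w: "w \<in> tens_right ?M (qclass (relations2 R) (x p)) q" for w p q
  proof -
    have "\<exists>u'\<in>qclass (relations2 R) (x p). \<phi> w = lin_ext (\<lambda>(r, s). \<Phi> r s q) u'"
      using w unfolding tens_right_def by (rule qlift_functional[OF lin ker, rotated 2]) (auto dest: gen)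
    then show ?thesis
      using eval2_cong_relations2[OF \<Phi>(1)] by (auto simp: eval2_def)
  qed
  have left: "\<phi> w = ?G p q" if w: "w \<in> tens_left ?M p (qclass (relations2 R') (y q))" for w p q
  proof -
    have "\<exists>u'\<in>qclass (relations2 R') (y q). \<phi> w = lin_ext (\<lambda>(r, s). \<Phi> p r s) u'"
      using w unfolding tens_left_def by (rule qlift_functional[OF lin ker, rotated 2]) (auto dest: gen)
    then show ?thesis
      using eval2_cong_relations2[OF \<Phi>(2)] by (auto simp: eval2_def)
  qed
  note M = csubspace_relations3[of R R'] and N = csubspace_relations2
  have F: "\<phi> w = (case z of (p, q) \<Rightarrow> ?F p q)" if "w \<in> ?f z" for w z
    using that right by (cases z) simp
  have G: "\<phi> w = (case z of (p, q) \<Rightarrow> ?G p q)" if "w \<in> ?g z" for w z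
    using that left by (cases z) simp
  have ne: "?f z \<noteq> {}" "?g z \<noteq> {}" for z
  proof -
    obtain p q where z: "z = (p, q)" by (cases z)
    have "lin_ext (\<lambda>(r, s). gen (r, s, q)) (x p) \<in> tens_right ?M (qclass (relations2 R) (x p)) q"
      unfolding tens_right_def by (rule lin_ext_in_qlift[OF M]) (auto simp: qclass_self N M)
    moreover have "lin_ext (\<lambda>(r, s). gen (p, r, s)) (y q) \<in> tens_left ?M p (qclass (relations2 R') (y q))"
      unfolding tens_left_def by (rule lin_ext_in_qlift[OF M]) (auto simp: qclass_self N M)
    ultimately show "?f z \<noteq> {}" "?g z \<noteq> {}" by (auto simp: z)
  qed
  from disj show ?thesis
  proof
    assume bal: "balanced R ?G"
    have "\<exists>w\<in>qlift ?M ?f (qclass (relations2 R') u). \<phi> w = lin_ext (case_prod ?F) u"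
      by (rule qlift_functional_attained[OF M lin F qclass_self[OF N] ne(1)])
    then obtain w where w: "w \<in> qlift ?M ?f (qclass (relations2 R') u)" "\<phi> w = eval2 ?F u"
      unfolding eval2_def[of ?F u] by blast
    have "\<exists>v'\<in>qclass (relations2 R) v. \<phi> w = lin_ext (case_prod ?G) v'"
      by (rule qlift_functional[OF lin ker G w(1)[unfolded eq]])
    then obtain v' where "v' \<in> qclass (relations2 R) v" "\<phi> w = eval2 ?G v'"
      unfolding eval2_def[of ?G] by blast
    with w(2) eval2_cong_relations2[OF bal] show ?thesis by simp
  next
    assume bal: "balanced R' ?F"
    have "\<exists>w\<in>qlift ?M ?g (qclass (relations2 R) v). \<phi> w = lin_ext (case_prod ?G) v"
      by (rule qlift_functional_attained[OF M lin G qclass_self[OF N] ne(2)])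
    then obtain w where w: "w \<in> qlift ?M ?g (qclass (relations2 R) v)" "\<phi> w = eval2 ?G v"
      unfolding eval2_def[of ?G v] by blast
    have "\<exists>u'\<in>qclass (relations2 R') u. \<phi> w = lin_ext (case_prod ?F) u'"
      by (rule qlift_functional[OF lin ker F w(1)[folded eq]])
    then obtain u' where "u' \<in> qclass (relations2 R') u" "\<phi> w = eval2 ?F u'"
      unfolding eval2_def[of ?F] by blast
    with w(2) eval2_cong_relations2[OF bal] show ?thesis by simp
  qed
qed

section \<open>The tensor products and comultiplications of a multiplier bialgebroid\<close>

lemma mult_left_mult: "T \<rhd> (a * b) = (T \<rhd> a) * b"
  and mult_right_mult: "(a * b) \<lhd> T = a * (b \<lhd> T)"
  and mult_right_left: "(a \<lhd> T) * b = a * (T \<rhd> b)"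
  by (transfer; auto)+

lemma nondegenerate_algebraD:
  assumes "nondegenerate_algebra TYPE('a::complex_algebra)"
  shows "(\<And>b. a * b = 0) \<Longrightarrow> a = (0::'a)" "(\<And>b. b * a = 0) \<Longrightarrow> a = (0::'a)"
  using assms unfolding nondegenerate_algebra_def by blast+

lemma multiplier_of_simps [simp]:
  "multiplier_of a \<rhd> b = a * b" "b \<lhd> multiplier_of a = b * a"
  by (transfer; simp)+

definition tenB :: "'a::complex_algebra bialgebroid \<Rightarrow> 'a \<Rightarrow> 'a \<Rightarrow> 'a tensor2"
  where "tenB \<A> = tens_val (NB \<A>)"

definition tenC :: "'a::complex_algebra bialgebroid \<Rightarrow> 'a \<Rightarrow> 'a \<Rightarrow> 'a tensor2"
  where "tenC \<A> = tens_val (NC \<A>)"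

definition dC1 :: "'a::complex_algebra bialgebroid \<Rightarrow> 'a \<Rightarrow> 'a \<Rightarrow> 'a tensor2"
  where "dC1 \<A> b a = rep (\<Delta>C1 \<A> b a)"

definition dC2 :: "'a::complex_algebra bialgebroid \<Rightarrow> 'a \<Rightarrow> 'a \<Rightarrow> 'a tensor2"
  where "dC2 \<A> b c = rep (\<Delta>C2 \<A> b c)"

definition dB1 :: "'a::complex_algebra bialgebroid \<Rightarrow> 'a \<Rightarrow> 'a \<Rightarrow> 'a tensor2"
  where "dB1 \<A> a b = rep (\<Delta>B1 \<A> a b)"

definition dB2 :: "'a::complex_algebra bialgebroid \<Rightarrow> 'a \<Rightarrow> 'a \<Rightarrow> 'a tensor2"
  where "dB2 \<A> c b = rep (\<Delta>B2 \<A> c b)"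

lemma csubspace_NB: "csubspace (NB \<A>)" and csubspace_NC: "csubspace (NC \<A>)"
  by (simp_all add: NB_def NC_def csubspace_relations2)

lemma tensor_product_tenB: "tensor_product (balB \<A>) (tenB \<A>)"
  and tensor_product_tenC: "tensor_product (balC \<A>) (tenC \<A>)"
  by (simp_all add: tenB_def tenC_def NB_def NC_def tensor_product_tens_val)

lemma eval2_tenB: "eval2 (tenB \<A>) u = proj (NB \<A>) u"
  and eval2_tenC: "eval2 (tenC \<A>) u = proj (NC \<A>) u"
  by (simp_all add: tenB_def tenC_def eval2_tens_val csubspace_NB csubspace_NC)

lemma proj_gen: "proj (NB \<A>) (gen (a, b)) = tenB \<A> a b" "proj (NC \<A>) (gen (a, b)) = tenC \<A> a b"
  by (simp_all add: tenB_def tenC_def tens_val_def)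

lemma val_qclass_NB: "val (NB \<A>) (qclass (NB \<A>) u) = eval2 (tenB \<A>) u"
  and val_qclass_NC: "val (NC \<A>) (qclass (NC \<A>) u) = eval2 (tenC \<A>) u"
  by (simp_all add: eval2_tenB eval2_tenC val_qclass csubspace_NB csubspace_NC)

lemmas balanced_tenB = tensor_product_tenB[unfolded tensor_product_def, THEN conjunct1]
lemmas balanced_tenC = tensor_product_tenC[unfolded tensor_product_def, THEN conjunct1]

lemma balanced_balB_I:
  assumes "\<And>a. clinear (f a)" "\<And>b. clinear (\<lambda>a. f a b)"
    and "\<And>x a b. x \<in> baseB \<A> \<Longrightarrow> f (a \<lhd> x) b = f a (b \<lhd> tB \<A> x)"
  shows "balanced (balB \<A>) f"
  by (rule balancedI) (use assms in \<open>auto simp: balB_def\<close>)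

lemma balanced_balC_I:
  assumes "\<And>a. clinear (f a)" "\<And>b. clinear (\<lambda>a. f a b)"
    and "\<And>y a b. y \<in> baseC \<A> \<Longrightarrow> f (tC \<A> y \<rhd> a) b = f a (y \<rhd> b)"
  shows "balanced (balC \<A>) f"
  by (rule balancedI) (use assms in \<open>auto simp: balC_def\<close>)

lemma balanced_balB_D: "balanced (balB \<A>) f \<Longrightarrow> x \<in> baseB \<A> \<Longrightarrow> f (a \<lhd> x) b = f a (b \<lhd> tB \<A> x)"
  by (rule balancedD(3)[of "balB \<A>" f "\<lambda>a. a \<lhd> x" "\<lambda>b. b \<lhd> tB \<A> x"]) (auto simp: balB_def)

lemma balanced_balC_D: "balanced (balC \<A>) f \<Longrightarrow> y \<in> baseC \<A> \<Longrightarrow> f (tC \<A> y \<rhd> a) b = f a (y \<rhd> b)"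
  by (rule balancedD(3)[of "balC \<A>" f "\<lambda>a. tC \<A> y \<rhd> a" "\<lambda>b. y \<rhd> b"]) (auto simp: balC_def)

lemma clinear_times_left: "clinear (\<lambda>x::'a::complex_algebra. a * x)"
  and clinear_times_right: "clinear (\<lambda>x::'a::complex_algebra. x * a)"
  by (auto intro!: clinearI simp: algebra_simps mult_scaleC_left mult_scaleC_right)

lemma lin_rules_algebra [lin]:
  fixes f :: "'x::complex_vector \<Rightarrow> 'a::complex_algebra"
  assumes "clinear f"
  shows "clinear (\<lambda>x. f x * a)" "clinear (\<lambda>x. a * f x)" "clinear (\<lambda>x. T \<rhd> f x)" "clinear (\<lambda>x. f x \<lhd> T)"
    "clinear (\<lambda>x. tenB \<A> (f x) a)" "clinear (\<lambda>x. tenB \<A> a (f x))"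
    "clinear (\<lambda>x. tenC \<A> (f x) a)" "clinear (\<lambda>x. tenC \<A> a (f x))"
  using clinear_compose[OF clinear_times_right assms] clinear_compose[OF clinear_times_left assms]
    clinear_compose[OF clinear_mult_left assms] clinear_compose[OF clinear_mult_right assms]
    clinear_compose[OF balancedD(2)[OF balanced_tenB] assms]
    clinear_compose[OF balancedD(1)[OF balanced_tenB] assms]
    clinear_compose[OF balancedD(2)[OF balanced_tenC] assms]
    clinear_compose[OF balancedD(1)[OF balanced_tenC] assms]
  by blast+

lemma lin_rules_multiplier [lin]:
  fixes f :: "'x::complex_vector \<Rightarrow> 'a::complex_algebra multiplier"
  assumes "clinear f"
  shows "clinear (\<lambda>x. f x \<rhd> a)" "clinear (\<lambda>x. a \<lhd> f x)"
  by (rule clinearI; simp add: clinear_rules[OF assms])+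

lemma qclass_NC_eq_iff: "qclass (NC \<A>) u = qclass (NC \<A>) v \<longleftrightarrow> eval2 (tenC \<A>) u = eval2 (tenC \<A>) v"
  and qclass_NB_eq_iff: "qclass (NB \<A>) u = qclass (NB \<A>) v \<longleftrightarrow> eval2 (tenB \<A>) u = eval2 (tenB \<A>) v"
  by (simp_all add: qclass_eq_iff csubspace_NC csubspace_NB eval2_tenC eval2_tenB proj_eq_iff)

lemma in_NC_iff: "u \<in> NC \<A> \<longleftrightarrow> eval2 (tenC \<A>) u = 0" and in_NB_iff: "u \<in> NB \<A> \<longleftrightarrow> eval2 (tenB \<A>) u = 0"
  by (simp_all add: eval2_tenC eval2_tenB proj csubspace_NC csubspace_NB)

context
  fixes \<A> :: "'a::complex_algebra bialgebroid"
  assumes \<A>: "multiplier_bialgebroid \<A>"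
begin

lemma bialgebroid_parts: "nondegenerate_algebra TYPE('a)" "idempotent_algebra TYPE('a)" "bialgebroid_base \<A>"
  "bialgebroid_nondegenerate \<A>" "comultiplication_homs \<A>" "comultiplication_bimodule \<A>"
  "coassociative \<A>"
  using \<A> by (simp_all only: multiplier_bialgebroid_def)

lemma nondegenerate_left: "(\<And>b. a * b = 0) \<Longrightarrow> a = (0::'a)"
  and nondegenerate_right: "(\<And>b. b * a = 0) \<Longrightarrow> a = (0::'a)"
  using nondegenerate_algebraD[OF bialgebroid_parts(1)] by blast+

lemma eq_from_left: "(\<And>b. a * b = a' * b) \<Longrightarrow> a = (a'::'a)"
  using nondegenerate_left[of "a - a'"] by (simp add: algebra_simps)

lemma eq_from_right: "(\<And>b. b * a = b * a') \<Longrightarrow> a = (a'::'a)"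
  using nondegenerate_right[of "a - a'"] by (simp add: algebra_simps)

lemma left_right_commute: "(T \<rhd> a) \<lhd> T' = T \<rhd> ((a::'a) \<lhd> T')"
  by (rule eq_from_left) (simp add: mult_right_left mult_left_mult[symmetric])

lemma multiplier_eq_left: "(\<And>a. T \<rhd> a = T' \<rhd> a) \<Longrightarrow> T = (T' :: 'a multiplier)"
  by (rule multiplier_eqI, blast, rule eq_from_left) (simp only: mult_right_left)

lemma base_algebras:
  "subalgebra (baseB \<A>)" "subalgebra (baseC \<A>)"
  "anti_isomorphism (baseB \<A>) (baseC \<A>) (tB \<A>)" "anti_isomorphism (baseC \<A>) (baseB \<A>) (tC \<A>)"
  using bialgebroid_parts(3) unfolding bialgebroid_base_def by blast+

lemma base_commute: "x \<in> baseB \<A> \<Longrightarrow> y \<in> baseC \<A> \<Longrightarrow> x * y = y * x"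
  using bialgebroid_parts(3) unfolding bialgebroid_base_def by blast+

lemma base_mult: "x \<in> baseB \<A> \<Longrightarrow> x' \<in> baseB \<A> \<Longrightarrow> x * x' \<in> baseB \<A>"
  "y \<in> baseC \<A> \<Longrightarrow> y' \<in> baseC \<A> \<Longrightarrow> y * y' \<in> baseC \<A>"
  using base_algebras(1,2) by (auto simp: subalgebra_def)

lemma tB_in: "x \<in> baseB \<A> \<Longrightarrow> tB \<A> x \<in> baseC \<A>" and tC_in: "y \<in> baseC \<A> \<Longrightarrow> tC \<A> y \<in> baseB \<A>"
  using base_algebras(3,4) by (auto simp: anti_isomorphism_def bij_betw_def)

lemma base_span:
  assumes "K \<in> {baseB \<A>, baseC \<A>}"
  shows "cspan {x \<rhd> a |x a. x \<in> K} = UNIV" "cspan {a \<lhd> x |a x. x \<in> K} = UNIV"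
  using bialgebroid_parts(3) assms unfolding bialgebroid_base_def by blast+

text \<open>
  Used for the bimodule property of the comultiplications, which moves factors out of all four sides at
  once.  On elements \<open>x y a x' y'\<close>, a further factor from \<open>B\<close> or \<open>C\<close> on one side can be absorbed into
  the factor that is already there, which yields the property for each side separately.
\<close>

lemma base_eqI:
  fixes F G :: "'a \<Rightarrow> 'v::complex_vector"
  assumes lin: "clinear F" "clinear G"
    and eq: "\<And>x y a x' y'. x \<in> baseB \<A> \<Longrightarrow> y \<in> baseC \<A> \<Longrightarrow> x' \<in> baseB \<A> \<Longrightarrow> y' \<in> baseC \<A> \<Longrightarrow>
      F ((x \<rhd> y \<rhd> a) \<lhd> x' \<lhd> y') = G ((x \<rhd> y \<rhd> a) \<lhd> x' \<lhd> y')"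
  shows "F d = G d"
proof -
  have left: "F (h d) = G (h d)"
    if "clinear h" "K \<in> {baseB \<A>, baseC \<A>}" "\<And>x a. x \<in> K \<Longrightarrow> F (h (x \<rhd> a)) = G (h (x \<rhd> a))" for h K d
    by (rule clinear_eq_on_span[OF clinear_compose[OF lin(1) that(1)] clinear_compose[OF lin(2) that(1)]
          base_span(1)[OF that(2)]]) (use that(3) in blast)
  have right: "F (h d) = G (h d)"
    if "clinear h" "K \<in> {baseB \<A>, baseC \<A>}" "\<And>x a. x \<in> K \<Longrightarrow> F (h (a \<lhd> x)) = G (h (a \<lhd> x))" for h K d
    by (rule clinear_eq_on_span[OF clinear_compose[OF lin(1) that(1)] clinear_compose[OF lin(2) that(1)]
          base_span(2)[OF that(2)]]) (use that(3) in blast)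
  show ?thesis
  proof (rule right[of "\<lambda>d. d" "baseC \<A>"])
    fix y' d assume y': "y' \<in> baseC \<A>"
    show "F (d \<lhd> y') = G (d \<lhd> y')"
    proof (rule right[of "\<lambda>d. d \<lhd> y'" "baseB \<A>"])
      fix x' d assume x': "x' \<in> baseB \<A>"
      show "F (d \<lhd> x' \<lhd> y') = G (d \<lhd> x' \<lhd> y')"
      proof (rule left[of "\<lambda>d. d \<lhd> x' \<lhd> y'" "baseB \<A>"])
        fix x d assume x: "x \<in> baseB \<A>"
        show "F ((x \<rhd> d) \<lhd> x' \<lhd> y') = G ((x \<rhd> d) \<lhd> x' \<lhd> y')"
          by (rule left[of "\<lambda>d. (x \<rhd> d) \<lhd> x' \<lhd> y'" "baseC \<A>"]) (intro clinear_compose[OF clinear_mult_right] clinear_compose[OF clinear_mult_left] clinear_ident, simp, use eq x x' y' in blast)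
      qed (intro clinear_compose[OF clinear_mult_right] clinear_ident, simp)
    qed (intro clinear_compose[OF clinear_mult_right] clinear_ident, simp)
  qed (intro clinear_compose[OF clinear_mult_right] clinear_ident, simp)
qed

lemma in_takeuchi: "\<Delta>C \<A> a \<in> takeuchiC \<A>" "\<Delta>B \<A> a \<in> takeuchiB \<A>"
  using bialgebroid_parts(5) unfolding comultiplication_homs_def by blast+

lemma \<Delta>_qEnd: "\<Delta>C \<A> a \<in> qEnd (NC \<A>)" "\<Delta>B \<A> a \<in> qEnd (NB \<A>)"
  using in_takeuchi unfolding takeuchiC_def takeuchiB_def by blast+

lemma clinear_\<Delta>C: "X \<in> qspace (NC \<A>) \<Longrightarrow> clinear (\<lambda>a. val (NC \<A>) (\<Delta>C \<A> a X))"
  using bialgebroid_parts(5) by (intro clinearI)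
    (auto simp: comultiplication_homs_def val_qadd val_qscale csubspace_NC
      qEnd_in_qspace[OF \<Delta>_qEnd(1)])

lemma clinear_\<Delta>B: "X \<in> qspace (NB \<A>) \<Longrightarrow> clinear (\<lambda>a. val (NB \<A>) (\<Delta>B \<A> a X))"
  using bialgebroid_parts(5) by (intro clinearI)
    (auto simp: comultiplication_homs_def val_qadd val_qscale csubspace_NB
      qEnd_in_qspace[OF \<Delta>_qEnd(2)])

lemma \<Delta>C_tens:
  "balanced (balC \<A>) (\<lambda>p q. val (NC \<A>) (\<Delta>C \<A> a (tens (NC \<A>) p q)))"
  "val (NC \<A>) (\<Delta>C \<A> a (qclass (NC \<A>) u)) = eval2 (\<lambda>p q. val (NC \<A>) (\<Delta>C \<A> a (tens (NC \<A>) p q))) u"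
  using qEnd_eval2[of "\<Delta>C \<A> a" "balC \<A>"] \<Delta>_qEnd(1) by (auto simp: NC_def)

lemma \<Delta>B_tens:
  "balanced (balB \<A>) (\<lambda>p q. val (NB \<A>) (\<Delta>B \<A> a (tens (NB \<A>) p q)))"
  "val (NB \<A>) (\<Delta>B \<A> a (qclass (NB \<A>) u)) = eval2 (\<lambda>p q. val (NB \<A>) (\<Delta>B \<A> a (tens (NB \<A>) p q))) u"
  using qEnd_eval2[of "\<Delta>B \<A> a" "balB \<A>"] \<Delta>_qEnd(2) by (auto simp: NB_def)

lemma ract_NC:
  "ract (NC \<A>) (qclass (NC \<A>) u) T T' = qclass (NC \<A>) (eval2 (\<lambda>p q. gen (p \<lhd> T, q \<lhd> T')) u)"
proof -
  have "balanced (balC \<A>) (\<lambda>p q. proj (NC \<A>) (gen (p \<lhd> T, q \<lhd> T')))"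
    unfolding proj_gen
    by (intro balanced_balC_I lin) (simp add: left_right_commute balanced_balC_D[OF balanced_tenC])
  from qlift_balanced[OF this csubspace_NC] show ?thesis
    by (simp add: ract_def tens_def NC_def)
qed

lemma lact_NB:
  "lact (NB \<A>) T T' (qclass (NB \<A>) u) = qclass (NB \<A>) (eval2 (\<lambda>p q. gen (T \<rhd> p, T' \<rhd> q)) u)"
proof -
  have "balanced (balB \<A>) (\<lambda>p q. proj (NB \<A>) (gen (T \<rhd> p, T' \<rhd> q)))"
    unfolding proj_gen
    by (intro balanced_balB_I lin) (simp add: left_right_commute[symmetric] balanced_balB_D[OF balanced_tenB])
  from qlift_balanced[OF this csubspace_NB] show ?thesis
    by (simp add: lact_def tens_def NB_def)
qed

lemma cancel_C1: "(\<And>a. eval2 (\<lambda>p q. tenC \<A> (p * a) q) u = 0) \<Longrightarrow> eval2 (tenC \<A>) u = 0"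
  and cancel_C2: "(\<And>a. eval2 (\<lambda>p q. tenC \<A> p (q * a)) u = 0) \<Longrightarrow> eval2 (tenC \<A>) u = 0"
  and cancel_B1: "(\<And>a. eval2 (\<lambda>p q. tenB \<A> (a * p) q) u = 0) \<Longrightarrow> eval2 (tenB \<A>) u = 0"
  and cancel_B2: "(\<And>a. eval2 (\<lambda>p q. tenB \<A> p (a * q)) u = 0) \<Longrightarrow> eval2 (tenB \<A>) u = 0"
proof -
  have nd: "bialgebroid_nondegenerate \<A>" by (rule bialgebroid_parts)
  have zC: "qclass (NC \<A>) v = qclass (NC \<A>) 0 \<longleftrightarrow> eval2 (tenC \<A>) v = 0"
    and zB: "qclass (NB \<A>) v = qclass (NB \<A>) 0 \<longleftrightarrow> eval2 (tenB \<A>) v = 0" for v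
    by (simp_all add: qclass_NC_eq_iff qclass_NB_eq_iff eval2_rules)
  show "eval2 (tenC \<A>) u = 0" if *: "\<And>a. eval2 (\<lambda>p q. tenC \<A> (p * a) q) u = 0"
  proof -
    have "\<forall>a. ract (NC \<A>) (qclass (NC \<A>) u) (multiplier_of a) 1 = qclass (NC \<A>) 0"
      by (simp add: ract_NC zC eval2_eval2 *)
    then show ?thesis
      using nd unfolding bialgebroid_nondegenerate_def zC[symmetric] by (metis qclass_in_qspace)
  qed
  show "eval2 (tenC \<A>) u = 0" if *: "\<And>a. eval2 (\<lambda>p q. tenC \<A> p (q * a)) u = 0"
  proof -
    have "\<forall>a. ract (NC \<A>) (qclass (NC \<A>) u) 1 (multiplier_of a) = qclass (NC \<A>) 0"
      by (simp add: ract_NC zC eval2_eval2 *)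
    then show ?thesis
      using nd unfolding bialgebroid_nondegenerate_def zC[symmetric] by (metis qclass_in_qspace)
  qed
  show "eval2 (tenB \<A>) u = 0" if *: "\<And>a. eval2 (\<lambda>p q. tenB \<A> (a * p) q) u = 0"
  proof -
    have "\<forall>a. lact (NB \<A>) (multiplier_of a) 1 (qclass (NB \<A>) u) = qclass (NB \<A>) 0"
      by (simp add: lact_NB zB eval2_eval2 *)
    then show ?thesis
      using nd unfolding bialgebroid_nondegenerate_def zB[symmetric] by (metis qclass_in_qspace)
  qed
  show "eval2 (tenB \<A>) u = 0" if *: "\<And>a. eval2 (\<lambda>p q. tenB \<A> p (a * q)) u = 0"
  proof -
    have "\<forall>a. lact (NB \<A>) 1 (multiplier_of a) (qclass (NB \<A>) u) = qclass (NB \<A>) 0"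
      by (simp add: lact_NB zB eval2_eval2 *)
    then show ?thesis
      using nd unfolding bialgebroid_nondegenerate_def zB[symmetric] by (metis qclass_in_qspace)
  qed
qed

end

context
  fixes \<A> :: "'a::complex_algebra bialgebroid"
  assumes \<A>: "multiplier_bialgebroid \<A>"
begin

text \<open>
  The elements \<open>\<Delta>\<^sub>C(b)(a \<otimes> 1)\<close> and their analogues exist by the definition of the algebras \<open>takeuchiC\<close>
  and \<open>takeuchiB\<close> and are unique by non-degeneracy of the tensor products.
\<close>

lemma \<Delta>C1_rep:
  "\<Delta>C1 \<A> b a = qclass (NC \<A>) (dC1 \<A> b a)"
  "val (NC \<A>) (\<Delta>C \<A> b (tens (NC \<A>) a c)) = eval2 (\<lambda>p q. tenC \<A> p (q * c)) (dC1 \<A> b a)"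
proof -
  have "\<exists>X\<in>qspace (NC \<A>). \<forall>c. \<Delta>C \<A> b (tens (NC \<A>) a c) = ract (NC \<A>) X 1 (multiplier_of c)"
    using in_takeuchi[OF \<A>, of b] unfolding takeuchiC_def mem_Collect_eq by blast
  note * = the_coset[OF csubspace_NC this ract_NC[OF \<A>] clinear_eval2 _ \<Delta>C1_def]
  have cancel: "u \<in> NC \<A>" if "\<And>c. eval2 (\<lambda>p q. gen (p, q * c)) u \<in> NC \<A>" for u
    unfolding in_NC_iff by (rule cancel_C2[OF \<A>]) (use that in \<open>simp add: in_NC_iff eval2_eval2\<close>)
  show "\<Delta>C1 \<A> b a = qclass (NC \<A>) (dC1 \<A> b a)"
    unfolding dC1_def by (rule *(1)) (simp add: cancel)
  have "\<Delta>C \<A> b (tens (NC \<A>) a c) = qclass (NC \<A>) (eval2 (\<lambda>p q. gen (p \<lhd> 1, q \<lhd> multiplier_of c)) (dC1 \<A> b a))"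
    unfolding dC1_def by (rule *(2)[THEN trans]) (simp_all add: cancel)
  then show "val (NC \<A>) (\<Delta>C \<A> b (tens (NC \<A>) a c)) = eval2 (\<lambda>p q. tenC \<A> p (q * c)) (dC1 \<A> b a)"
    by (simp add: val_qclass_NC eval2_eval2)
qed

lemma \<Delta>C2_rep:
  "\<Delta>C2 \<A> b c = qclass (NC \<A>) (dC2 \<A> b c)"
  "val (NC \<A>) (\<Delta>C \<A> b (tens (NC \<A>) a c)) = eval2 (\<lambda>p q. tenC \<A> (p * a) q) (dC2 \<A> b c)"
proof -
  have "\<exists>X\<in>qspace (NC \<A>). \<forall>a. \<Delta>C \<A> b (tens (NC \<A>) a c) = ract (NC \<A>) X (multiplier_of a) 1"
    using in_takeuchi[OF \<A>, of b] unfolding takeuchiC_def mem_Collect_eq by blast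
  note * = the_coset[OF csubspace_NC this ract_NC[OF \<A>] clinear_eval2 _ \<Delta>C2_def]
  have cancel: "u \<in> NC \<A>" if "\<And>a. eval2 (\<lambda>p q. gen (p * a, q)) u \<in> NC \<A>" for u
    unfolding in_NC_iff by (rule cancel_C1[OF \<A>]) (use that in \<open>simp add: in_NC_iff eval2_eval2\<close>)
  show "\<Delta>C2 \<A> b c = qclass (NC \<A>) (dC2 \<A> b c)"
    unfolding dC2_def by (rule *(1)) (simp add: cancel)
  have "\<Delta>C \<A> b (tens (NC \<A>) a c) = qclass (NC \<A>) (eval2 (\<lambda>p q. gen (p \<lhd> multiplier_of a, q \<lhd> 1)) (dC2 \<A> b c))"
    unfolding dC2_def by (rule *(2)[THEN trans]) (simp_all add: cancel)
  then show "val (NC \<A>) (\<Delta>C \<A> b (tens (NC \<A>) a c)) = eval2 (\<lambda>p q. tenC \<A> (p * a) q) (dC2 \<A> b c)"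
    by (simp add: val_qclass_NC eval2_eval2)
qed

lemma \<Delta>B1_rep:
  "\<Delta>B1 \<A> a b = qclass (NB \<A>) (dB1 \<A> a b)"
  "val (NB \<A>) (\<Delta>B \<A> b (tens (NB \<A>) a c)) = eval2 (\<lambda>p q. tenB \<A> p (c * q)) (dB1 \<A> a b)"
proof -
  have "\<exists>X\<in>qspace (NB \<A>). \<forall>c. \<Delta>B \<A> b (tens (NB \<A>) a c) = lact (NB \<A>) 1 (multiplier_of c) X"
    using in_takeuchi[OF \<A>, of b] unfolding takeuchiB_def mem_Collect_eq by blast
  note * = the_coset[OF csubspace_NB this lact_NB[OF \<A>] clinear_eval2 _ \<Delta>B1_def]
  have cancel: "u \<in> NB \<A>" if "\<And>c. eval2 (\<lambda>p q. gen (p, c * q)) u \<in> NB \<A>" for u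
    unfolding in_NB_iff by (rule cancel_B2[OF \<A>]) (use that in \<open>simp add: in_NB_iff eval2_eval2\<close>)
  show "\<Delta>B1 \<A> a b = qclass (NB \<A>) (dB1 \<A> a b)"
    unfolding dB1_def by (rule *(1)) (simp add: cancel)
  have "\<Delta>B \<A> b (tens (NB \<A>) a c) = qclass (NB \<A>) (eval2 (\<lambda>p q. gen (1 \<rhd> p, multiplier_of c \<rhd> q)) (dB1 \<A> a b))"
    unfolding dB1_def by (rule *(2)[THEN trans]) (simp_all add: cancel)
  then show "val (NB \<A>) (\<Delta>B \<A> b (tens (NB \<A>) a c)) = eval2 (\<lambda>p q. tenB \<A> p (c * q)) (dB1 \<A> a b)"
    by (simp add: val_qclass_NB eval2_eval2)
qed

lemma \<Delta>B2_rep: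
  "\<Delta>B2 \<A> c b = qclass (NB \<A>) (dB2 \<A> c b)"
  "val (NB \<A>) (\<Delta>B \<A> b (tens (NB \<A>) a c)) = eval2 (\<lambda>p q. tenB \<A> (a * p) q) (dB2 \<A> c b)"
proof -
  have "\<exists>X\<in>qspace (NB \<A>). \<forall>a. \<Delta>B \<A> b (tens (NB \<A>) a c) = lact (NB \<A>) (multiplier_of a) 1 X"
    using in_takeuchi[OF \<A>, of b] unfolding takeuchiB_def mem_Collect_eq by blast
  note * = the_coset[OF csubspace_NB this lact_NB[OF \<A>] clinear_eval2 _ \<Delta>B2_def]
  have cancel: "u \<in> NB \<A>" if "\<And>a. eval2 (\<lambda>p q. gen (a * p, q)) u \<in> NB \<A>" for u
    unfolding in_NB_iff by (rule cancel_B1[OF \<A>]) (use that in \<open>simp add: in_NB_iff eval2_eval2\<close>)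
  show "\<Delta>B2 \<A> c b = qclass (NB \<A>) (dB2 \<A> c b)"
    unfolding dB2_def by (rule *(1)) (simp add: cancel)
  have "\<Delta>B \<A> b (tens (NB \<A>) a c) = qclass (NB \<A>) (eval2 (\<lambda>p q. gen (multiplier_of a \<rhd> p, 1 \<rhd> q)) (dB2 \<A> c b))"
    unfolding dB2_def by (rule *(2)[THEN trans]) (simp_all add: cancel)
  then show "val (NB \<A>) (\<Delta>B \<A> b (tens (NB \<A>) a c)) = eval2 (\<lambda>p q. tenB \<A> (a * p) q) (dB2 \<A> c b)"
    by (simp add: val_qclass_NB eval2_eval2)
qed

text \<open>
  Stated for right multipliers \<open>T\<close> of \<open>C\<close>, since images of elements of a base algebra under a morphism
  are of this kind.
\<close>

lemma \<Delta>C_right_C: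
  assumes T: "\<And>y. y \<in> baseC \<A> \<Longrightarrow> y * T \<in> baseC \<A>"
  shows "val (NC \<A>) (\<Delta>C \<A> (d \<lhd> T) (tens (NC \<A>) b c)) =
    val (NC \<A>) (\<Delta>C \<A> d (tens (NC \<A>) (T \<rhd> b) c))" (is "?F d = ?G d")
proof (rule base_eqI[OF \<A>, of ?F ?G])
  show "clinear ?F" "clinear ?G"
    by (rule clinear_compose[OF clinear_\<Delta>C[OF \<A> tens_in_qspace] clinear_mult_right] clinear_\<Delta>C[OF \<A> tens_in_qspace])+
  fix x y a x' y'
  assume xy: "x \<in> baseB \<A>" "y \<in> baseC \<A>" "x' \<in> baseB \<A>" "y' \<in> baseC \<A>"
  have bimod: "\<Delta>C \<A> ((x \<rhd> y \<rhd> a) \<lhd> x' \<lhd> z) (tens (NC \<A>) b c) =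
      lact (NC \<A>) y x (\<Delta>C \<A> a (tens (NC \<A>) (z \<rhd> b) (x' \<rhd> c)))" if "z \<in> baseC \<A>" for b c z
    using bialgebroid_parts(6)[OF \<A>] xy that unfolding comultiplication_bimodule_def by blast
  show "?F ((x \<rhd> y \<rhd> a) \<lhd> x' \<lhd> y') = ?G ((x \<rhd> y \<rhd> a) \<lhd> x' \<lhd> y')"
    using bimod[OF T[OF xy(4)], of b c] bimod[OF xy(4), of "T \<rhd> b" c] by simp
qed

lemma \<Delta>C_right_B:
  assumes T: "T \<in> baseB \<A>"
  shows "val (NC \<A>) (\<Delta>C \<A> (d \<lhd> T) (tens (NC \<A>) b c)) =
    val (NC \<A>) (\<Delta>C \<A> d (tens (NC \<A>) b (T \<rhd> c)))" (is "?F d = ?G d")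
proof (rule base_eqI[OF \<A>, of ?F ?G])
  show "clinear ?F" "clinear ?G"
    by (rule clinear_compose[OF clinear_\<Delta>C[OF \<A> tens_in_qspace] clinear_mult_right] clinear_\<Delta>C[OF \<A> tens_in_qspace])+
  fix x y a x' y'
  assume xy: "x \<in> baseB \<A>" "y \<in> baseC \<A>" "x' \<in> baseB \<A>" "y' \<in> baseC \<A>"
  have bimod: "\<Delta>C \<A> ((x \<rhd> y \<rhd> a) \<lhd> z \<lhd> y') (tens (NC \<A>) b c) =
      lact (NC \<A>) y x (\<Delta>C \<A> a (tens (NC \<A>) (y' \<rhd> b) (z \<rhd> c)))" if "z \<in> baseB \<A>" for b c z
    using bialgebroid_parts(6)[OF \<A>] xy that unfolding comultiplication_bimodule_def by blast
  have "e \<lhd> y' \<lhd> T = e \<lhd> T \<lhd> y'" for e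
    using base_commute[OF \<A> T xy(4)] by (metis mult_right_simps(6))
  then show "?F ((x \<rhd> y \<rhd> a) \<lhd> x' \<lhd> y') = ?G ((x \<rhd> y \<rhd> a) \<lhd> x' \<lhd> y')"
    using bimod[OF base_mult(1)[OF \<A> xy(3) T], of b c] bimod[OF xy(3), of b "T \<rhd> c"] by simp
qed

lemma \<Delta>B_left_B:
  assumes T: "T \<in> baseB \<A>"
  shows "val (NB \<A>) (\<Delta>B \<A> (T \<rhd> d) (tens (NB \<A>) b c)) =
    val (NB \<A>) (\<Delta>B \<A> d (tens (NB \<A>) b (c \<lhd> T)))" (is "?F d = ?G d")
proof (rule base_eqI[OF \<A>, of ?F ?G])
  show "clinear ?F" "clinear ?G"
    by (rule clinear_compose[OF clinear_\<Delta>B[OF \<A> tens_in_qspace] clinear_mult_left] clinear_\<Delta>B[OF \<A> tens_in_qspace])+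
  fix x y a x' y'
  assume xy: "x \<in> baseB \<A>" "y \<in> baseC \<A>" "x' \<in> baseB \<A>" "y' \<in> baseC \<A>"
  have bimod: "\<Delta>B \<A> ((z \<rhd> y \<rhd> a) \<lhd> x' \<lhd> y') (tens (NB \<A>) b c) =
      ract (NB \<A>) (\<Delta>B \<A> a (tens (NB \<A>) (b \<lhd> y) (c \<lhd> z))) y' x'" if "z \<in> baseB \<A>" for b c z
    using bialgebroid_parts(6)[OF \<A>] xy that unfolding comultiplication_bimodule_def by blast
  show "?F ((x \<rhd> y \<rhd> a) \<lhd> x' \<lhd> y') = ?G ((x \<rhd> y \<rhd> a) \<lhd> x' \<lhd> y')"
    using bimod[OF base_mult(1)[OF \<A> T xy(1)], of b c] bimod[OF xy(1), of b "c \<lhd> T"]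
    by (simp add: left_right_commute[OF \<A>, symmetric])
qed

lemma \<Delta>B_left_C:
  assumes T: "T \<in> baseC \<A>"
  shows "val (NB \<A>) (\<Delta>B \<A> (T \<rhd> d) (tens (NB \<A>) b c)) =
    val (NB \<A>) (\<Delta>B \<A> d (tens (NB \<A>) (b \<lhd> T) c))" (is "?F d = ?G d")
proof (rule base_eqI[OF \<A>, of ?F ?G])
  show "clinear ?F" "clinear ?G"
    by (rule clinear_compose[OF clinear_\<Delta>B[OF \<A> tens_in_qspace] clinear_mult_left] clinear_\<Delta>B[OF \<A> tens_in_qspace])+
  fix x y a x' y'
  assume xy: "x \<in> baseB \<A>" "y \<in> baseC \<A>" "x' \<in> baseB \<A>" "y' \<in> baseC \<A>"
  have bimod: "\<Delta>B \<A> ((x \<rhd> z \<rhd> a) \<lhd> x' \<lhd> y') (tens (NB \<A>) b c) =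
      ract (NB \<A>) (\<Delta>B \<A> a (tens (NB \<A>) (b \<lhd> z) (c \<lhd> x))) y' x'" if "z \<in> baseC \<A>" for b c z
    using bialgebroid_parts(6)[OF \<A>] xy that unfolding comultiplication_bimodule_def by blast
  have "x \<rhd> T \<rhd> e = T \<rhd> x \<rhd> e" for e
    using base_commute[OF \<A> xy(1) T] by (metis mult_left_simps(6))
  then show "?F ((x \<rhd> y \<rhd> a) \<lhd> x' \<lhd> y') = ?G ((x \<rhd> y \<rhd> a) \<lhd> x' \<lhd> y')"
    using bimod[OF base_mult(2)[OF \<A> T xy(2)], of b c] bimod[OF xy(2), of "b \<lhd> T" c]
    by (simp add: left_right_commute[OF \<A>, symmetric])
qed

lemma balanced_tenB_right:
  assumes "\<And>x. x \<in> baseB \<A> \<Longrightarrow> x * T = T * x" "\<And>y. y \<in> baseC \<A> \<Longrightarrow> y * T' = T' * y"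
  shows "balanced (balB \<A>) (\<lambda>p q. tenB \<A> (p \<lhd> T) (q \<lhd> T'))"
proof (intro balanced_balB_I lin)
  fix x a b assume x: "x \<in> baseB \<A>"
  have "a \<lhd> x \<lhd> T = a \<lhd> T \<lhd> x" "b \<lhd> tB \<A> x \<lhd> T' = b \<lhd> T' \<lhd> tB \<A> x"
    using assms(1)[OF x] assms(2)[OF tB_in[OF \<A> x]] by (metis mult_right_simps(6))+
  then show "tenB \<A> (a \<lhd> x \<lhd> T) (b \<lhd> T') = tenB \<A> (a \<lhd> T) (b \<lhd> tB \<A> x \<lhd> T')"
    by (simp add: balanced_balB_D[OF balanced_tenB x])
qed

lemma balanced_tenB_left:
  assumes "\<And>x. x \<in> baseB \<A> \<Longrightarrow> x * T = T * x"
  shows "balanced (balB \<A>) (\<lambda>p q. tenB \<A> (p \<lhd> T) q)"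
proof -
  have "y * 1 = 1 * y" for y :: "'a multiplier"
    by (rule multiplier_eqI) simp_all
  with balanced_tenB_right[of T 1] assms show ?thesis by simp
qed

lemma \<Delta>B_right_C:
  assumes T: "\<And>y. y \<in> baseC \<A> \<Longrightarrow> y * T \<in> baseC \<A>" "\<And>x. x \<in> baseB \<A> \<Longrightarrow> x * T = T * x"
  shows "val (NB \<A>) (\<Delta>B \<A> (d \<lhd> T) (tens (NB \<A>) b c)) =
    eval2 (\<lambda>p q. tenB \<A> (p \<lhd> T) q) (val (NB \<A>) (\<Delta>B \<A> d (tens (NB \<A>) b c)))"
  (is "?F d = ?G d")
proof -
  have balT: "balanced (balB \<A>) (\<lambda>p q. tenB \<A> (p \<lhd> T) q)"
    by (rule balanced_tenB_left[OF T(2)])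
  have ten: "eval2 (\<lambda>p q. tenB \<A> (p \<lhd> T) q) (tenB \<A> p q) = tenB \<A> (p \<lhd> T) q" for p q
    by (simp add: proj_gen(1)[symmetric] eval2_proj[OF balT, folded NB_def, simplified proj_gen[symmetric]])
  show ?thesis
  proof (rule base_eqI[OF \<A>, of ?F ?G])
    show "clinear ?F" "clinear ?G"
      by (rule clinear_compose[OF clinear_\<Delta>B[OF \<A> tens_in_qspace] clinear_mult_right]
          clinear_compose[OF clinear_eval2 clinear_\<Delta>B[OF \<A> tens_in_qspace]])+
    fix x y a x' y'
    assume xy: "x \<in> baseB \<A>" "y \<in> baseC \<A>" "x' \<in> baseB \<A>" "y' \<in> baseC \<A>"
    have bimod: "\<Delta>B \<A> ((x \<rhd> y \<rhd> a) \<lhd> x' \<lhd> z) (tens (NB \<A>) b c) =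
        ract (NB \<A>) (\<Delta>B \<A> a (tens (NB \<A>) (b \<lhd> y) (c \<lhd> x))) z x'" if "z \<in> baseC \<A>" for z
      using bialgebroid_parts(6)[OF \<A>] xy that unfolding comultiplication_bimodule_def by blast
    obtain u where u: "\<Delta>B \<A> a (tens (NB \<A>) (b \<lhd> y) (c \<lhd> x)) = qclass (NB \<A>) u"
      using qEnd_in_qspace[OF \<Delta>_qEnd(2)[OF \<A>]] by (metis qclass_rep csubspace_NB tens_in_qspace)
    have ract: "ract (NB \<A>) (qclass (NB \<A>) u) z x' = qclass (NB \<A>) (eval2 (\<lambda>p q. gen (p \<lhd> z, q \<lhd> x')) u)"
      if "z \<in> baseC \<A>" for z
    proof -
      have "balanced (balB \<A>) (\<lambda>p q. proj (NB \<A>) (gen (p \<lhd> z, q \<lhd> x')))"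
        unfolding proj_gen
        by (rule balanced_tenB_right) (use base_commute[OF \<A>] xy that in auto)
      from qlift_balanced[OF this csubspace_NB] show ?thesis
        by (simp add: ract_def tens_def NB_def)
    qed
    show "?F ((x \<rhd> y \<rhd> a) \<lhd> x' \<lhd> y') = ?G ((x \<rhd> y \<rhd> a) \<lhd> x' \<lhd> y')"
      using bimod[OF T(1)[OF xy(4)]] bimod[OF xy(4)]
      by (simp add: u ract T(1) xy val_qclass_NB eval2_eval2 eval2_tenB eval2_proj[OF balT, folded NB_def] val_qclass[OF csubspace_NB]
          clinear_apply_eval2[OF proj(1)[OF csubspace_NB]] proj_gen ten)
  qed
qed

lemma \<Delta>C_mult: "X \<in> qspace (NC \<A>) \<Longrightarrow> \<Delta>C \<A> (a * a') X = \<Delta>C \<A> a (\<Delta>C \<A> a' X)"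
  and \<Delta>B_mult: "X \<in> qspace (NB \<A>) \<Longrightarrow> \<Delta>B \<A> (a * a') X = \<Delta>B \<A> a' (\<Delta>B \<A> a X)"
  using bialgebroid_parts(5)[OF \<A>] unfolding comultiplication_homs_def by blast+

lemma coassoc_CB:
  fixes \<Phi> :: "'a \<Rightarrow> 'a \<Rightarrow> 'a \<Rightarrow> 'w::complex_vector"
  assumes "\<And>q. balanced (balC \<A>) (\<lambda>r s. \<Phi> r s q)" "\<And>p. balanced (balB \<A>) (\<Phi> p)"
    and "balanced (balC \<A>) (\<lambda>p q. eval2 (\<Phi> p) (dB2 \<A> c q)) \<or>
      balanced (balB \<A>) (\<lambda>p q. eval2 (\<lambda>r s. \<Phi> r s q) (dC1 \<A> p a))"
  shows "eval2 (\<lambda>p q. eval2 (\<lambda>r s. \<Phi> r s q) (dC1 \<A> p a)) (dB2 \<A> c b) =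
    eval2 (\<lambda>p q. eval2 (\<Phi> p) (dB2 \<A> c q)) (dC1 \<A> b a)"
proof (rule coassociativity_functional[OF assms(1,2) _ assms(3)])
  have "let M = relations3 (balC \<A>) (balB \<A>) in
      qlift M (\<lambda>(p, q). tens_right M (\<Delta>C1 \<A> p a) q) (\<Delta>B2 \<A> c b) =
      qlift M (\<lambda>(p, q). tens_left M p (\<Delta>B2 \<A> c q)) (\<Delta>C1 \<A> b a)"
    using bialgebroid_parts(7)[OF \<A>] unfolding coassociative_def by blast
  then show "qlift (relations3 (balC \<A>) (balB \<A>))
      (\<lambda>(p, q). tens_right (relations3 (balC \<A>) (balB \<A>)) (qclass (relations2 (balC \<A>)) (dC1 \<A> p a)) q)
        (qclass (relations2 (balB \<A>)) (dB2 \<A> c b)) =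
      qlift (relations3 (balC \<A>) (balB \<A>))
      (\<lambda>(p, q). tens_left (relations3 (balC \<A>) (balB \<A>)) p (qclass (relations2 (balB \<A>)) (dB2 \<A> c q)))
        (qclass (relations2 (balC \<A>)) (dC1 \<A> b a))"
    unfolding Let_def \<Delta>C1_rep(1) \<Delta>B2_rep(1) NC_def NB_def .
qed

lemma coassoc_BC:
  fixes \<Phi> :: "'a \<Rightarrow> 'a \<Rightarrow> 'a \<Rightarrow> 'w::complex_vector"
  assumes "\<And>q. balanced (balB \<A>) (\<lambda>r s. \<Phi> r s q)" "\<And>p. balanced (balC \<A>) (\<Phi> p)"
    and "balanced (balC \<A>) (\<lambda>p q. eval2 (\<lambda>r s. \<Phi> r s q) (dB1 \<A> a p)) \<or>
      balanced (balB \<A>) (\<lambda>p q. eval2 (\<Phi> p) (dC2 \<A> q c))"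
  shows "eval2 (\<lambda>p q. eval2 (\<lambda>r s. \<Phi> r s q) (dB1 \<A> a p)) (dC2 \<A> b c) =
    eval2 (\<lambda>p q. eval2 (\<Phi> p) (dC2 \<A> q c)) (dB1 \<A> a b)"
proof (rule coassociativity_functional[OF assms(1,2) _ assms(3)[THEN disj_commute[THEN iffD1]]])
  have "let M = relations3 (balB \<A>) (balC \<A>) in
      qlift M (\<lambda>(p, q). tens_right M (\<Delta>B1 \<A> a p) q) (\<Delta>C2 \<A> b c) =
      qlift M (\<lambda>(p, q). tens_left M p (\<Delta>C2 \<A> q c)) (\<Delta>B1 \<A> a b)"
    using bialgebroid_parts(7)[OF \<A>] unfolding coassociative_def by blast
  then show "qlift (relations3 (balB \<A>) (balC \<A>))
      (\<lambda>(p, q). tens_right (relations3 (balB \<A>) (balC \<A>)) (qclass (relations2 (balB \<A>)) (dB1 \<A> a p)) q)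
        (qclass (relations2 (balC \<A>)) (dC2 \<A> b c)) =
      qlift (relations3 (balB \<A>) (balC \<A>))
      (\<lambda>(p, q). tens_left (relations3 (balB \<A>) (balC \<A>)) p (qclass (relations2 (balC \<A>)) (dC2 \<A> q c)))
        (qclass (relations2 (balB \<A>)) (dB1 \<A> a b))"
    unfolding Let_def \<Delta>B1_rep(1) \<Delta>C2_rep(1) NC_def NB_def .
qed

end

section \<open>Extensions to multiplier algebras\<close>

lemma anti_isomorphism_UNIV:
  fixes S :: "'a::complex_algebra \<Rightarrow> 'a"
  assumes "anti_isomorphism UNIV UNIV S"
  shows "clinear S" "bij S" "S (a * b) = S b * S a"
  using assms by (auto simp: anti_isomorphism_def intro: clinearI)

text \<open>
  The extension of \<open>S\<close> to multipliers is given by \<open>b \<mapsto> S(S\<^sup>-\<^sup>1(b) T)\<close> on the left and by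
  \<open>b \<mapsto> S(T S\<^sup>-\<^sup>1(b))\<close> on the right.
\<close>

lemma extend_anti:
  fixes S :: "'a::complex_algebra \<Rightarrow> 'a"
  assumes S: "anti_isomorphism UNIV UNIV S" and nd: "nondegenerate_algebra TYPE('a)"
  shows "extend_anti S T \<rhd> S a = S (a \<lhd> T)" "S a \<lhd> extend_anti S T = S (T \<rhd> a)"
proof -
  note SS = anti_isomorphism_UNIV[OF S]
  have inv: "S (inv S a) = a" "inv S (S a) = a" for a
    using SS(2) by (simp_all add: bij_is_surj bij_is_inj surj_f_inv_f)
  have lin_inv: "clinear (inv S)"
    by (rule clinearI) (metis inv clinear_rules(1)[OF SS(1)], metis inv clinear_rules(2)[OF SS(1)])
  have inv_mult: "inv S (a * b) = inv S b * inv S a" for a b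
    by (metis inv SS(3))
  let ?P = "\<lambda>T'. \<forall>a. T' \<rhd> S a = S (a \<lhd> T) \<and> S a \<lhd> T' = S (T \<rhd> a)"
  have "\<exists>!T'. ?P T'"
  proof (rule ex_ex1I)
    define L where "L = (\<lambda>a. S (inv S a \<lhd> T))"
    define R where "R = (\<lambda>a. S (T \<rhd> inv S a))"
    have lin: "clinear L" "clinear R"
      unfolding L_def R_def
      by (intro clinear_compose[OF SS(1)] clinear_compose[OF clinear_mult_right] clinear_compose[OF clinear_mult_left] lin_inv)+
    have mem: "(L, R) \<in> {(L, R) |L R. clinear L \<and> clinear R \<and> (\<forall>a b. L (a * b) = L a * b) \<and>
        (\<forall>a b. R (a * b) = a * R b) \<and> (\<forall>a b. a * L b = R a * b)}"
      using lin
      by (simp add: L_def R_def inv_mult mult_right_mult mult_left_mult SS(3) inv)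
        (metis SS(3) inv(1) mult_right_left)
    have "L (S a) = S (a \<lhd> T)" "R (S a) = S (T \<rhd> a)" for a
      by (simp_all add: L_def R_def inv)
    then have "?P (Abs_multiplier (L, R))"
      by (simp add: mult_left.rep_eq mult_right.rep_eq Abs_multiplier_inverse[OF mem])
    then show "\<exists>T'. ?P T'" by blast
    show "T' = T''" if T': "?P T'" and T'': "?P T''" for T' T''
    proof (rule multiplier_eqI)
      show "T' \<rhd> a = T'' \<rhd> a" "a \<lhd> T' = a \<lhd> T''" for a
        using T' T'' inv(1)[of a] by metis+
    qed
  qed
  from theI'[OF this] show "extend_anti S T \<rhd> S a = S (a \<lhd> T)" "S a \<lhd> extend_anti S T = S (T \<rhd> a)"
    unfolding extend_anti_def by blast+
qed

context
  fixes \<pi> :: "'d::complex_algebra \<Rightarrow> 'a::complex_algebra multiplier"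
  assumes \<pi>: "nondegenerate_hom \<pi>" and nd: "nondegenerate_algebra TYPE('a)"
begin

lemma hom_rules: "clinear \<pi>" "\<pi> (d * d') = \<pi> d * \<pi> d'"
  "cspan {\<pi> d \<rhd> a |d a. True} = UNIV" "cspan {a \<lhd> \<pi> d |a d. True} = UNIV"
  using \<pi> unfolding nondegenerate_hom_def by blast+

lemma hom_cancel_left:
  assumes "\<And>d. \<pi> d \<rhd> a = \<pi> d \<rhd> a'"
  shows "a = a'"
proof -
  have "b * (a - a') = 0" for b
  proof (rule clinear_eq_on_span[OF clinear_times_right clinear_const_0 hom_rules(4)])
    show "x * (a - a') = 0" if "x \<in> {b \<lhd> \<pi> d |b d. True}" for x
      using that assms by (auto simp: mult_right_left clinear_rules[OF clinear_mult_left])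
  qed
  from nondegenerate_algebraD(2)[OF nd this] show ?thesis by simp
qed

lemma hom_cancel_right:
  assumes "\<And>d. a \<lhd> \<pi> d = a' \<lhd> \<pi> d"
  shows "a = a'"
proof -
  have "(a - a') * b = 0" for b
  proof (rule clinear_eq_on_span[OF clinear_times_left clinear_const_0 hom_rules(3)])
    show "(a - a') * x = 0" if "x \<in> {\<pi> d \<rhd> b |d b. True}" for x
      using that assms by (auto simp: mult_right_left[symmetric] clinear_rules[OF clinear_mult_right])
  qed
  from nondegenerate_algebraD(1)[OF nd this] show ?thesis by simp
qed

text \<open>
  The extension acts by \<open>\<pi>(d) a \<mapsto> \<pi>(T d) a\<close>.  This is well-defined because
  \<open>\<pi>(e) (\<Sum> \<pi>(T d) a) = \<pi>(e T) (\<Sum> \<pi>(d) a)\<close> for all \<open>e\<close>, and \<open>\<pi>(D)\<close> annihilates no non-zero element.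
\<close>

lemma extend_hom:
  shows "extend_hom \<pi> T * \<pi> d = \<pi> (T \<rhd> d)" "\<pi> d * extend_hom \<pi> T = \<pi> (d \<lhd> T)"
proof -
  let ?P = "\<lambda>T'. \<forall>d. T' * \<pi> d = \<pi> (T \<rhd> d) \<and> \<pi> d * T' = \<pi> (d \<lhd> T)"
  have spanL: "cspan (range (\<lambda>(d, a). \<pi> d \<rhd> a)) = UNIV"
    and spanR: "cspan (range (\<lambda>(d, a). a \<lhd> \<pi> d)) = UNIV"
  proof -
    have "range (\<lambda>(d, a). \<pi> d \<rhd> a) = {\<pi> d \<rhd> a |d a. True}" "range (\<lambda>(d, a). a \<lhd> \<pi> d) = {a \<lhd> \<pi> d |a d. True}"
      by auto
    then show "cspan (range (\<lambda>(d, a). \<pi> d \<rhd> a)) = UNIV" "cspan (range (\<lambda>(d, a). a \<lhd> \<pi> d)) = UNIV"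
      using hom_rules(3,4) by (simp_all only:)
  qed
  have "\<exists>L. clinear L \<and> (\<forall>x. L ((\<lambda>(d, a). \<pi> d \<rhd> a) x) = (\<lambda>(d, a). \<pi> (T \<rhd> d) \<rhd> a) x)"
  proof (rule clinear_factorization[OF spanL])
    fix u assume u: "lin_ext (\<lambda>(d, a). \<pi> d \<rhd> a) u = 0"
    have "\<pi> e \<rhd> lin_ext (\<lambda>(d, a). \<pi> (T \<rhd> d) \<rhd> a) u = \<pi> (e \<lhd> T) \<rhd> lin_ext (\<lambda>(d, a). \<pi> d \<rhd> a) u" for e
      by (simp add: clinear_apply_lin_ext[OF clinear_mult_left] split_def mult_left_simps(6)[symmetric]
          hom_rules(2)[symmetric] mult_right_left del: mult_left_simps(6))
    with u show "lin_ext (\<lambda>(d, a). \<pi> (T \<rhd> d) \<rhd> a) u = 0"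
      by - (rule hom_cancel_left, simp add: clinear_rules[OF clinear_mult_left])
  qed
  then obtain L where L: "clinear L" "L (\<pi> d \<rhd> a) = \<pi> (T \<rhd> d) \<rhd> a" for d a
    by auto
  have "\<exists>R. clinear R \<and> (\<forall>x. R ((\<lambda>(d, a). a \<lhd> \<pi> d) x) = (\<lambda>(d, a). a \<lhd> \<pi> (d \<lhd> T)) x)"
  proof (rule clinear_factorization[OF spanR])
    fix u assume u: "lin_ext (\<lambda>(d, a). a \<lhd> \<pi> d) u = 0"
    have "lin_ext (\<lambda>(d, a). a \<lhd> \<pi> (d \<lhd> T)) u \<lhd> \<pi> e = lin_ext (\<lambda>(d, a). a \<lhd> \<pi> d) u \<lhd> \<pi> (T \<rhd> e)" for e
      by (simp add: clinear_apply_lin_ext[OF clinear_mult_right] split_def mult_right_simps(6)[symmetric]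
          hom_rules(2)[symmetric] mult_right_left del: mult_right_simps(6))
    with u show "lin_ext (\<lambda>(d, a). a \<lhd> \<pi> (d \<lhd> T)) u = 0"
      by - (rule hom_cancel_right, simp add: clinear_rules[OF clinear_mult_right])
  qed
  then obtain R where R: "clinear R" "R (a \<lhd> \<pi> d) = a \<lhd> \<pi> (d \<lhd> T)" for d a
    by auto
  have L_mult: "L (a * b) = L a * b" for a b
  proof (rule clinear_eq_on_span[of "\<lambda>a. L (a * b)" "\<lambda>a. L a * b", OF _ _ hom_rules(3)])
    show "clinear (\<lambda>a. L (a * b))" "clinear (\<lambda>a. L a * b)"
      by (intro lin clinear_compose[OF L(1)])+
    show "L (x * b) = L x * b" if "x \<in> {\<pi> d \<rhd> a |d a. True}" for x
      using that by (auto simp: L mult_left_mult[symmetric])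
  qed
  have R_mult: "R (a * b) = a * R b" for a b
  proof (rule clinear_eq_on_span[of "\<lambda>b. R (a * b)" "\<lambda>b. a * R b", OF _ _ hom_rules(4)])
    show "clinear (\<lambda>b. R (a * b))" "clinear (\<lambda>b. a * R b)"
      by (intro lin clinear_compose[OF R(1)])+
    show "R (a * x) = a * R x" if "x \<in> {a \<lhd> \<pi> d |a d. True}" for x
      using that by (auto simp: R mult_right_mult[symmetric])
  qed
  have mid: "a * L b = R a * b" for a b
  proof (rule clinear_eq_on_span[of "\<lambda>a. a * L b" "\<lambda>a. R a * b", OF _ _ hom_rules(4)])
    show "clinear (\<lambda>a. a * L b)" "clinear (\<lambda>a. R a * b)"
      by (intro lin clinear_compose[OF R(1)])+
    fix x assume "x \<in> {a \<lhd> \<pi> d |a d. True}"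
    then obtain a d where x: "x = a \<lhd> \<pi> d" by blast
    show "x * L b = R x * b"
    proof (rule clinear_eq_on_span[of "\<lambda>b. x * L b" "\<lambda>b. R x * b", OF _ _ hom_rules(3)])
      show "clinear (\<lambda>b. x * L b)" "clinear (\<lambda>b. R x * b)"
        by (intro lin clinear_compose[OF L(1)])+
      show "x * L y = R x * y" if "y \<in> {\<pi> d \<rhd> a |d a. True}" for y
        using that
        by (auto simp: x L R mult_right_left mult_left_simps(6)[symmetric] hom_rules(2)[symmetric]
            simp del: mult_left_simps(6))
    qed
  qed
  have mem: "(L, R) \<in> {(L, R) |L R. clinear L \<and> clinear R \<and> (\<forall>a b. L (a * b) = L a * b) \<and>
      (\<forall>a b. R (a * b) = a * R b) \<and> (\<forall>a b. a * L b = R a * b)}"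
    using L(1) R(1) L_mult R_mult mid by blast
  have LR: "Abs_multiplier (L, R) \<rhd> a = L a" "a \<lhd> Abs_multiplier (L, R) = R a" for a
    by (simp_all add: mult_left.rep_eq mult_right.rep_eq Abs_multiplier_inverse[OF mem])
  have ex: "?P (Abs_multiplier (L, R))"
  proof (intro allI conjI multiplier_eqI)
    fix d a
    show "(Abs_multiplier (L, R) * \<pi> d) \<rhd> a = \<pi> (T \<rhd> d) \<rhd> a"
      by (simp add: LR L)
    show "a \<lhd> (\<pi> d * Abs_multiplier (L, R)) = a \<lhd> \<pi> (d \<lhd> T)"
      by (simp add: LR R)
    show "a \<lhd> (Abs_multiplier (L, R) * \<pi> d) = a \<lhd> \<pi> (T \<rhd> d)"
    proof -
      have "(R a \<lhd> \<pi> d - a \<lhd> \<pi> (T \<rhd> d)) * b = 0" for b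
        by (simp add: algebra_simps mult_right_left L(2)[symmetric] mid)
      from nondegenerate_algebraD(1)[OF nd this] show ?thesis by (simp add: LR)
    qed
    show "(\<pi> d * Abs_multiplier (L, R)) \<rhd> a = \<pi> (d \<lhd> T) \<rhd> a"
    proof -
      have "b * (\<pi> d \<rhd> L a - \<pi> (d \<lhd> T) \<rhd> a) = 0" for b
        by (simp add: algebra_simps mult_right_left[symmetric] R(2)[symmetric] mid)
      from nondegenerate_algebraD(2)[OF nd this] show ?thesis by (simp add: LR)
    qed
  qed
  have "\<exists>!T'. ?P T'"
  proof (rule ex_ex1I)
    show "\<exists>T'. ?P T'" using ex by blast
    show "T' = T''" if T': "?P T'" and T'': "?P T''" for T' T''
    proof (rule multiplier_eqI)
      fix a
      show "T' \<rhd> a = T'' \<rhd> a"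
        by (rule hom_cancel_left) (metis T' T'' mult_left_simps(6))
      show "a \<lhd> T' = a \<lhd> T''"
        by (rule hom_cancel_right) (metis T' T'' mult_right_simps(6))
    qed
  qed
  from theI'[OF this] show "extend_hom \<pi> T * \<pi> d = \<pi> (T \<rhd> d)" "\<pi> d * extend_hom \<pi> T = \<pi> (d \<lhd> T)"
    unfolding extend_hom_def by blast+
qed

end

section \<open>Regular multiplier Hopf algebroids\<close>

text \<open>
  Each law is an equation between cosets in the definitions; the covering element that turns
  \<open>\<Delta>\<^sub>C(b)(1 \<otimes> c)\<close> into a value of the endomorphism \<open>\<Delta>\<^sub>C(b)\<close>, where the laws are given, is cancelled
  afterwards.
\<close>

lemma Hopf_frame_bialgebroid:
  fixes \<A> :: "'a::complex_algebra bialgebroid"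
  assumes \<A>: "multiplier_bialgebroid \<A>" and eC: "left_counit \<A> eC" and eB: "right_counit \<A> eB"
    and S: "antipode_wrt \<A> eC eB S"
  shows "Hopf_frame (*) (\<rhd>) (\<lhd>) (baseB \<A>) (baseC \<A>) (tB \<A>) (tC \<A>) (tenB \<A>) (tenC \<A>)
    (dB1 \<A>) (dB2 \<A>) (dC1 \<A>) (dC2 \<A>) eB eC S"
proof -
  note \<Delta>_rep = \<Delta>C1_rep[OF \<A>] \<Delta>C2_rep[OF \<A>] \<Delta>B1_rep[OF \<A>] \<Delta>B2_rep[OF \<A>]
  have S': "anti_isomorphism UNIV UNIV S" using S by (simp add: antipode_wrt_def)
  note ext = extend_anti[OF S' bialgebroid_parts(1)[OF \<A>]]
  have tB_inj: "inv_into (baseB \<A>) (tB \<A>) (tB \<A> x) = x" if "x \<in> baseB \<A>" for x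
    using base_algebras(3)[OF \<A>] that by (auto simp: anti_isomorphism_def bij_betw_def)
  have tC_inj: "inv_into (baseC \<A>) (tC \<A>) (tC \<A> y) = y" if "y \<in> baseC \<A>" for y
    using base_algebras(4)[OF \<A>] that by (auto simp: anti_isomorphism_def bij_betw_def)
  have ext_B: "extend_anti S (tC \<A> y) = y" if "y \<in> baseC \<A>" for y
    using S that tC_in[OF \<A> that] tC_inj[OF that] unfolding antipode_wrt_def by metis
  have ext_C: "extend_anti S (tB \<A> x) = x" if "x \<in> baseB \<A>" for x
    using S that tB_in[OF \<A> that] tB_inj[OF that] unfolding antipode_wrt_def by metis
  have eC_lin: "clinear eC" and eC_range: "eC a \<in> baseC \<A>"
    and eC_left: "y \<in> baseC \<A> \<Longrightarrow> eC (y \<rhd> a) = y * eC a"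
    and eC_t: "y \<in> baseC \<A> \<Longrightarrow> eC (tC \<A> y \<rhd> a) = eC a * y"
    and eC_counit: "qeval (\<lambda>(p, q). eC p \<rhd> q) (\<Delta>C2 \<A> a b) = a * b"
      "qeval (\<lambda>(p, q). tC \<A> (eC q) \<rhd> p) (\<Delta>C1 \<A> a b) = a * b" for y a b
    using eC unfolding left_counit_def by blast+
  have eB_lin: "clinear eB" and eB_range: "eB a \<in> baseB \<A>"
    and eB_right: "x \<in> baseB \<A> \<Longrightarrow> eB (a \<lhd> x) = eB a * x"
    and eB_t: "x \<in> baseB \<A> \<Longrightarrow> eB (a \<lhd> tB \<A> x) = x * eB a"
    and eB_counit: "qeval (\<lambda>(p, q). q \<lhd> tB \<A> (eB p)) (\<Delta>B2 \<A> b a) = b * a"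
      "qeval (\<lambda>(p, q). p \<lhd> eB q) (\<Delta>B1 \<A> b a) = b * a" for x a b
    using eB unfolding right_counit_def by blast+
  have anti: "qeval (\<lambda>(p, q). S p * q) (\<Delta>C2 \<A> a b) = eB a \<rhd> b"
    "qeval (\<lambda>(p, q). p * S q) (\<Delta>B1 \<A> a b) = a \<lhd> eC b" for a b
    using S unfolding antipode_wrt_def by blast+
  note S_lin = anti_isomorphism_UNIV(1)[OF S']
  have tC_mult: "y \<in> baseC \<A> \<Longrightarrow> y' \<in> baseC \<A> \<Longrightarrow> tC \<A> (y * y') = tC \<A> y' * tC \<A> y" for y y'
    using base_algebras(4)[OF \<A>] by (simp add: anti_isomorphism_def)
  have tB_mult: "x \<in> baseB \<A> \<Longrightarrow> x' \<in> baseB \<A> \<Longrightarrow> tB \<A> (x * x') = tB \<A> x' * tB \<A> x" for x x'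
    using base_algebras(3)[OF \<A>] by (simp add: anti_isomorphism_def)
  have tB_add: "x \<in> baseB \<A> \<Longrightarrow> x' \<in> baseB \<A> \<Longrightarrow> tB \<A> (x + x') = tB \<A> x + tB \<A> x'"
    "x \<in> baseB \<A> \<Longrightarrow> tB \<A> (k *\<^sub>C x) = k *\<^sub>C tB \<A> x" for x x' k
    using base_algebras(3)[OF \<A>] by (auto simp: anti_isomorphism_def)
  have tC_add: "y \<in> baseC \<A> \<Longrightarrow> y' \<in> baseC \<A> \<Longrightarrow> tC \<A> (y + y') = tC \<A> y + tC \<A> y'"
    "y \<in> baseC \<A> \<Longrightarrow> tC \<A> (k *\<^sub>C y) = k *\<^sub>C tC \<A> y" for y y' k
    using base_algebras(4)[OF \<A>] by (auto simp: anti_isomorphism_def)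
  have eq_B2: "eval2 (tenB \<A>) u = eval2 (tenB \<A>) v"
    if "\<And>a. eval2 (\<lambda>p q. tenB \<A> p (a * q)) u = eval2 (\<lambda>p q. tenB \<A> p (a * q)) v" for u v
    using cancel_B2[OF \<A>, of "u - v"] that by (simp add: eval2_rules)
  have eq_C1: "eval2 (tenC \<A>) u = eval2 (tenC \<A>) v"
    if "\<And>a. eval2 (\<lambda>p q. tenC \<A> (p * a) q) u = eval2 (\<lambda>p q. tenC \<A> (p * a) q) v" for u v
    using cancel_C1[OF \<A>, of "u - v"] that by (simp add: eval2_rules)
  have S_la_tC: "S (tC \<A> y \<rhd> a) = S a \<lhd> y" "S (a \<lhd> tC \<A> y) = y \<rhd> S a" if "y \<in> baseC \<A>" for y a
    using ext[where T = "tC \<A> y" and a = a] by (simp_all add: ext_B that)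
  have S_la_tB: "S (tB \<A> x \<rhd> a) = S a \<lhd> x" "S (a \<lhd> tB \<A> x) = x \<rhd> S a" if "x \<in> baseB \<A>" for x a
    using ext[where T = "tB \<A> x" and a = a] by (simp_all add: ext_C that)
  \<comment> \<open>\<open>t\<^sub>B\<close> and \<open>t\<^sub>C\<close> are additive only on \<open>B\<close> and \<open>C\<close>, so linearity of maps involving them is shown by hand below.\<close>
  note [lin] = clinear_compose[OF eC_lin] clinear_compose[OF eB_lin] clinear_compose[OF S_lin]
  show ?thesis
  proof (rule Hopf_frame.intro)
    show "balanced {} ((*) :: 'a \<Rightarrow> 'a \<Rightarrow> 'a)"
      by (rule balancedI) (intro lin | simp)+
    show "(a * b) * c = a * (b * c)" for a b c :: 'a
      by (rule mult.assoc)
    show "a = 0" if "\<And>b. a * b = 0" for a :: 'a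
      using that by (rule nondegenerate_left[OF \<A>])
    show "a = 0" if "\<And>b. b * a = 0" for a :: 'a
      using that by (rule nondegenerate_right[OF \<A>])
    show "cspan {a * b |a b :: 'a. True} = UNIV"
      using bialgebroid_parts(2)[OF \<A>] by (simp only: idempotent_algebra_def)
    show "clinear (\<lambda>a :: 'a. k \<rhd> a)" "clinear (\<lambda>a :: 'a. a \<lhd> k)" for k
      by (rule clinear_mult_left clinear_mult_right)+
    show "k \<rhd> (a * b) = (k \<rhd> a) * b" "(a * b) \<lhd> k = a * (b \<lhd> k)" "(a \<lhd> k) * b = a * (k \<rhd> b)" for k and a b :: 'a
      by (rule mult_left_mult mult_right_mult mult_right_left)+
    show RB: "tensor_product {(\<lambda>a. a \<lhd> x, \<lambda>b. b \<lhd> tB \<A> x) |x. x \<in> baseB \<A>} (tenB \<A>)"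
      using tensor_product_tenB[of \<A>] by (simp only: balB_def)
    show RC: "tensor_product {(\<lambda>a. tC \<A> y \<rhd> a, \<lambda>b. y \<rhd> b) |y. y \<in> baseC \<A>} (tenC \<A>)"
      using tensor_product_tenC[of \<A>] by (simp only: balC_def)
    show "eval2 (tenB \<A>) u = 0" if "\<And>a. eval2 (\<lambda>p q. tenB \<A> (a * p) q) u = 0" for u
      using that by (rule cancel_B1[OF \<A>])
    show "eval2 (tenB \<A>) u = 0" if "\<And>a. eval2 (\<lambda>p q. tenB \<A> p (a * q)) u = 0" for u
      using that by (rule cancel_B2[OF \<A>])
    show "eval2 (tenC \<A>) u = 0" if "\<And>a. eval2 (\<lambda>p q. tenC \<A> (p * a) q) u = 0" for u
      using that by (rule cancel_C1[OF \<A>])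
    show "eval2 (tenC \<A>) u = 0" if "\<And>a. eval2 (\<lambda>p q. tenC \<A> p (q * a)) u = 0" for u
      using that by (rule cancel_C2[OF \<A>])
    show "eval2 (\<lambda>p q. tenB \<A> p (c * q)) (dB1 \<A> a b) = eval2 (\<lambda>p q. tenB \<A> (a * p) q) (dB2 \<A> c b)" for a b c
      by (simp only: \<Delta>_rep(6,8)[symmetric])
    show "eval2 (\<lambda>p q. tenC \<A> p (q * c)) (dC1 \<A> b a) = eval2 (\<lambda>p q. tenC \<A> (p * a) q) (dC2 \<A> b c)" for a b c
      by (simp only: \<Delta>_rep(2,4)[symmetric])
    show "clinear (\<lambda>b. eval2 (tenB \<A>) (dB1 \<A> a b))" for a
      by (rule clinearI; unfold eval2_rules[symmetric]; rule eq_B2)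
        (simp_all add: eval2_rules \<Delta>_rep(6)[symmetric] clinear_rules[OF clinear_\<Delta>B[OF \<A>]])
    show "clinear (\<lambda>b. eval2 (tenC \<A>) (dC2 \<A> b c))" for c
      by (rule clinearI; unfold eval2_rules[symmetric]; rule eq_C1)
        (simp_all add: eval2_rules \<Delta>_rep(4)[symmetric] clinear_rules[OF clinear_\<Delta>C[OF \<A>]])
    show "balanced {(\<lambda>a. a \<lhd> x, \<lambda>b. b \<lhd> tB \<A> x) |x. x \<in> baseB \<A>}
        (\<lambda>p q. eval2 (\<lambda>r s. tenB \<A> r (q * s)) (dB1 \<A> p b))" for b
      using \<Delta>B_tens(1)[OF \<A>, of b] by (simp only: balB_def \<Delta>_rep)
    show "balanced {(\<lambda>a. tC \<A> y \<rhd> a, \<lambda>b. y \<rhd> b) |y. y \<in> baseC \<A>}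
        (\<lambda>p q. eval2 (\<lambda>r s. tenC \<A> (r * p) s) (dC2 \<A> b q))" for b
      using \<Delta>C_tens(1)[OF \<A>, of b] by (simp only: balC_def \<Delta>_rep(4))
    show "eval2 (tenB \<A>) (dB1 \<A> c (b' * b)) =
        eval2 (\<lambda>p q. eval2 (\<lambda>r s. tenB \<A> r (q * s)) (dB1 \<A> p b)) (dB1 \<A> c b')" for b b' c
      proof -
      let ?v = "eval2 (\<lambda>p q. eval2 (\<lambda>r s. gen (r, q * s)) (dB1 \<A> p b)) (dB1 \<A> c b')"
      have "eval2 (tenB \<A>) (dB1 \<A> c (b' * b)) = eval2 (tenB \<A>) ?v"
      proof (rule eq_B2)
        fix e
        have "\<Delta>B \<A> b' (tens (NB \<A>) c e) = qclass (NB \<A>) (eval2 (\<lambda>p q. gen (p, e * q)) (dB1 \<A> c b'))"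
          by (rule val_eqD[OF csubspace_NB[of \<A>]]) (simp_all add: qEnd_in_qspace[OF \<Delta>_qEnd(2)[OF \<A>]] \<Delta>_rep val_qclass_NB eval2_eval2)
        then have "val (NB \<A>) (\<Delta>B \<A> (b' * b) (tens (NB \<A>) c e)) =
            eval2 (\<lambda>p q. eval2 (\<lambda>r s. tenB \<A> r ((e * q) * s)) (dB1 \<A> p b)) (dB1 \<A> c b')"
          by (simp add: \<Delta>B_mult[OF \<A>] \<Delta>B_tens(2)[OF \<A>] eval2_eval2 \<Delta>_rep(6))
        then show "eval2 (\<lambda>p q. tenB \<A> p (e * q)) (dB1 \<A> c (b' * b)) = eval2 (\<lambda>p q. tenB \<A> p (e * q)) ?v"
          by (simp add: \<Delta>_rep(6) eval2_eval2 mult.assoc)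
      qed
      then show ?thesis by (simp add: eval2_eval2)
    qed
    show "eval2 (tenC \<A>) (dC2 \<A> (b * b') c) =
        eval2 (\<lambda>p q. eval2 (\<lambda>r s. tenC \<A> (r * p) s) (dC2 \<A> b q)) (dC2 \<A> b' c)" for b b' c
      proof -
      let ?v = "eval2 (\<lambda>p q. eval2 (\<lambda>r s. gen (r * p, s)) (dC2 \<A> b q)) (dC2 \<A> b' c)"
      have "eval2 (tenC \<A>) (dC2 \<A> (b * b') c) = eval2 (tenC \<A>) ?v"
      proof (rule eq_C1)
        fix e
        have "\<Delta>C \<A> b' (tens (NC \<A>) e c) = qclass (NC \<A>) (eval2 (\<lambda>p q. gen (p * e, q)) (dC2 \<A> b' c))"
          by (rule val_eqD[OF csubspace_NC[of \<A>]]) (simp_all add: qEnd_in_qspace[OF \<Delta>_qEnd(1)[OF \<A>]] \<Delta>_rep(4) val_qclass_NC eval2_eval2)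
        then have "val (NC \<A>) (\<Delta>C \<A> (b * b') (tens (NC \<A>) e c)) =
            eval2 (\<lambda>p q. eval2 (\<lambda>r s. tenC \<A> (r * (p * e)) s) (dC2 \<A> b q)) (dC2 \<A> b' c)"
          by (simp add: \<Delta>C_mult[OF \<A>] \<Delta>C_tens(2)[OF \<A>] eval2_eval2 \<Delta>_rep(4))
        then show "eval2 (\<lambda>p q. tenC \<A> (p * e) q) (dC2 \<A> (b * b') c) = eval2 (\<lambda>p q. tenC \<A> (p * e) q) ?v"
          by (simp add: \<Delta>_rep(4) eval2_eval2 mult.assoc)
      qed
      then show ?thesis by (simp add: eval2_eval2)
    qed
    show "eval2 (tenB \<A>) (dB1 \<A> c (x \<rhd> b)) = eval2 (\<lambda>p q. tenB \<A> p (x \<rhd> q)) (dB1 \<A> c b)"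
      if "x \<in> baseB \<A>" for x b c
      proof -
      have "eval2 (tenB \<A>) (dB1 \<A> c (x \<rhd> b)) = eval2 (tenB \<A>) (eval2 (\<lambda>p q. gen (p, x \<rhd> q)) (dB1 \<A> c b))"
        using \<Delta>B_left_B[OF \<A> that, of b c]
        by (intro eq_B2) (simp add: eval2_eval2 \<Delta>_rep(6) mult_right_left)
      then show ?thesis by (simp add: eval2_eval2)
    qed
    show "eval2 (tenB \<A>) (dB1 \<A> c (y \<rhd> b)) = eval2 (tenB \<A>) (dB1 \<A> (c \<lhd> y) b)"
      if "y \<in> baseC \<A>" for y b c
      using \<Delta>B_left_C[OF \<A> that, of b c] by (intro eq_B2) (simp add: \<Delta>_rep(6))
    show "eval2 (tenC \<A>) (dC2 \<A> (b \<lhd> y) c) = eval2 (\<lambda>p q. tenC \<A> (p \<lhd> y) q) (dC2 \<A> b c)"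
      if "y \<in> baseC \<A>" for y b c
      proof -
      have "eval2 (tenC \<A>) (dC2 \<A> (b \<lhd> y) c) = eval2 (tenC \<A>) (eval2 (\<lambda>p q. gen (p \<lhd> y, q)) (dC2 \<A> b c))"
        using \<Delta>C_right_C[OF \<A>, of y b _ c] that base_mult(2)[OF \<A>]
        by (intro eq_C1) (simp add: eval2_eval2 \<Delta>_rep(4) mult_right_left)
      then show ?thesis by (simp add: eval2_eval2)
    qed
    show "eval2 (tenC \<A>) (dC2 \<A> (b \<lhd> x) c) = eval2 (tenC \<A>) (dC2 \<A> b (x \<rhd> c))"
      if "x \<in> baseB \<A>" for x b c
      using \<Delta>C_right_B[OF \<A> that, of b _ c] by (intro eq_C1) (simp add: \<Delta>_rep(4))
    show "tB \<A> x \<in> baseC \<A>" if "x \<in> baseB \<A>" for x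
      using that by (rule tB_in[OF \<A>])
    show "tC \<A> y \<in> baseB \<A>" if "y \<in> baseC \<A>" for y
      using that by (rule tC_in[OF \<A>])
    show "eB a \<in> baseB \<A>" "eC a \<in> baseC \<A>" for a
      by (rule eB_range eC_range)+
    show "clinear (\<lambda>a. b \<lhd> eB a)" "clinear (\<lambda>a. eC a \<rhd> b)" for b
      by (intro lin)+
    show "b \<lhd> eB (a \<lhd> x) = b \<lhd> eB a \<lhd> x" "b \<lhd> eB (a \<lhd> tB \<A> x) = b \<lhd> x \<lhd> eB a"
      if "x \<in> baseB \<A>" for x a b
      by (simp_all add: that eB_right eB_t)
    show "eC (y \<rhd> a) \<rhd> b = y \<rhd> eC a \<rhd> b" "eC (tC \<A> y \<rhd> a) \<rhd> b = eC a \<rhd> y \<rhd> b"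
      if "y \<in> baseC \<A>" for y a b
      by (simp_all add: that eC_left eC_t)
    have "balanced (balB \<A>) (\<lambda>p q. p \<lhd> eB q)"
      by (intro balanced_balB_I lin) (simp add: eB_t)
    then show "eval2 (\<lambda>p q. p \<lhd> eB q) (dB1 \<A> b a) = b * a" for a b
      using eB_counit(2)[of b a] by (simp only: \<Delta>_rep NB_def qeval_balanced)
    have "balanced (balB \<A>) (\<lambda>p q. q \<lhd> tB \<A> (eB p))"
      using tB_add tB_mult eB_range
      by (intro balanced_balB_I lin clinearI)
        (simp_all add: clinear_rules[OF eB_lin] eB_right)
    then show "eval2 (\<lambda>p q. q \<lhd> tB \<A> (eB p)) (dB2 \<A> b a) = b * a" for a b
      using eB_counit(1)[of b a] by (simp only: \<Delta>_rep NB_def qeval_balanced)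
    have "balanced (balC \<A>) (\<lambda>p q. tC \<A> (eC q) \<rhd> p)"
      using tC_add tC_mult eC_range
      by (intro balanced_balC_I lin clinearI)
        (simp_all add: clinear_rules[OF eC_lin] eC_left)
    then show "eval2 (\<lambda>p q. tC \<A> (eC q) \<rhd> p) (dC1 \<A> a b) = a * b" for a b
      using eC_counit(2)[of a b] by (simp only: \<Delta>_rep NC_def qeval_balanced)
    have "balanced (balC \<A>) (\<lambda>p q. eC p \<rhd> q)"
      by (intro balanced_balC_I lin) (simp add: eC_t)
    then show "eval2 (\<lambda>p q. eC p \<rhd> q) (dC2 \<A> a b) = a * b" for a b
      using eC_counit(1)[of a b] by (simp only: \<Delta>_rep NC_def qeval_balanced)
    show "clinear S" "bij S" "S (a * b) = S b * S a" for a b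
      by (rule anti_isomorphism_UNIV[OF S'])+
    show "S (tC \<A> y \<rhd> a) = S a \<lhd> y" "S (a \<lhd> tC \<A> y) = y \<rhd> S a" if "y \<in> baseC \<A>" for y a
      using that by (rule S_la_tC)+
    show "S (tB \<A> x \<rhd> a) = S a \<lhd> x" "S (a \<lhd> tB \<A> x) = x \<rhd> S a" if "x \<in> baseB \<A>" for x a
      using that by (rule S_la_tB)+
    have "balanced (balB \<A>) (\<lambda>p q. p * S q)"
      by (intro balanced_balB_I lin) (simp add: S_la_tB mult_right_left)
    then show "eval2 (\<lambda>p q. p * S q) (dB1 \<A> a b) = a \<lhd> eC b" for a b
      using anti(2)[of a b] by (simp only: \<Delta>_rep NB_def qeval_balanced)
    have "balanced (balC \<A>) (\<lambda>p q. S p * q)"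
      by (intro balanced_balC_I lin) (simp add: S_la_tC mult_right_left)
    then show "eval2 (\<lambda>p q. S p * q) (dC2 \<A> a b) = eB a \<rhd> b" for a b
      using anti(1)[of a b] by (simp only: \<Delta>_rep NC_def qeval_balanced)
  qed (rule coassoc_CB[OF \<A>, unfolded balB_def balC_def] coassoc_BC[OF \<A>, unfolded balB_def balC_def]; blast)+
qed

text \<open>
  Endomorphisms of a quotient are functions on cosets, made unique by \<open>extensional\<close>.  A property \<open>P\<close>
  of such functions describes one of them if it holds for the one induced by \<open>h\<close> and determines the
  values on elementary tensors.
\<close>

lemma the_coset_endomorphism:
  fixes R :: "'a::complex_algebra balance" and h :: "'a tensor2 \<Rightarrow> 'a tensor2"
  defines "N \<equiv> relations2 R"
  assumes h: "clinear h" "\<And>n. n \<in> N \<Longrightarrow> h n \<in> N"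
    and sat: "\<And>K. (\<And>u. K (qclass N u) = qclass N (h u)) \<Longrightarrow> P K"
    and uniq: "\<And>\<Theta> p q. \<Theta> \<in> qEnd N \<Longrightarrow> P \<Theta> \<Longrightarrow> val N (\<Theta> (tens N p q)) = proj N (h (gen (p, q)))"
  shows "(THE \<Theta>. \<Theta> \<in> qEnd N \<inter> extensional (qspace N) \<and> P \<Theta>) (qclass N u) = qclass N (h u)"
proof -
  have N: "csubspace N" by (simp add: N_def csubspace_relations2)
  define K where "K = restrict (\<lambda>X. qclass N (h (rep X))) (qspace N)"
  have K: "K (qclass N u) = qclass N (h u)" for u
  proof -
    have "rep (qclass N u) - u \<in> N"
      using rep_in[of "qclass N u"] qclass_self[OF N, of u] mem_qclass by blast
    from h(2)[OF this] show ?thesis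
      by (simp add: K_def qclass_eq_iff[OF N] clinear_rules[OF h(1)])
  qed
  have "K \<in> qEnd N"
    unfolding qEnd_def qspace_def
    by (auto simp: K qadd_qclass[OF N] qscale_qclass[OF N] clinear_rules[OF h(1)])
  moreover have "K \<in> extensional (qspace N)"
    by (simp add: K_def)
  moreover have "P K" by (rule sat) (rule K)
  moreover have "\<Theta> = K" if \<Theta>: "\<Theta> \<in> qEnd N" "\<Theta> \<in> extensional (qspace N)" "P \<Theta>" for \<Theta>
  proof (rule extensionalityI[OF \<Theta>(2) \<open>K \<in> extensional (qspace N)\<close>])
    fix X assume X: "X \<in> qspace N"
    then obtain u where u: "X = qclass N u" by (auto simp: qspace_def)
    have "val N (\<Theta> X) = eval2 (\<lambda>p q. val N (\<Theta> (tens N p q))) u"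
      unfolding u using \<Theta>(1) unfolding N_def by (rule qEnd_eval2(2))
    also have "\<dots> = proj N (h u)"
      unfolding uniq[OF \<Theta>(1,3)]
      by (rule clinear_tensor2_eq_eval2[OF clinear_compose[OF proj(1)[OF N] h(1)], symmetric])
    also have "\<dots> = val N (K X)"
      by (simp add: u K val_qclass[OF N])
    finally show "\<Theta> X = K X"
      by (rule val_eqD[OF N qEnd_in_qspace[OF \<Theta>(1) X] qEnd_in_qspace[OF \<open>K \<in> qEnd N\<close> X]])
  qed
  ultimately have "(THE \<Theta>. \<Theta> \<in> qEnd N \<inter> extensional (qspace N) \<and> P \<Theta>) = K"
    by (intro the_equality) blast+
  then show ?thesis by (simp add: K)
qed

locale Hopf_bialgebroid =
  fixes \<A> :: "'a::complex_algebra bialgebroid" and eC eB :: "'a \<Rightarrow> 'a multiplier" and S :: "'a \<Rightarrow> 'a"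
  assumes bialgebroid: "multiplier_bialgebroid \<A>"
    and left_counit: "left_counit \<A> eC" and right_counit: "right_counit \<A> eB"
    and antipode: "antipode_wrt \<A> eC eB S"
begin

sublocale H: Hopf_frame "(*)" "(\<rhd>)" "(\<lhd>)" "baseB \<A>" "baseC \<A>" "tB \<A>" "tC \<A>" "tenB \<A>" "tenC \<A>"
    "dB1 \<A>" "dB2 \<A>" "dC1 \<A>" "dC2 \<A>" eB eC S
  using bialgebroid left_counit right_counit antipode by (rule Hopf_frame_bialgebroid)

sublocale M: Hopf_frame "\<lambda>a b. b * a" "\<lambda>k a. a \<lhd> k" "\<lambda>a k. k \<rhd> a" "baseC \<A>" "baseB \<A>" "tC \<A>" "tB \<A>"
    "\<lambda>a b. tenC \<A> b a" "\<lambda>a b. tenB \<A> b a" "\<lambda>a b. flip2 (dC2 \<A> b a)" "\<lambda>c b. flip2 (dC1 \<A> b c)"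
    "\<lambda>b a. flip2 (dB2 \<A> a b)" "\<lambda>b c. flip2 (dB1 \<A> c b)" eC eB S
  by (rule H.mirror)

lemma RC_eq: "H.RC = balC \<A>" and RB_eq: "H.RB = balB \<A>"
  by (simp_all only: balC_def balB_def)

lemma balanced_mirror: "balanced M.RC f \<longleftrightarrow> balanced (balB \<A>) (\<lambda>a b. f b a)"
proof -
  have "M.RC = (\<lambda>(f, g). (g, f)) ` balB \<A>"
    by (simp only: balB_def setcompr_eq_image image_image prod.case)
  then show ?thesis by (simp only: balanced_flip)
qed

definition DB :: "'a \<Rightarrow> 'a \<Rightarrow> 'a \<Rightarrow> 'a tensor2"
  where "DB b p q = eval2 (\<lambda>r s. gen (r, q * s)) (dB1 \<A> p b)"

lemma DB_mirror: "DB b p q = flip2 (M.DC b q p)"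
  by (simp add: DB_def M.DC_def flip2_eval2)

lemma \<Delta>C_eq_DC: "\<Delta>C \<A> b (tens (NC \<A>) p q) = qclass (NC \<A>) (H.DC b p q)"
  by (rule val_eqD[OF csubspace_NC[of \<A>]])
    (simp_all add: qEnd_in_qspace[OF \<Delta>_qEnd(1)[OF bialgebroid]] \<Delta>C2_rep(2)[OF bialgebroid]
      val_qclass_NC H.eval2_DC)

lemma \<Delta>B_eq_DB: "\<Delta>B \<A> b (tens (NB \<A>) p q) = qclass (NB \<A>) (DB b p q)"
  by (rule val_eqD[OF csubspace_NB[of \<A>]])
    (simp_all add: qEnd_in_qspace[OF \<Delta>_qEnd(2)[OF bialgebroid]] \<Delta>B1_rep(2)[OF bialgebroid]
      val_qclass_NB DB_def eval2_eval2)

text \<open>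
  Linear maps on the free vector space that induce \<open>\<Delta>\<^sub>C(T)\<close> and \<open>\<Delta>\<^sub>B(T)\<close> on the quotients.
\<close>

definition extC :: "'a multiplier \<Rightarrow> 'a tensor2 \<Rightarrow> 'a tensor2"
  where "extC T = eval2 (H.ext T)"

definition extB :: "'a multiplier \<Rightarrow> 'a tensor2 \<Rightarrow> 'a tensor2"
  where "extB T u = flip2 (eval2 (M.ext T) (flip2 u))"

lemma \<Delta>C_ext_qclass: "\<Delta>C_ext \<A> T (qclass (NC \<A>) u) = qclass (NC \<A>) (extC T u)"
  unfolding \<Delta>C_ext_def NC_def
proof (rule the_coset_endomorphism, fold NC_def)
  note bal = balanced_tenC[of \<A>, folded RC_eq]
  note bal_ext = H.balanced_ext[OF bal, of T]
  show "clinear (extC T)" unfolding extC_def by (rule clinear_eval2)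
  show "extC T n \<in> NC \<A>" if "n \<in> NC \<A>" for n
    using eval2_relations2[OF bal_ext[unfolded RC_eq], of n] that
    by (simp add: in_NC_iff extC_def eval2_eval2 NC_def[symmetric])
  show "(\<forall>X\<in>qspace (NC \<A>). \<forall>a b. K (ract (NC \<A>) X (multiplier_of a) (multiplier_of b)) =
        ract (NC \<A>) (K X) (multiplier_of a) (multiplier_of b)) \<and>
      (\<forall>a b c. K (\<Delta>C \<A> a (tens (NC \<A>) b c)) = \<Delta>C \<A> (T \<rhd> a) (tens (NC \<A>) b c))"
    if K: "\<And>u. K (qclass (NC \<A>) u) = qclass (NC \<A>) (extC T u)" for K
  proof (intro conjI ballI allI)
    fix X a b assume "X \<in> qspace (NC \<A>)"
    then obtain u where u: "X = qclass (NC \<A>) u" by (auto simp: qspace_def)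
    show "K (ract (NC \<A>) X (multiplier_of a) (multiplier_of b)) =
        ract (NC \<A>) (K X) (multiplier_of a) (multiplier_of b)"
      using H.ext_mult[OF bal, of T a b u]
      by (simp add: u K ract_NC[OF bialgebroid] qclass_NC_eq_iff extC_def eval2_eval2)
  next
    show "K (\<Delta>C \<A> a (tens (NC \<A>) b c)) = \<Delta>C \<A> (T \<rhd> a) (tens (NC \<A>) b c)" for a b c
      using H.ext_DC[OF bal, of T a b c] by (simp add: \<Delta>C_eq_DC K qclass_NC_eq_iff extC_def eval2_eval2)
  qed
  fix \<Theta> p q
  assume \<Theta>: "\<Theta> \<in> qEnd (NC \<A>)" and P: "(\<forall>X\<in>qspace (NC \<A>). \<forall>a b. \<Theta> (ract (NC \<A>) X (multiplier_of a) (multiplier_of b)) =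
        ract (NC \<A>) (\<Theta> X) (multiplier_of a) (multiplier_of b)) \<and>
      (\<forall>a b c. \<Theta> (\<Delta>C \<A> a (tens (NC \<A>) b c)) = \<Delta>C \<A> (T \<rhd> a) (tens (NC \<A>) b c))"
  let ?f = "\<lambda>p q. val (NC \<A>) (\<Theta> (tens (NC \<A>) p q))" and ?g = "\<lambda>p q. eval2 (tenC \<A>) (H.ext T p q)"
  have \<Theta>': "\<Theta> \<in> qEnd (relations2 (balC \<A>))" using \<Theta> by (simp only: NC_def)
  note f = qEnd_eval2[OF \<Theta>', folded NC_def]
  have "?f p q - ?g p q = 0"
  proof (rule H.DC_eq_0[of "\<lambda>p q. ?f p q - ?g p q"])
    show "balanced H.RC (\<lambda>p q. ?f p q - ?g p q)"
      using f(1) bal_ext unfolding RC_eq by (rule balanced_diff)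
    fix b p q
    have "\<Theta> (qclass (NC \<A>) (H.DC b p q)) = qclass (NC \<A>) (H.DC (T \<rhd> b) p q)"
      using P by (simp add: \<Delta>C_eq_DC)
    then show "eval2 (\<lambda>p q. ?f p q - ?g p q) (H.DC b p q) = 0"
      by (simp add: eval2_diff_fun f(2)[symmetric] val_qclass_NC H.ext_DC[OF bal])
  qed
  then show "val (NC \<A>) (\<Theta> (tens (NC \<A>) p q)) = proj (NC \<A>) (extC T (gen (p, q)))"
    by (simp add: extC_def eval2_tenC[symmetric])
qed

lemma extB_DB:
  assumes "balanced (balB \<A>) f"
  shows "eval2 f (extB T (DB c p q)) = eval2 f (DB (c \<lhd> T) p q)"
  using M.ext_DC[of "\<lambda>a b. f b a" T c q p] assms
  by (simp add: balanced_mirror extB_def DB_mirror eval2_eval2)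

lemma DB_eq_0:
  assumes "balanced (balB \<A>) f" "\<And>b p q. eval2 f (DB b p q) = 0"
  shows "f p q = 0"
  using M.DC_eq_0[of "\<lambda>a b. f b a" q p] assms by (simp add: balanced_mirror DB_mirror)

lemma balanced_extB:
  assumes "balanced (balB \<A>) f"
  shows "balanced (balB \<A>) (\<lambda>p q. eval2 f (extB T (gen (p, q))))"
  using M.balanced_ext[of "\<lambda>a b. f b a" T] assms by (simp add: balanced_mirror extB_def)

lemma clinear_extB: "clinear (extB T)"
  unfolding extB_def by (intro clinear_compose[OF clinear_flip2] clinear_compose[OF clinear_eval2] clinear_flip2)

lemma \<Delta>B_ext_qclass: "\<Delta>B_ext \<A> T (qclass (NB \<A>) u) = qclass (NB \<A>) (extB T u)"
  unfolding \<Delta>B_ext_def NB_def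
proof (rule the_coset_endomorphism, fold NB_def)
  note bal = balanced_tenB[of \<A>]
  have bal': "balanced M.RC (\<lambda>a b. tenB \<A> b a)" using bal by (simp add: balanced_mirror)
  show "clinear (extB T)" by (rule clinear_extB)
  have extB: "eval2 (tenB \<A>) (extB T n) = eval2 (\<lambda>p q. eval2 (tenB \<A>) (extB T (gen (p, q)))) n" for n
    by (rule clinear_tensor2_eq_eval2[OF clinear_compose[OF clinear_eval2 clinear_extB]])
  show "extB T n \<in> NB \<A>" if "n \<in> NB \<A>" for n
    unfolding in_NB_iff by (subst extB, rule eval2_relations2[OF balanced_extB[OF bal]]) (use that in \<open>simp only: NB_def\<close>)
  show "(\<forall>X\<in>qspace (NB \<A>). \<forall>a b. K (lact (NB \<A>) (multiplier_of a) (multiplier_of b) X) =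
        lact (NB \<A>) (multiplier_of a) (multiplier_of b) (K X)) \<and>
      (\<forall>a b c. K (\<Delta>B \<A> c (tens (NB \<A>) a b)) = \<Delta>B \<A> (c \<lhd> T) (tens (NB \<A>) a b))"
    if K: "\<And>u. K (qclass (NB \<A>) u) = qclass (NB \<A>) (extB T u)" for K
  proof (intro conjI ballI allI)
    fix X a b assume "X \<in> qspace (NB \<A>)"
    then obtain u where u: "X = qclass (NB \<A>) u" by (auto simp: qspace_def)
    show "K (lact (NB \<A>) (multiplier_of a) (multiplier_of b) X) =
        lact (NB \<A>) (multiplier_of a) (multiplier_of b) (K X)"
      using M.ext_mult[OF bal', of T b a "flip2 u"]
      by (simp add: u K lact_NB[OF bialgebroid] qclass_NB_eq_iff extB_def eval2_eval2)
  next
    show "K (\<Delta>B \<A> c (tens (NB \<A>) a b)) = \<Delta>B \<A> (c \<lhd> T) (tens (NB \<A>) a b)" for a b c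
      using extB_DB[OF bal] by (simp add: \<Delta>B_eq_DB K qclass_NB_eq_iff)
  qed
  fix \<Theta> p q
  assume \<Theta>: "\<Theta> \<in> qEnd (NB \<A>)" and P: "(\<forall>X\<in>qspace (NB \<A>). \<forall>a b. \<Theta> (lact (NB \<A>) (multiplier_of a) (multiplier_of b) X) =
        lact (NB \<A>) (multiplier_of a) (multiplier_of b) (\<Theta> X)) \<and>
      (\<forall>a b c. \<Theta> (\<Delta>B \<A> c (tens (NB \<A>) a b)) = \<Delta>B \<A> (c \<lhd> T) (tens (NB \<A>) a b))"
  let ?f = "\<lambda>p q. val (NB \<A>) (\<Theta> (tens (NB \<A>) p q))" and ?g = "\<lambda>p q. eval2 (tenB \<A>) (extB T (gen (p, q)))"
  have \<Theta>': "\<Theta> \<in> qEnd (relations2 (balB \<A>))" using \<Theta> by (simp only: NB_def)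
  note f = qEnd_eval2[OF \<Theta>', folded NB_def]
  have "?f p q - ?g p q = 0"
  proof (rule DB_eq_0[of "\<lambda>p q. ?f p q - ?g p q"])
    show "balanced (balB \<A>) (\<lambda>p q. ?f p q - ?g p q)"
      using f(1) balanced_extB[OF bal] by (rule balanced_diff)
    fix b p q
    have "\<Theta> (qclass (NB \<A>) (DB b p q)) = qclass (NB \<A>) (DB (b \<lhd> T) p q)"
      using P by (simp add: \<Delta>B_eq_DB)
    then show "eval2 (\<lambda>p q. ?f p q - ?g p q) (DB b p q) = 0"
      by (simp add: eval2_diff_fun f(2)[symmetric] val_qclass_NB extB[symmetric] extB_DB[OF bal])
  qed
  then show "val (NB \<A>) (\<Theta> (tens (NB \<A>) p q)) = proj (NB \<A>) (extB T (gen (p, q)))"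
    by (simp add: eval2_tenB[symmetric])
qed

end

section \<open>Morphisms\<close>

locale Hopf_morphism =
  A: Hopf_bialgebroid \<A> eC eB S + D: Hopf_bialgebroid \<D> \<delta>C \<delta>B S\<^sub>D
  for \<A> :: "'a::complex_algebra bialgebroid" and eC eB S
    and \<D> :: "'d::complex_algebra bialgebroid" and \<delta>C \<delta>B S\<^sub>D +
  fixes \<pi> :: "'d \<Rightarrow> 'a multiplier"
  assumes morphism: "morphism \<D> \<A> \<pi>"
begin

lemma nondegenerate_\<pi>: "nondegenerate_hom \<pi>"
  using morphism by (simp add: morphism_def)

lemmas nd_A = bialgebroid_parts(1)[OF A.bialgebroid]
lemmas \<pi>_rules = hom_rules[OF nondegenerate_\<pi> nd_A]

lemma clinear_\<pi> [lin]: "clinear h \<Longrightarrow> clinear (\<lambda>x. \<pi> (h x))"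
  by (rule clinear_compose[OF \<pi>_rules(1)])

lemmas [lin] = A.H.lin_rules(5,11,12) D.H.lin_rules(5,11,12)

lemma \<pi>_la: "\<pi> d \<rhd> \<pi> d' \<rhd> a = \<pi> (d * d') \<rhd> a"
  by (simp add: \<pi>_rules(2))

text \<open>
  The value of \<open>\<Delta>\<^sub>B(\<pi>(d))\<close> does not depend on the representative of \<open>(d' \<otimes> d'')\<Delta>\<^sub>B(d)\<close> on the other side of
  the defining equation.  Hence \<open>p \<otimes> q \<mapsto> a \<pi>(p) \<otimes> b \<pi>(q)\<close> kills the relations of the tensor product
  over \<open>\<D>\<close>.
\<close>

lemma morphism_B:
  "eval2 (\<lambda>p q. tenB \<A> (a \<lhd> \<pi> p) (b \<lhd> \<pi> q)) (D.DB d d' d'') =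
    eval2 (tenB \<A>) (A.extB (\<pi> d) (gen (a \<lhd> \<pi> d', b \<lhd> \<pi> d'')))"
  "balanced (balB \<D>) (\<lambda>p q. tenB \<A> (a \<lhd> \<pi> p) (b \<lhd> \<pi> q))"
proof -
  have *: "eval2 (\<lambda>p q. tenB \<A> (a \<lhd> \<pi> p) (b \<lhd> \<pi> q)) u =
      eval2 (tenB \<A>) (A.extB (\<pi> d) (gen (a \<lhd> \<pi> d', b \<lhd> \<pi> d'')))"
    if u: "u \<in> qclass (NB \<D>) (D.DB d d' d'')" for u d d' d''
  proof -
    have "\<Delta>B_ext \<A> (\<pi> d) (tens (NB \<A>) (a \<lhd> \<pi> d') (b \<lhd> \<pi> d'')) =
        qlift (NB \<A>) (\<lambda>(p, q). tens (NB \<A>) (a \<lhd> \<pi> p) (b \<lhd> \<pi> q)) (\<Delta>B \<D> d (tens (NB \<D>) d' d''))"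
      using morphism unfolding morphism_def by blast
    then have "qlift (NB \<A>) (\<lambda>(p, q). tens (NB \<A>) (a \<lhd> \<pi> p) (b \<lhd> \<pi> q)) (qclass (NB \<D>) (D.DB d d' d'')) =
        qclass (NB \<A>) (A.extB (\<pi> d) (gen (a \<lhd> \<pi> d', b \<lhd> \<pi> d'')))"
      unfolding D.\<Delta>B_eq_DB by (simp only: A.\<Delta>B_ext_qclass tens_def)
    from qlift_value[OF csubspace_NB this u, of "\<lambda>(p, q). gen (a \<lhd> \<pi> p, b \<lhd> \<pi> q)"]
    have "qclass (NB \<A>) (eval2 (\<lambda>p q. gen (a \<lhd> \<pi> p, b \<lhd> \<pi> q)) u) =
        qclass (NB \<A>) (A.extB (\<pi> d) (gen (a \<lhd> \<pi> d', b \<lhd> \<pi> d'')))"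
      by (auto simp: eval2_def tens_def qclass_self csubspace_NB)
    then show ?thesis by (simp add: qclass_NB_eq_iff eval2_eval2)
  qed
  show "eval2 (\<lambda>p q. tenB \<A> (a \<lhd> \<pi> p) (b \<lhd> \<pi> q)) (D.DB d d' d'') =
      eval2 (tenB \<A>) (A.extB (\<pi> d) (gen (a \<lhd> \<pi> d', b \<lhd> \<pi> d'')))"
    by (rule *) (rule qclass_self[OF csubspace_NB])
  have "eval2 (\<lambda>p q. tenB \<A> (a \<lhd> \<pi> p) (b \<lhd> \<pi> q)) n = 0" if "n \<in> relations2 (balB \<D>)" for n
    using *[of "D.DB 0 0 0 + n" 0 0 0] *[of "D.DB 0 0 0" 0 0 0] that
    by (simp add: mem_qclass NB_def[symmetric] qclass_self csubspace_NB eval2_rules complex_vector.subspace_0)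
  from balanced_clinear[OF clinear_eval2 this]
  show "balanced (balB \<D>) (\<lambda>p q. tenB \<A> (a \<lhd> \<pi> p) (b \<lhd> \<pi> q))" by simp
qed

lemma morphism_C:
  "eval2 (\<lambda>p q. tenC \<A> (\<pi> p \<rhd> a) (\<pi> q \<rhd> b)) (D.H.DC d d' d'') =
    eval2 (tenC \<A>) (A.extC (\<pi> d) (gen (\<pi> d' \<rhd> a, \<pi> d'' \<rhd> b)))"
  "balanced (balC \<D>) (\<lambda>p q. tenC \<A> (\<pi> p \<rhd> a) (\<pi> q \<rhd> b))"
proof -
  have *: "eval2 (\<lambda>p q. tenC \<A> (\<pi> p \<rhd> a) (\<pi> q \<rhd> b)) u =
      eval2 (tenC \<A>) (A.extC (\<pi> d) (gen (\<pi> d' \<rhd> a, \<pi> d'' \<rhd> b)))"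
    if u: "u \<in> qclass (NC \<D>) (D.H.DC d d' d'')" for u d d' d''
  proof -
    have "\<Delta>C_ext \<A> (\<pi> d) (tens (NC \<A>) (\<pi> d' \<rhd> a) (\<pi> d'' \<rhd> b)) =
        qlift (NC \<A>) (\<lambda>(p, q). tens (NC \<A>) (\<pi> p \<rhd> a) (\<pi> q \<rhd> b)) (\<Delta>C \<D> d (tens (NC \<D>) d' d''))"
      using morphism unfolding morphism_def by blast
    then have "qlift (NC \<A>) (\<lambda>(p, q). tens (NC \<A>) (\<pi> p \<rhd> a) (\<pi> q \<rhd> b)) (qclass (NC \<D>) (D.H.DC d d' d'')) =
        qclass (NC \<A>) (A.extC (\<pi> d) (gen (\<pi> d' \<rhd> a, \<pi> d'' \<rhd> b)))"
      unfolding D.\<Delta>C_eq_DC by (simp only: A.\<Delta>C_ext_qclass tens_def)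
    from qlift_value[OF csubspace_NC this u, of "\<lambda>(p, q). gen (\<pi> p \<rhd> a, \<pi> q \<rhd> b)"]
    have "qclass (NC \<A>) (eval2 (\<lambda>p q. gen (\<pi> p \<rhd> a, \<pi> q \<rhd> b)) u) =
        qclass (NC \<A>) (A.extC (\<pi> d) (gen (\<pi> d' \<rhd> a, \<pi> d'' \<rhd> b)))"
      by (auto simp: eval2_def tens_def qclass_self csubspace_NC)
    then show ?thesis by (simp add: qclass_NC_eq_iff eval2_eval2)
  qed
  show "eval2 (\<lambda>p q. tenC \<A> (\<pi> p \<rhd> a) (\<pi> q \<rhd> b)) (D.H.DC d d' d'') =
      eval2 (tenC \<A>) (A.extC (\<pi> d) (gen (\<pi> d' \<rhd> a, \<pi> d'' \<rhd> b)))"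
    by (rule *) (rule qclass_self[OF csubspace_NC])
  have "eval2 (\<lambda>p q. tenC \<A> (\<pi> p \<rhd> a) (\<pi> q \<rhd> b)) n = 0" if "n \<in> relations2 (balC \<D>)" for n
    using *[of "D.H.DC 0 0 0 + n" 0 0 0] *[of "D.H.DC 0 0 0" 0 0 0] that
    by (simp add: mem_qclass NC_def[symmetric] qclass_self csubspace_NC eval2_rules complex_vector.subspace_0)
  from balanced_clinear[OF clinear_eval2 this]
  show "balanced (balC \<D>) (\<lambda>p q. tenC \<A> (\<pi> p \<rhd> a) (\<pi> q \<rhd> b))" by simp
qed

lemma eval2_cong_tenB:
  assumes "balanced (balB \<A>) f" "eval2 (tenB \<A>) u = eval2 (tenB \<A>) v"
  shows "eval2 f u = eval2 f v"
  by (rule eval2_cong_tensor[OF tensor_product_tenB assms])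

lemma eval2_cong_tenC:
  assumes "balanced (balC \<A>) f" "eval2 (tenC \<A>) u = eval2 (tenC \<A>) v"
  shows "eval2 f u = eval2 f v"
  by (rule eval2_cong_tensor[OF tensor_product_tenC assms])

lemma balanced_B_\<pi>:
  assumes "balanced (balB \<A>) f"
  shows "balanced (balB \<D>) (\<lambda>p q. f (a \<lhd> \<pi> p) (b \<lhd> \<pi> q))"
proof (rule balanced_balB_I)
  show "clinear (\<lambda>q. f (a \<lhd> \<pi> p) (b \<lhd> \<pi> q))" for p
    by (intro clinear_compose[OF balancedD(1)[OF assms]] lin)
  show "clinear (\<lambda>p. f (a \<lhd> \<pi> p) (b \<lhd> \<pi> q))" for q
    by (intro clinear_compose[OF balancedD(2)[OF assms]] lin)
  show "f (a \<lhd> \<pi> (p \<lhd> x)) (b \<lhd> \<pi> q) = f (a \<lhd> \<pi> p) (b \<lhd> \<pi> (q \<lhd> tB \<D> x))" if "x \<in> baseB \<D>" for x p q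
    using eval2_cong_tenB[OF assms, of "gen (a \<lhd> \<pi> (p \<lhd> x), b \<lhd> \<pi> q)" "gen (a \<lhd> \<pi> p, b \<lhd> \<pi> (q \<lhd> tB \<D> x))"]
      balanced_balB_D[OF morphism_B(2) that] by simp
qed

lemma balanced_C_\<pi>:
  assumes "balanced (balC \<A>) f"
  shows "balanced (balC \<D>) (\<lambda>p q. f (\<pi> p \<rhd> a) (\<pi> q \<rhd> b))"
proof (rule balanced_balC_I)
  show "clinear (\<lambda>q. f (\<pi> p \<rhd> a) (\<pi> q \<rhd> b))" for p
    by (intro clinear_compose[OF balancedD(1)[OF assms]] lin)
  show "clinear (\<lambda>p. f (\<pi> p \<rhd> a) (\<pi> q \<rhd> b))" for q
    by (intro clinear_compose[OF balancedD(2)[OF assms]] lin)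
  show "f (\<pi> (tC \<D> y \<rhd> p) \<rhd> a) (\<pi> q \<rhd> b) = f (\<pi> p \<rhd> a) (\<pi> (y \<rhd> q) \<rhd> b)" if "y \<in> baseC \<D>" for y p q
    using eval2_cong_tenC[OF assms, of "gen (\<pi> (tC \<D> y \<rhd> p) \<rhd> a, \<pi> q \<rhd> b)" "gen (\<pi> p \<rhd> a, \<pi> (y \<rhd> q) \<rhd> b)"]
      balanced_balC_D[OF morphism_C(2) that] by simp
qed

abbreviation \<pi>' :: "'d multiplier \<Rightarrow> 'a multiplier"
  where "\<pi>' \<equiv> extend_hom \<pi>"

lemma \<pi>'_la: "\<pi>' T \<rhd> \<pi> d \<rhd> a = \<pi> (T \<rhd> d) \<rhd> a" "\<pi> d \<rhd> \<pi>' T \<rhd> a = \<pi> (d \<lhd> T) \<rhd> a"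
  by (simp_all add: mult_left_simps(6)[symmetric] mult_right_simps(6)[symmetric]
      extend_hom[OF nondegenerate_\<pi> nd_A] del: mult_left_simps(6) mult_right_simps(6))

text \<open>
  The image \<open>\<pi>(y)\<close> is a multiplier of \<open>C\<close>.  It commutes with \<open>B\<close> because elements of \<open>C\<close> do, and \<open>C\<close> acts
  non-degenerately on \<open>A\<close>.
\<close>

lemma \<pi>'_base:
  assumes "y \<in> baseC \<D>"
  shows "c \<in> baseC \<A> \<Longrightarrow> \<pi>' y * c \<in> baseC \<A>" "c \<in> baseC \<A> \<Longrightarrow> c * \<pi>' y \<in> baseC \<A>"
    and "x \<in> baseB \<A> \<Longrightarrow> x * \<pi>' y = \<pi>' y * x"
proof -
  have sp: "cspan {\<pi>' y * c |y c. y \<in> baseC \<D> \<and> c \<in> baseC \<A>} = baseC \<A>"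
    "cspan {c * \<pi>' y |y c. y \<in> baseC \<D> \<and> c \<in> baseC \<A>} = baseC \<A>"
    using morphism unfolding morphism_def by blast+
  show left: "\<pi>' y * c \<in> baseC \<A>" if "c \<in> baseC \<A>" for c
    using complex_vector.span_base[of "\<pi>' y * c" "{\<pi>' y * c |y c. y \<in> baseC \<D> \<and> c \<in> baseC \<A>}"] assms that
    unfolding sp by blast
  show "c * \<pi>' y \<in> baseC \<A>" if "c \<in> baseC \<A>" for c
    using complex_vector.span_base[of "c * \<pi>' y" "{c * \<pi>' y |y c. y \<in> baseC \<D> \<and> c \<in> baseC \<A>}"] assms that
    unfolding sp by blast
  show "x * \<pi>' y = \<pi>' y * x" if x: "x \<in> baseB \<A>" for x
  proof (rule multiplier_eq_left[OF A.bialgebroid])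
    fix a
    show "(x * \<pi>' y) \<rhd> a = (\<pi>' y * x) \<rhd> a"
    proof (rule clinear_eq_on_span[OF clinear_mult_left clinear_mult_left base_span(1)[OF A.bialgebroid, of "baseC \<A>"]])
      fix b assume "b \<in> {c \<rhd> a |c a. c \<in> baseC \<A>}"
      then obtain c a where c: "b = c \<rhd> a" "c \<in> baseC \<A>" by blast
      have "x * \<pi>' y * c = \<pi>' y * x * c"
        using base_commute[OF A.bialgebroid x c(2)] base_commute[OF A.bialgebroid x left[OF c(2)]]
        by (metis mult.assoc)
      then show "(x * \<pi>' y) \<rhd> b = (\<pi>' y * x) \<rhd> b"
        unfolding c mult_left_simps(6)[symmetric] by simp
    qed simp
  qed
qed

text \<open>
  Apply \<open>\<epsilon>\<^sub>C \<otimes> \<iota>\<close> to \<open>\<Delta>\<^sub>C(c \<pi>(d))(1 \<otimes> \<pi>(d'')) = \<Delta>\<^sub>C(c)(\<pi> \<otimes> \<pi>)(\<Delta>\<^sub>C(d)(1 \<otimes> d''))\<close>.  As the elements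
  \<open>\<Delta>\<^sub>C(d)(1 \<otimes> d'')\<close> span the tensor product for \<open>\<D>\<close>, this gives
  \<open>(\<epsilon>\<^sub>C \<otimes> \<iota>)(\<Delta>\<^sub>C(c)(\<pi>(p) \<otimes> b)) = c \<pi>(\<epsilon>\<^sub>C(p)) b\<close> for all \<open>p\<close> and \<open>b\<close>.  The right-hand side equals
  \<open>(\<epsilon>\<^sub>C \<otimes> \<iota>)(\<Delta>\<^sub>C(c)(\<pi>(\<epsilon>\<^sub>C(p)) \<otimes> b))\<close>, and as the elements \<open>\<Delta>\<^sub>C(c)(1 \<otimes> b)\<close> span the tensor product for
  \<open>\<A>\<close>, the factors \<open>\<pi>(p)\<close> and \<open>\<pi>(\<epsilon>\<^sub>C(p))\<close> have the same effect in the argument of \<open>\<epsilon>\<^sub>C\<close>.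
\<close>

lemma counit_morphism:
  "eC (c \<lhd> \<pi> p) \<rhd> s = eC (c \<lhd> \<pi>' (\<delta>C p)) \<rhd> s"
proof -
  have bal: "balanced (balC \<A>) (\<lambda>r s. eC (r \<lhd> T) \<rhd> s)" for T
    by (intro balanced_balC_I lin) (simp add: left_right_commute[OF A.bialgebroid] A.H.eC_la_t)
  have eq_C1: "eval2 (tenC \<A>) u = eval2 (tenC \<A>) v"
    if "\<And>f. eval2 (\<lambda>p q. tenC \<A> (p * f) q) u = eval2 (\<lambda>p q. tenC \<A> (p * f) q) v" for u v
    using that by (rule A.H.eq_C1)
  have step: "eval2 (\<lambda>r s. eC (r \<lhd> \<pi> p) \<rhd> s) (dC2 \<A> c (\<pi> q \<rhd> a)) = c * (\<pi> (\<delta>C p \<rhd> q) \<rhd> a)" for c p q a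
  proof -
    define G1 where "G1 p q = eval2 (\<lambda>r s. eC (r \<lhd> \<pi> p) \<rhd> s) (dC2 \<A> c (\<pi> q \<rhd> a))" for p q
    define G2 where "G2 p q = c * (\<pi> (\<delta>C p \<rhd> q) \<rhd> a)" for p q
    have cover: "eval2 (\<lambda>r s. tenC \<A> ((r \<lhd> \<pi> p) * f) s) (dC2 \<A> c (\<pi> q \<rhd> a)) =
        eval2 (tenC \<A>) (A.H.DC c (\<pi> p \<rhd> f) (\<pi> q \<rhd> a))" for p q f
      by (simp add: A.H.eval2_DC mult_right_left)
    have balDC: "balanced (balC \<A>) (\<lambda>r s. eval2 (tenC \<A>) (A.H.DC c r s))" for c
      using A.H.balanced_DC[OF balanced_tenC[of \<A>, folded A.RC_eq]] by (simp only: A.RC_eq)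
    have "G1 p q - G2 p q = 0" for p q
    proof (rule D.H.canonical_eq_0[of "\<lambda>p q. G1 p q - G2 p q"])
      have "balanced (balC \<D>) G1"
      proof (rule balanced_balC_I)
        show "clinear (G1 p)" for p
          unfolding G1_def
          by (intro clinear_compose[OF A.H.clinear_dC2_eval(2)] lin) (simp add: A.RC_eq bal)
        show "clinear (\<lambda>p. G1 p q)" for q
          unfolding G1_def by (intro lin)
        show "G1 (tC \<D> y \<rhd> p) q = G1 p (y \<rhd> q)" if "y \<in> baseC \<D>" for y p q
        proof -
          have "eval2 (tenC \<A>) (eval2 (\<lambda>r s. gen (r \<lhd> \<pi> (tC \<D> y \<rhd> p), s)) (dC2 \<A> c (\<pi> q \<rhd> a))) =
              eval2 (tenC \<A>) (eval2 (\<lambda>r s. gen (r \<lhd> \<pi> p, s)) (dC2 \<A> c (\<pi> (y \<rhd> q) \<rhd> a)))"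
            using balanced_balC_D[OF balanced_C_\<pi>[OF balDC] that]
            by (intro eq_C1) (simp add: eval2_eval2 cover)
          from eval2_cong_tenC[OF bal[of 1] this] show ?thesis
            by (simp add: G1_def eval2_eval2)
        qed
      qed
      moreover have "balanced (balC \<D>) G2"
        unfolding G2_def by (intro balanced_balC_I lin) (simp add: D.H.eC_la_t)
      ultimately show "balanced D.H.RC (\<lambda>p q. G1 p q - G2 p q)"
        unfolding D.RC_eq by (rule balanced_diff)
      fix d d''
      have "eval2 (tenC \<A>) (eval2 (\<lambda>p q. eval2 (\<lambda>r s. gen (r \<lhd> \<pi> p, s)) (dC2 \<A> c (\<pi> q \<rhd> a))) (dC2 \<D> d d'')) =
          eval2 (tenC \<A>) (dC2 \<A> (c \<lhd> \<pi> d) (\<pi> d'' \<rhd> a))"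
      proof (rule eq_C1)
        fix f
        have "eval2 (\<lambda>p q. eval2 (tenC \<A>) (A.H.DC c (\<pi> p \<rhd> f) (\<pi> q \<rhd> a))) (dC2 \<D> d d'') =
            eval2 (tenC \<A>) (A.H.DC (c \<lhd> \<pi> d) f (\<pi> d'' \<rhd> a))" (is "?l f = ?r f")
        proof (rule clinear_eq_on_span[of ?l ?r, OF _ _ \<pi>_rules(3)])
          show "clinear ?l"
            by (intro clinear_eval2_fun clinear_compose[OF balancedD(2)[OF balDC]] lin)
          show "clinear ?r"
            by (rule balancedD(2)[OF balDC])
          fix x assume "x \<in> {\<pi> d' \<rhd> a' |d' a'. True}"
          then obtain d' a' where x: "x = \<pi> d' \<rhd> a'" by blast
          have "?l x = eval2 (\<lambda>p q. eval2 (tenC \<A>) (A.H.DC c (\<pi> p \<rhd> a') (\<pi> q \<rhd> a))) (D.H.DC d d' d'')"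
            by (simp add: D.H.eval2_DC x \<pi>_la)
          also have "\<dots> = eval2 (\<lambda>r s. eval2 (tenC \<A>) (A.H.DC c r s))
              (eval2 (\<lambda>p q. gen (\<pi> p \<rhd> a', \<pi> q \<rhd> a)) (D.H.DC d d' d''))"
            by (simp add: eval2_eval2)
          also have "\<dots> = eval2 (\<lambda>r s. eval2 (tenC \<A>) (A.H.DC c r s))
              (A.extC (\<pi> d) (gen (\<pi> d' \<rhd> a', \<pi> d'' \<rhd> a)))"
            by (rule eval2_cong_tenC[OF balDC]) (simp add: eval2_eval2 morphism_C(1))
          also have "\<dots> = ?r x"
            unfolding A.extC_def A.H.DC_ext[OF balanced_tenC[of \<A>, folded A.RC_eq]] by (simp add: x)
          finally show "?l x = ?r x" .
        qed
        then show "eval2 (\<lambda>p q. tenC \<A> (p * f) q)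
            (eval2 (\<lambda>p q. eval2 (\<lambda>r s. gen (r \<lhd> \<pi> p, s)) (dC2 \<A> c (\<pi> q \<rhd> a))) (dC2 \<D> d d'')) =
          eval2 (\<lambda>p q. tenC \<A> (p * f) q) (dC2 \<A> (c \<lhd> \<pi> d) (\<pi> d'' \<rhd> a))"
          by (simp add: eval2_eval2 cover) (simp add: A.H.eval2_DC)
      qed
      from eval2_cong_tenC[OF bal[of 1] this]
      have "eval2 G1 (dC2 \<D> d d'') = (c \<lhd> \<pi> d) * (\<pi> d'' \<rhd> a)"
        by (simp add: G1_def[abs_def] eval2_eval2 A.H.counit_C2)
      also have "\<dots> = c * (\<pi> (d * d'') \<rhd> a)"
        by (simp add: mult_right_left \<pi>_la)
      also have "\<dots> = eval2 G2 (dC2 \<D> d d'')"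
        unfolding G2_def D.H.counit_C2[of d d'', symmetric]
        by (rule clinear_apply_eval2) (intro lin)
      finally show "eval2 (\<lambda>p q. G1 p q - G2 p q) (dC2 \<D> d d'') = 0"
        by (simp add: eval2_diff_fun)
    qed
    then show ?thesis by (simp add: G1_def G2_def)
  qed
  define y where "y = \<pi>' (\<delta>C p)"
  have step': "eval2 (\<lambda>r s. eC (r \<lhd> \<pi> p) \<rhd> s) (dC2 \<A> c b) = c * (y \<rhd> b)" for c b
  proof (rule clinear_eq_on_span[of _ "\<lambda>b. c * (y \<rhd> b)", OF _ _ \<pi>_rules(3)])
    show "clinear (\<lambda>b. eval2 (\<lambda>r s. eC (r \<lhd> \<pi> p) \<rhd> s) (dC2 \<A> c b))"
      by (rule A.H.clinear_dC2_eval(2)) (simp only: A.RC_eq bal)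
    show "clinear (\<lambda>b. c * (y \<rhd> b))" by (intro lin)
    show "eval2 (\<lambda>r s. eC (r \<lhd> \<pi> p) \<rhd> s) (dC2 \<A> c x) = c * (y \<rhd> x)"
      if "x \<in> {\<pi> d \<rhd> a |d a. True}" for x
      using that by (auto simp: step y_def \<pi>'_la)
  qed
  have y: "eval2 (\<lambda>r s. eC (r \<lhd> y) \<rhd> s) (dC2 \<A> c b) = c * (y \<rhd> b)" for c b
  proof -
    have "eval2 (tenC \<A>) (dC2 \<A> (c \<lhd> y) b) = eval2 (tenC \<A>) (eval2 (\<lambda>r s. gen (r \<lhd> y, s)) (dC2 \<A> c b))"
      using \<Delta>C_right_C[OF A.bialgebroid, of y c _ b] \<pi>'_base(2)[OF D.H.eC_range]
      by (intro eq_C1) (simp add: y_def \<Delta>C2_rep(2)[OF A.bialgebroid] eval2_eval2 mult_right_left)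
    from eval2_cong_tenC[OF bal[of 1] this] show ?thesis
      by (simp add: eval2_eval2 A.H.counit_C2 mult_right_left)
  qed
  have "eC (c \<lhd> \<pi> p) \<rhd> s - eC (c \<lhd> y) \<rhd> s = 0"
    by (rule A.H.canonical_eq_0[of "\<lambda>r s. eC (r \<lhd> \<pi> p) \<rhd> s - eC (r \<lhd> y) \<rhd> s"])
      (simp_all add: A.RC_eq balanced_diff bal eval2_diff_fun step' y)
  then show ?thesis by (simp add: y_def)
qed

lemma balanced_antipode_A: "balanced (balB \<A>) (\<lambda>p q. p * S q)"
  by (intro balanced_balB_I lin) (simp add: A.H.S_ra_tB mult_right_left)

lemma antipode_DB: "eval2 (\<lambda>p q. p * S q) (A.DB c a b) = a * (eC c \<rhd> S b)"
proof -
  have "eval2 (\<lambda>p q. p * S q) (A.DB c a b) = eval2 (\<lambda>p q. (p * S q) * S b) (dB1 \<A> a c)"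
    by (simp add: A.DB_def eval2_eval2 A.H.S_mult mult.assoc)
  also have "\<dots> = (a \<lhd> eC c) * S b"
    unfolding A.H.antipode_B1[symmetric] by (rule clinear_apply_eval2[symmetric]) (intro lin)
  finally show ?thesis by (simp add: mult_right_left)
qed

text \<open>
  Let \<open>y = \<pi>(\<epsilon>\<^sub>C(d))\<close>.  By \<open>counit_morphism\<close>, \<open>\<Delta>\<^sub>B(c \<pi>(d))\<close> and \<open>\<Delta>\<^sub>B(c y) = \<Delta>\<^sub>B(c)(y \<otimes> 1)\<close> have the same
  image under \<open>p \<otimes> q \<mapsto> p S(q)\<close>.  As elements \<open>(a \<otimes> b)\<Delta>\<^sub>B(c)\<close> span the tensor product, \<open>\<Delta>\<^sub>B(\<pi>(d))\<close>
  followed by this map is \<open>p \<otimes> q \<mapsto> p y S(q)\<close>.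
\<close>

lemma antipode_extB: "eval2 (\<lambda>p q. p * S q) (A.extB (\<pi> d) (gen (a, b))) = (a \<lhd> \<pi>' (\<delta>C d)) * S b"
proof -
  define y where "y = \<pi>' (\<delta>C d)"
  let ?f = "\<lambda>p q. eval2 (\<lambda>p q. p * S q) (A.extB (\<pi> d) (gen (p, q))) - (p \<lhd> y) * S q"
  have y: "x * y = y * x" if "x \<in> baseB \<A>" for x
    unfolding y_def by (rule \<pi>'_base(3)[OF D.H.eC_range that])
  have y': "z * y \<in> baseC \<A>" if "z \<in> baseC \<A>" for z
    unfolding y_def by (rule \<pi>'_base(2)[OF D.H.eC_range that])
  have bal: "balanced (balB \<A>) (\<lambda>p q. (p \<lhd> y) * S q)"
  proof (intro balanced_balB_I lin)
    fix x a b assume x: "x \<in> baseB \<A>"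
    have "a \<lhd> x \<lhd> y = a \<lhd> y \<lhd> x"
      using y[OF x] by (metis mult_right_simps(6))
    then show "(a \<lhd> x \<lhd> y) * S b = (a \<lhd> y) * S (b \<lhd> tB \<A> x)"
      by (simp add: A.H.S_ra_tB[OF x] mult_right_left)
  qed
  have "?f a b = 0"
  proof (rule A.DB_eq_0[of ?f])
    show "balanced (balB \<A>) ?f"
      by (rule balanced_diff[OF A.balanced_extB[OF balanced_antipode_A] bal])
    fix c p q
    have extB: "eval2 (\<lambda>p q. eval2 (\<lambda>p q. p * S q) (A.extB (\<pi> d) (gen (p, q)))) u =
        eval2 (\<lambda>p q. p * S q) (A.extB (\<pi> d) u)" for u
      by (rule clinear_tensor2_eq_eval2[symmetric, OF clinear_compose[OF clinear_eval2 A.clinear_extB]])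
    have "eval2 (tenB \<A>) (A.DB (c \<lhd> y) p q) = eval2 (tenB \<A>) (eval2 (\<lambda>p q. gen (p \<lhd> y, q)) (A.DB c p q))"
    proof -
      have balT: "balanced (balB \<A>) (\<lambda>p q. tenB \<A> (p \<lhd> y) q)"
        by (rule balanced_tenB_left[OF A.bialgebroid y])
      have "eval2 (tenB \<A>) (A.DB (c \<lhd> y) p q) = val (NB \<A>) (\<Delta>B \<A> (c \<lhd> y) (tens (NB \<A>) p q))"
        by (simp only: A.\<Delta>B_eq_DB val_qclass_NB)
      also have "\<dots> = eval2 (\<lambda>p q. tenB \<A> (p \<lhd> y) q) (val (NB \<A>) (\<Delta>B \<A> c (tens (NB \<A>) p q)))"
        by (rule \<Delta>B_right_C[OF A.bialgebroid y' y])
      also have "\<dots> = eval2 (\<lambda>p q. tenB \<A> (p \<lhd> y) q) (A.DB c p q)"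
        unfolding A.\<Delta>B_eq_DB val_qclass[OF csubspace_NB]
        using eval2_proj[OF balT] by (simp only: NB_def)
      finally show ?thesis by (simp add: eval2_eval2)
    qed
    from eval2_cong_tenB[OF balanced_antipode_A this]
    have "eval2 (\<lambda>p q. (p \<lhd> y) * S q) (A.DB c p q) = p * (eC (c \<lhd> y) \<rhd> S q)"
      by (simp add: eval2_eval2 antipode_DB)
    also have "\<dots> = p * (eC (c \<lhd> \<pi> d) \<rhd> S q)"
      by (simp add: counit_morphism y_def)
    also have "\<dots> = eval2 (\<lambda>p q. p * S q) (A.extB (\<pi> d) (A.DB c p q))"
      by (simp add: A.extB_DB[OF balanced_antipode_A] antipode_DB)
    finally show "eval2 ?f (A.DB c p q) = 0"
      by (simp add: eval2_diff_fun extB)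
  qed
  then show ?thesis by (simp add: y_def)
qed

text \<open>
  The identity \<open>\<pi>(d\<^sup>1) S(\<pi>(d\<^sup>2)) = \<pi>(\<epsilon>\<^sub>C(d))\<close>, multiplied by \<open>S(g \<pi>(c))\<close> from the right.
\<close>

lemma antipode_morphism:
  "eval2 (\<lambda>p q. \<pi> p \<rhd> S (g \<lhd> \<pi> q)) (dB2 \<D> c d) = \<pi>' (\<delta>C d) \<rhd> S (g \<lhd> \<pi> c)"
proof (rule eq_from_right[OF A.bialgebroid])
  fix b
  let ?l = "eval2 (\<lambda>p q. \<pi> p \<rhd> S (g \<lhd> \<pi> q)) (dB2 \<D> c d)" and ?r = "\<pi>' (\<delta>C d) \<rhd> S (g \<lhd> \<pi> c)"
  show "b * ?l = b * ?r"
  proof (rule clinear_eq_on_span[OF clinear_times_right clinear_times_right \<pi>_rules(4)])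
    fix x assume "x \<in> {a \<lhd> \<pi> d' |a d'. True}"
    then obtain a d' where x: "x = a \<lhd> \<pi> d'" by blast
    let ?f = "\<lambda>p q. (a \<lhd> \<pi> p) * S (g \<lhd> \<pi> q)"
    have bal: "balanced (balB \<D>) ?f"
      by (rule balanced_B_\<pi>[OF balanced_antipode_A])
    have "x * ?l = eval2 (\<lambda>p q. ?f (d' * p) q) (dB2 \<D> c d)"
      by (subst clinear_apply_eval2[OF clinear_times_left]) (simp add: x mult_right_left \<pi>_la)
    also have "\<dots> = eval2 ?f (D.DB d d' c)"
      using D.H.dB12_eval[OF bal[folded D.RB_eq]] by (simp add: D.DB_def eval2_eval2)
    also have "\<dots> = eval2 (\<lambda>p q. p * S q) (eval2 (\<lambda>p q. gen (a \<lhd> \<pi> p, g \<lhd> \<pi> q)) (D.DB d d' c))"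
      by (simp add: eval2_eval2)
    also have "\<dots> = eval2 (\<lambda>p q. p * S q) (A.extB (\<pi> d) (gen (a \<lhd> \<pi> d', g \<lhd> \<pi> c)))"
      by (rule eval2_cong_tenB[OF balanced_antipode_A]) (simp add: eval2_eval2 morphism_B(1))
    also have "\<dots> = x * ?r"
      by (simp add: antipode_extB x mult_right_left)
    finally show "x * ?l = x * ?r" .
  qed
qed

lemma antipode_D_C1: "eval2 (\<lambda>r s. S\<^sub>D r * s) (dC1 \<D> p a) = S\<^sub>D a \<lhd> \<delta>B p"
  using D.M.antipode_B2[of p a] by simp

text \<open>
  Mixed coassociativity in \<open>\<D>\<close> is evaluated by \<open>r \<otimes> s \<otimes> q \<mapsto> \<pi>(S(r)) \<pi>(s) S(g \<pi>(q))\<close>, with the element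
  \<open>b\<close> covered by \<open>a\<close> on the first leg and by \<open>c\<close> on the last.  One side equals
  \<open>\<pi>(S(a)) S(g \<pi>(c b))\<close> and the other \<open>\<pi>(S(b a)) S(g \<pi>(c))\<close>; cancel \<open>\<pi>(S(a))\<close>, and use that elements
  \<open>g \<pi>(c)\<close> span \<open>A\<close>.
\<close>

lemma antipode_\<pi>: "\<pi> (S\<^sub>D b) \<rhd> S k = S (k \<lhd> \<pi> b)"
proof -
  have key: "\<pi> (S\<^sub>D a) \<rhd> \<pi> (S\<^sub>D b) \<rhd> S (g \<lhd> \<pi> c) = \<pi> (S\<^sub>D a) \<rhd> S (g \<lhd> \<pi> c \<lhd> \<pi> b)" for a c g
  proof -
    define \<Phi> where "\<Phi> r s q = \<pi> (S\<^sub>D r) \<rhd> \<pi> s \<rhd> S (g \<lhd> \<pi> q)" for r s q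
    \<comment> \<open>Base elements move between \<open>\<pi>(s)\<close> and \<open>S(g \<pi>(q))\<close>, since \<open>p \<otimes> q \<mapsto> a \<pi>(p) S(g \<pi>(q))\<close> is balanced.\<close>
    have slide: "\<pi> (s \<lhd> x) \<rhd> S (g \<lhd> \<pi> q) = \<pi> s \<rhd> S (g \<lhd> \<pi> (q \<lhd> tB \<D> x))" if "x \<in> baseB \<D>" for s x q
    proof (rule eq_from_right[OF A.bialgebroid])
      fix b
      from balanced_balB_D[OF balanced_B_\<pi>[OF balanced_antipode_A] that, of b s g q]
      show "b * (\<pi> (s \<lhd> x) \<rhd> S (g \<lhd> \<pi> q)) = b * (\<pi> s \<rhd> S (g \<lhd> \<pi> (q \<lhd> tB \<D> x)))"
        by (simp add: mult_right_left)
    qed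
    have right: "eval2 (\<Phi> p) (dB2 \<D> c q) = \<pi> (S\<^sub>D p \<lhd> \<delta>C q) \<rhd> S (g \<lhd> \<pi> c)" for p q
    proof -
      have "eval2 (\<Phi> p) (dB2 \<D> c q) = \<pi> (S\<^sub>D p) \<rhd> eval2 (\<lambda>s q. \<pi> s \<rhd> S (g \<lhd> \<pi> q)) (dB2 \<D> c q)"
        by (simp add: \<Phi>_def[abs_def] clinear_apply_eval2[OF clinear_mult_left])
      then show ?thesis by (simp add: antipode_morphism \<pi>'_la)
    qed
    have left: "eval2 (\<lambda>r s. \<Phi> r s q) (dC1 \<D> p a) = \<pi> (S\<^sub>D a) \<rhd> S (g \<lhd> \<pi> (q \<lhd> tB \<D> (\<delta>B p)))" for p q
    proof -
      have "eval2 (\<lambda>r s. \<Phi> r s q) (dC1 \<D> p a) = \<pi> (eval2 (\<lambda>r s. S\<^sub>D r * s) (dC1 \<D> p a)) \<rhd> S (g \<lhd> \<pi> q)"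
        unfolding \<Phi>_def \<pi>_la by (rule clinear_apply_eval2[symmetric]) (intro lin)
      then show ?thesis by (simp add: antipode_D_C1 slide D.H.eB_range)
    qed
    have "eval2 (\<lambda>p q. eval2 (\<lambda>r s. \<Phi> r s q) (dC1 \<D> p a)) (dB2 \<D> c b) =
        eval2 (\<lambda>p q. eval2 (\<Phi> p) (dB2 \<D> c q)) (dC1 \<D> b a)"
    proof (rule coassoc_CB[OF D.bialgebroid])
      show "balanced (balC \<D>) (\<lambda>r s. \<Phi> r s q)" for q
        unfolding \<Phi>_def \<pi>_la
        by (intro balanced_balC_I lin) (simp add: D.H.S_la_tC mult_right_left)
      show "balanced (balB \<D>) (\<Phi> p)" for p
        unfolding \<Phi>_def by (intro balanced_balB_I lin) (simp add: slide)
      show "balanced (balC \<D>) (\<lambda>p q. eval2 (\<Phi> p) (dB2 \<D> c q)) \<or>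
          balanced (balB \<D>) (\<lambda>p q. eval2 (\<lambda>r s. \<Phi> r s q) (dC1 \<D> p a))"
      proof (intro disjI1 balanced_balC_I; unfold right)
        show "clinear (\<lambda>q. \<pi> (S\<^sub>D p \<lhd> \<delta>C q) \<rhd> S (g \<lhd> \<pi> c))" for p
        proof -
          have "clinear \<delta>C" using D.left_counit by (simp add: left_counit_def)
          then show ?thesis by (intro lin)
        qed
        show "clinear (\<lambda>p. \<pi> (S\<^sub>D p \<lhd> \<delta>C q) \<rhd> S (g \<lhd> \<pi> c))" for q
          by (intro lin)
        show "\<pi> (S\<^sub>D (tC \<D> y \<rhd> p) \<lhd> \<delta>C q) \<rhd> S (g \<lhd> \<pi> c) = \<pi> (S\<^sub>D p \<lhd> \<delta>C (y \<rhd> q)) \<rhd> S (g \<lhd> \<pi> c)"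
          if "y \<in> baseC \<D>" for y p q
        proof -
          have "\<delta>C (y \<rhd> q) = y * \<delta>C q"
            using D.left_counit that unfolding left_counit_def by blast
          then show ?thesis by (simp add: D.H.S_la_tC that)
        qed
      qed
    qed
    moreover have "eval2 (\<lambda>p q. \<pi> (S\<^sub>D a) \<rhd> S (g \<lhd> \<pi> (q \<lhd> tB \<D> (\<delta>B p)))) (dB2 \<D> c b) =
        \<pi> (S\<^sub>D a) \<rhd> S (g \<lhd> \<pi> (c * b))"
      unfolding D.H.counit_B2[symmetric] by (rule clinear_apply_eval2[symmetric]) (intro lin)
    moreover have "eval2 (\<lambda>p q. \<pi> (S\<^sub>D (tC \<D> (\<delta>C q) \<rhd> p)) \<rhd> S (g \<lhd> \<pi> c)) (dC1 \<D> b a) =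
        \<pi> (S\<^sub>D (b * a)) \<rhd> S (g \<lhd> \<pi> c)"
      unfolding D.H.counit_C1[symmetric] by (rule clinear_apply_eval2[symmetric]) (intro lin)
    ultimately show ?thesis
      by (simp add: left right D.H.S_la_tC D.H.eC_range D.H.S_mult \<pi>_rules(2))
  qed
  have surj: "\<exists>a. d = S\<^sub>D a" for d
    using D.H.S_S' by metis
  show ?thesis
  proof (rule clinear_eq_on_span[of "\<lambda>k. \<pi> (S\<^sub>D b) \<rhd> S k" "\<lambda>k. S (k \<lhd> \<pi> b)", OF _ _ \<pi>_rules(4)])
    show "clinear (\<lambda>k. \<pi> (S\<^sub>D b) \<rhd> S k)" "clinear (\<lambda>k. S (k \<lhd> \<pi> b))"
      by (intro lin)+
    fix x assume "x \<in> {g \<lhd> \<pi> c |g c. True}"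
    then obtain g c where x: "x = g \<lhd> \<pi> c" by blast
    show "\<pi> (S\<^sub>D b) \<rhd> S x = S (x \<lhd> \<pi> b)"
    proof (rule hom_cancel_left[OF nondegenerate_\<pi> nd_A])
      fix d
      obtain a where "d = S\<^sub>D a" using surj by blast
      then show "\<pi> d \<rhd> \<pi> (S\<^sub>D b) \<rhd> S x = \<pi> d \<rhd> S (x \<lhd> \<pi> b)"
        unfolding x by (simp only: key)
    qed
  qed
qed

lemma antipode_comp: "\<pi> (S\<^sub>D b) = extend_anti S (\<pi> b)"
proof (rule multiplier_eq_left[OF A.bialgebroid])
  fix a
  have "anti_isomorphism UNIV UNIV S"
    using A.antipode by (simp add: antipode_wrt_def)
  from extend_anti(1)[OF this nd_A, of "\<pi> b" "inv S a"]
  show "\<pi> (S\<^sub>D b) \<rhd> a = extend_anti S (\<pi> b) \<rhd> a"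
    using antipode_\<pi>[of b "inv S a"] by (simp add: A.H.S_S')
qed

end

theorem theorem4p2p3:
  fixes \<A> :: "'a::complex_algebra bialgebroid"
    and \<D> :: "'d::complex_algebra bialgebroid"
    and S\<^sub>A :: "'a \<Rightarrow> 'a" and S\<^sub>D :: "'d \<Rightarrow> 'd"
    and \<pi> :: "'d \<Rightarrow> 'a multiplier"
  assumes "regular_multiplier_Hopf_algebroid \<A>"
    and "regular_multiplier_Hopf_algebroid \<D>"
    and "antipode \<A> S\<^sub>A"
    and "antipode \<D> S\<^sub>D"
    and "morphism \<D> \<A> \<pi>"
  shows "\<pi> \<circ> S\<^sub>D = extend_anti S\<^sub>A \<circ> \<pi>"
proof -
  obtain eC eB where A: "left_counit \<A> eC" "right_counit \<A> eB" "antipode_wrt \<A> eC eB S\<^sub>A"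
    using assms(3) unfolding antipode_def by blast
  obtain \<delta>C \<delta>B where D: "left_counit \<D> \<delta>C" "right_counit \<D> \<delta>B" "antipode_wrt \<D> \<delta>C \<delta>B S\<^sub>D"
    using assms(4) unfolding antipode_def by blast
  interpret Hopf_morphism \<A> eC eB S\<^sub>A \<D> \<delta>C \<delta>B S\<^sub>D \<pi>
    using assms(1,2,5) A D
    by (intro Hopf_morphism.intro Hopf_bialgebroid.intro Hopf_morphism_axioms.intro)
      (simp_all add: regular_multiplier_Hopf_algebroid_def)
  show ?thesis
    by (rule ext) (simp add: antipode_comp)
qed

end
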